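(* Let $k$ be a field, let $\mathcal{C}$ be a connected Schurian $k$-category with a base object $c_0$, let $X$ be a connected grading of $\mathcal{C}$ by a group $\Gamma_X$, let $u=\{{}_xu_{c_0}\}_{x\in\mathcal{C}_0}$ be a set of connector walks for $X$ at $c_0$, and let $Z_{X,u}$ be the connected grading of $\mathcal{C}$ by $\pi_1(CW(\mathcal{C}),c_0)$ determined by $\deg_{Z_{X,u}}{}_ye_x=[\,{}_yu_{c_0}^{-1}\,{}_ye_x\,{}_xu_{c_0}]$. Then $X$ is a quotient of $Z_{X,u}$ through a unique group map; that is, there is a unique surjective group homomorphism $\varphi:\pi_1(CW(\mathcal{C}),c_0)\to\Gamma_X$ such that for all objects $x,y$ and all $s\in\Gamma_X$ $$X^s{}_y\mathcal{C}_x=\bigoplus_{\varphi(r)=s}Z_{X,u}^r\,{}_y\mathcal{C}_x .$$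
   Context: A $k$-category is a small category $\mathcal{C}$ (object set $\mathcal{C}_0$) such that each morphism set ${}_y\mathcal{C}_x$ from $x$ to $y$ is a $k$-vector space, composition is $k$-bilinear, and the $k$-multiples of the identity of each object are central in its endomorphism ring. Walks. Each non-zero morphism $f$ from $x$ to $y$ gives two virtual morphisms: $(f,1)$ with source $x$ and target $y$ (identified with $f$), and $(f,-1)$ with source $y$ and target $x$. A walk from $x$ to $y$ is a sequence $w=(f_n,\epsilon_n),\dots,(f_1,\epsilon_1)$ of virtual morphisms such that the target of $(f_i,\epsilon_i)$ is the source of $(f_{i+1},\epsilon_{i+1})$, the source of $(f_1,\epsilon_1)$ is $x$ and the target of $(f_n,\epsilon_n)$ is $y$; its inverse is $w^{-1}=(f_1,-\epsilon_1),\dots,(f_n,-\epsilon_n)$. A $k$-category is connected if for every pair of objects $(x,y)$ there is a walk from $x$ to $y$. Gradings. A grading $X$ of $\mathcal{C}$ by a group $\Gamma_X$ is a decomposition ${}_y\mathcal{C}_x=\bigoplus_{s\in\Gamma_X}X^s{}_y\mathcal{C}_x$ for all $x,y$, with $X^t{}_z\mathcal{C}_y\,X^s{}_y\mathcal{C}_x\subset X^{ts}{}_z\mathcal{C}_x$. A non-zero $f\in X^s{}_y\mathcal{C}_x$ is homogeneous with $\deg_Xf=s$; set $\deg_X(f,1)=\deg_Xf$, $\deg_X(f,-1)=(\deg_Xf)^{-1}$. A homogeneous walk is a walk $w=(f_n,\epsilon_n),\dots,(f_1,\epsilon_1)$ with all $f_i$ homogeneous, and $\deg_Xw=\deg_X(f_n,\epsilon_n)\cdots\deg_X(f_1,\epsilon_1)$.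 The grading is connected if for all objects $x,y$ and all $s\in\Gamma_X$ there is a homogeneous walk from $x$ to $y$ of degree $s$. Connector walks. A set of connector walks for $X$ at $c_0$ is a family $u=\{{}_xu_{c_0}\}_{x\in\mathcal{C}_0}$ of homogeneous walks, ${}_xu_{c_0}$ going from $c_0$ to $x$, with $\deg_X{}_xu_{c_0}=1$ and ${}_{c_0}u_{c_0}$ the identity of $c_0$. Schurian. $\mathcal{C}$ is Schurian if each ${}_y\mathcal{C}_x$ has dimension $0$ or $1$ over $k$. Fix a non-zero element ${}_ye_x$ in each one-dimensional ${}_y\mathcal{C}_x$, with ${}_xe_x$ the identity of $x$. The CW-complex $CW(\mathcal{C})$ of a Schurian $\mathcal{C}$ is the $2$-dimensional CW-complex with: - $0$-cells: the objects of $\mathcal{C}$; - $1$-cells: one for each ${}_ye_x$ with $x\neq y$ (again denoted ${}_ye_x$), attached to $x$ and $y$ (so if ${}_y\mathcal{C}_x\ne 0\ne{}_x\mathcal{C}_y$ there are two $1$-cells between $x$ and $y$); - for each ordered triple $(x,y,z)$ of pairwise distinct objects such that ${}_y\mathcal{C}_x$, ${}_z\mathcal{C}_y$ and ${}_z\mathcal{C}_x$ are non-zero and ${}_ze_y\,{}_ye_x\neq 0$, one $2$-cell attached along ${}_ye_x$, ${}_ze_y$, ${}_ze_x$ (making the path ${}_ye_x$ followed by ${}_ze_y$ homotopic to ${}_ze_x$); - for each unordered pair of distinct objects $x,y$ such that ${}_y\mathcal{C}_x$ and ${}_x\mathcal{C}_y$ are non-zero and ${}_xe_y\,{}_ye_x\neq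 0$ (equivalently ${}_ye_x\,{}_xe_y\neq 0$), exactly one $2$-cell attached along ${}_ye_x$ and ${}_xe_y$ (making the loop ${}_ye_x$ followed by ${}_xe_y$ null-homotopic). Loops. A closed walk $w=(f_n,\epsilon_n),\dots,(f_1,\epsilon_1)$ at $c_0$ describes a loop in $CW(\mathcal{C})$: on $[\frac{i-1}{n},\frac in]$ it traverses the $1$-cell of $f_i$ (the cell ${}_ye_x$ if $0\neq f_i\in{}_y\mathcal{C}_x$, constant if $x=y$) from the source to the target of $(f_i,\epsilon_i)$. Its class in $\pi_1(CW(\mathcal{C}),c_0)$ is $[w]$. Products in $\pi_1$ are written like walks, right to left: $[w][w']$ is the class of $w'$ followed by $w$. Since each ${}_y\mathcal{C}_x$ is at most one-dimensional, a grading of $\mathcal{C}$ is determined by the degrees of the ${}_ye_x$. *)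

theory Defs
  imports "HOL-Analysis.Analysis" "HOL-Algebra.Module"
begin

section \<open>Vector spaces\<close>

text \<open>
  A vector space over a field \<open>K\<close> is a module over \<open>K\<close> in the sense of HOL-Algebra. (The record type
  of modules also carries multiplicative fields; they play no role.)
\<close>

definition has_dimension :: "'k ring \<Rightarrow> ('k, 'm) module \<Rightarrow> nat \<Rightarrow> bool" where
  "has_dimension K M n \<longleftrightarrow>
     (\<exists>B. finite B \<and> card B = n \<and> B \<subseteq> carrier M \<and>
        (\<forall>v \<in> carrier M. \<exists>!a. a \<in> B \<rightarrow>\<^sub>E carrier K \<and> v = (\<Oplus>\<^bsub>M\<^esub>b\<in>B. a b \<odot>\<^bsub>M\<^esub> b)))"

text \<open>\<open>V\<close> is the internal direct sum, inside \<open>M\<close>, of the subspaces \<open>A i\<close>, \<open>i \<in> I\<close>; \<open>I\<close> may be infinite.\<close>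

definition is_direct_sum ::
    "'k ring \<Rightarrow> ('k, 'm) module \<Rightarrow> 'i set \<Rightarrow> ('i \<Rightarrow> 'm set) \<Rightarrow> 'm set \<Rightarrow> bool" where
  "is_direct_sum K M I A V \<longleftrightarrow>
     (\<forall>i \<in> I. submodule (A i) K M) \<and>
     V = {(\<Oplus>\<^bsub>M\<^esub>i\<in>F. a i) | F a. finite F \<and> F \<subseteq> I \<and> (\<forall>i \<in> F. a i \<in> A i)} \<and>
     (\<forall>F a. finite F \<and> F \<subseteq> I \<and> (\<forall>i \<in> F. a i \<in> A i) \<and> (\<Oplus>\<^bsub>M\<^esub>i\<in>F. a i) = \<zero>\<^bsub>M\<^esub> \<longrightarrow>
        (\<forall>i \<in> F. a i = \<zero>\<^bsub>M\<^esub>))"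


section \<open>Linear categories\<close>

text \<open>
  \<open>Mor C x y\<close> is the space of morphisms from \<open>x\<close> to \<open>y\<close>, and \<open>Cmp C x y z g f\<close> is the composite
  \<open>g f\<close> of \<open>f\<close> from \<open>x\<close> to \<open>y\<close> and \<open>g\<close> from \<open>y\<close> to \<open>z\<close>. Different morphism spaces need not have
  disjoint carriers: a morphism is always considered together with its source and target.
\<close>

record ('o, 'k, 'm) kcat =
  Obj :: "'o set"
  Mor :: "'o \<Rightarrow> 'o \<Rightarrow> ('k, 'm) module"
  Cmp :: "'o \<Rightarrow> 'o \<Rightarrow> 'o \<Rightarrow> 'm \<Rightarrow> 'm \<Rightarrow> 'm"
  Idn :: "'o \<Rightarrow> 'm"

locale k_category = field K for K :: "'k ring" +
  fixes C :: "('o, 'k, 'm) kcat"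
  assumes mor_space: "\<lbrakk>x \<in> Obj C; y \<in> Obj C\<rbrakk> \<Longrightarrow> module K (Mor C x y)"
    and id_closed: "x \<in> Obj C \<Longrightarrow> Idn C x \<in> carrier (Mor C x x)"
    and comp_closed:
      "\<lbrakk>x \<in> Obj C; y \<in> Obj C; z \<in> Obj C; f \<in> carrier (Mor C x y); g \<in> carrier (Mor C y z)\<rbrakk>
       \<Longrightarrow> Cmp C x y z g f \<in> carrier (Mor C x z)"
    and comp_assoc:
      "\<lbrakk>w \<in> Obj C; x \<in> Obj C; y \<in> Obj C; z \<in> Obj C;
        f \<in> carrier (Mor C w x); g \<in> carrier (Mor C x y); h \<in> carrier (Mor C y z)\<rbrakk>
       \<Longrightarrow> Cmp C w x z (Cmp C x y z h g) f = Cmp C w y z h (Cmp C w x y g f)"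
    and comp_id_right:
      "\<lbrakk>x \<in> Obj C; y \<in> Obj C; f \<in> carrier (Mor C x y)\<rbrakk> \<Longrightarrow> Cmp C x x y f (Idn C x) = f"
    and comp_id_left:
      "\<lbrakk>x \<in> Obj C; y \<in> Obj C; f \<in> carrier (Mor C x y)\<rbrakk> \<Longrightarrow> Cmp C x y y (Idn C y) f = f"
    and comp_add_left:
      "\<lbrakk>x \<in> Obj C; y \<in> Obj C; z \<in> Obj C;
        f \<in> carrier (Mor C x y); g \<in> carrier (Mor C y z); g' \<in> carrier (Mor C y z)\<rbrakk>
       \<Longrightarrow> Cmp C x y z (g \<oplus>\<^bsub>Mor C y z\<^esub> g') f = Cmp C x y z g f \<oplus>\<^bsub>Mor C x z\<^esub> Cmp C x y z g' f"
    and comp_add_right: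
      "\<lbrakk>x \<in> Obj C; y \<in> Obj C; z \<in> Obj C;
        f \<in> carrier (Mor C x y); f' \<in> carrier (Mor C x y); g \<in> carrier (Mor C y z)\<rbrakk>
       \<Longrightarrow> Cmp C x y z g (f \<oplus>\<^bsub>Mor C x y\<^esub> f') = Cmp C x y z g f \<oplus>\<^bsub>Mor C x z\<^esub> Cmp C x y z g f'"
    and comp_smult_left:
      "\<lbrakk>x \<in> Obj C; y \<in> Obj C; z \<in> Obj C; a \<in> carrier K;
        f \<in> carrier (Mor C x y); g \<in> carrier (Mor C y z)\<rbrakk>
       \<Longrightarrow> Cmp C x y z (a \<odot>\<^bsub>Mor C y z\<^esub> g) f = a \<odot>\<^bsub>Mor C x z\<^esub> Cmp C x y z g f"
    and comp_smult_right:
      "\<lbrakk>x \<in> Obj C; y \<in> Obj C; z \<in> Obj C; a \<in> carrier K;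
        f \<in> carrier (Mor C x y); g \<in> carrier (Mor C y z)\<rbrakk>
       \<Longrightarrow> Cmp C x y z g (a \<odot>\<^bsub>Mor C x y\<^esub> f) = a \<odot>\<^bsub>Mor C x z\<^esub> Cmp C x y z g f"
    and smult_id_central:
      "\<lbrakk>x \<in> Obj C; a \<in> carrier K; f \<in> carrier (Mor C x x)\<rbrakk>
       \<Longrightarrow> Cmp C x x x (a \<odot>\<^bsub>Mor C x x\<^esub> Idn C x) f = Cmp C x x x f (a \<odot>\<^bsub>Mor C x x\<^esub> Idn C x)"

definition nonzero_mor :: "('o, 'k, 'm) kcat \<Rightarrow> 'o \<Rightarrow> 'o \<Rightarrow> 'm \<Rightarrow> bool" where
  "nonzero_mor C x y f \<longleftrightarrow>
     x \<in> Obj C \<and> y \<in> Obj C \<and> f \<in> carrier (Mor C x y) \<and> f \<noteq> \<zero>\<^bsub>Mor C x y\<^esub>"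

definition nonzero_space :: "('o, 'k, 'm) kcat \<Rightarrow> 'o \<Rightarrow> 'o \<Rightarrow> bool" where
  "nonzero_space C x y \<longleftrightarrow> (\<exists>f. nonzero_mor C x y f)"

definition schurian :: "'k ring \<Rightarrow> ('o, 'k, 'm) kcat \<Rightarrow> bool" where
  "schurian K C \<longleftrightarrow>
     (\<forall>x \<in> Obj C. \<forall>y \<in> Obj C. has_dimension K (Mor C x y) 0 \<or> has_dimension K (Mor C x y) 1)"

text \<open>\<open>e x y\<close> is the chosen morphism from \<open>x\<close> to \<open>y\<close>; it is unconstrained where the space is zero.\<close>

definition basis_choice :: "('o, 'k, 'm) kcat \<Rightarrow> ('o \<Rightarrow> 'o \<Rightarrow> 'm) \<Rightarrow> bool" where
  "basis_choice C e \<longleftrightarrow>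
     (\<forall>x \<in> Obj C. \<forall>y \<in> Obj C. nonzero_space C x y \<longrightarrow> nonzero_mor C x y (e x y)) \<and>
     (\<forall>x \<in> Obj C. nonzero_space C x x \<longrightarrow> e x x = Idn C x)"


section \<open>Walks\<close>

text \<open>For \<open>f\<close> from \<open>x\<close> to \<open>y\<close>, \<open>Pos x y f\<close> is the virtual morphism \<open>(f, 1)\<close>, \<open>Neg x y f\<close> is \<open>(f, -1)\<close>.\<close>

datatype ('o, 'm) virt = Pos 'o 'o 'm | Neg 'o 'o 'm

fun vsource :: "('o, 'm) virt \<Rightarrow> 'o" where
  "vsource (Pos x y f) = x"
| "vsource (Neg x y f) = y"

fun vtarget :: "('o, 'm) virt \<Rightarrow> 'o" where
  "vtarget (Pos x y f) = y"
| "vtarget (Neg x y f) = x"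

fun vinverse :: "('o, 'm) virt \<Rightarrow> ('o, 'm) virt" where
  "vinverse (Pos x y f) = Neg x y f"
| "vinverse (Neg x y f) = Pos x y f"

fun is_virtual :: "('o, 'k, 'm) kcat \<Rightarrow> ('o, 'm) virt \<Rightarrow> bool" where
  "is_virtual C (Pos x y f) = nonzero_mor C x y f"
| "is_virtual C (Neg x y f) = nonzero_mor C x y f"

text \<open>
  A walk \<open>v\<^sub>n, \<dots>, v\<^sub>1\<close> is the list \<open>[v\<^sub>n, \<dots>, v\<^sub>1]\<close>: it is traversed from the last entry of the list
  to its head, so that \<open>w' @ w\<close> is \<open>w\<close> followed by \<open>w'\<close>. Walks are nonempty.
\<close>

definition is_walk :: "('o, 'k, 'm) kcat \<Rightarrow> 'o \<Rightarrow> 'o \<Rightarrow> ('o, 'm) virt list \<Rightarrow> bool" where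
  "is_walk C x y w \<longleftrightarrow>
     w \<noteq> [] \<and> (\<forall>v \<in> set w. is_virtual C v) \<and>
     (\<forall>i. Suc i < length w \<longrightarrow> vtarget (w ! Suc i) = vsource (w ! i)) \<and>
     vsource (last w) = x \<and> vtarget (hd w) = y"

definition walk_inverse :: "('o, 'm) virt list \<Rightarrow> ('o, 'm) virt list" where
  "walk_inverse w = rev (map vinverse w)"

definition connected_category :: "('o, 'k, 'm) kcat \<Rightarrow> bool" where
  "connected_category C \<longleftrightarrow> (\<forall>x \<in> Obj C. \<forall>y \<in> Obj C. \<exists>w. is_walk C x y w)"


section \<open>Gradings\<close>

text \<open>\<open>X s x y\<close> is the component of degree \<open>s\<close> of the space of morphisms from \<open>x\<close> to \<open>y\<close>.\<close>

definition is_grading ::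
    "'k ring \<Rightarrow> ('o, 'k, 'm) kcat \<Rightarrow> ('g, 'h) monoid_scheme \<Rightarrow> ('g \<Rightarrow> 'o \<Rightarrow> 'o \<Rightarrow> 'm set) \<Rightarrow> bool" where
  "is_grading K C G X \<longleftrightarrow>
     (\<forall>x \<in> Obj C. \<forall>y \<in> Obj C.
        is_direct_sum K (Mor C x y) (carrier G) (\<lambda>s. X s x y) (carrier (Mor C x y))) \<and>
     (\<forall>x \<in> Obj C. \<forall>y \<in> Obj C. \<forall>z \<in> Obj C. \<forall>s \<in> carrier G. \<forall>t \<in> carrier G.
        \<forall>f \<in> X s x y. \<forall>g \<in> X t y z. Cmp C x y z g f \<in> X (t \<otimes>\<^bsub>G\<^esub> s) x z)"

definition degree_of ::
    "('g, 'h) monoid_scheme \<Rightarrow> ('g \<Rightarrow> 'o \<Rightarrow> 'o \<Rightarrow> 'm set) \<Rightarrow> 'o \<Rightarrow> 'o \<Rightarrow> 'm \<Rightarrow> 'g" where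
  "degree_of G X x y f = (THE s. s \<in> carrier G \<and> f \<in> X s x y)"

fun vhomogeneous ::
    "('g, 'h) monoid_scheme \<Rightarrow> ('g \<Rightarrow> 'o \<Rightarrow> 'o \<Rightarrow> 'm set) \<Rightarrow> ('o, 'm) virt \<Rightarrow> bool" where
  "vhomogeneous G X (Pos x y f) = (\<exists>s \<in> carrier G. f \<in> X s x y)"
| "vhomogeneous G X (Neg x y f) = (\<exists>s \<in> carrier G. f \<in> X s x y)"

fun vdegree ::
    "('g, 'h) monoid_scheme \<Rightarrow> ('g \<Rightarrow> 'o \<Rightarrow> 'o \<Rightarrow> 'm set) \<Rightarrow> ('o, 'm) virt \<Rightarrow> 'g" where
  "vdegree G X (Pos x y f) = degree_of G X x y f"
| "vdegree G X (Neg x y f) = inv\<^bsub>G\<^esub> (degree_of G X x y f)"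

definition is_homogeneous_walk ::
    "('o, 'k, 'm) kcat \<Rightarrow> ('g, 'h) monoid_scheme \<Rightarrow> ('g \<Rightarrow> 'o \<Rightarrow> 'o \<Rightarrow> 'm set) \<Rightarrow>
     'o \<Rightarrow> 'o \<Rightarrow> ('o, 'm) virt list \<Rightarrow> bool" where
  "is_homogeneous_walk C G X x y w \<longleftrightarrow> is_walk C x y w \<and> (\<forall>v \<in> set w. vhomogeneous G X v)"

definition walk_degree ::
    "('g, 'h) monoid_scheme \<Rightarrow> ('g \<Rightarrow> 'o \<Rightarrow> 'o \<Rightarrow> 'm set) \<Rightarrow> ('o, 'm) virt list \<Rightarrow> 'g" where
  "walk_degree G X w = foldr (\<lambda>v d. vdegree G X v \<otimes>\<^bsub>G\<^esub> d) w \<one>\<^bsub>G\<^esub>"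

definition connected_grading ::
    "('o, 'k, 'm) kcat \<Rightarrow> ('g, 'h) monoid_scheme \<Rightarrow> ('g \<Rightarrow> 'o \<Rightarrow> 'o \<Rightarrow> 'm set) \<Rightarrow> bool" where
  "connected_grading C G X \<longleftrightarrow>
     (\<forall>x \<in> Obj C. \<forall>y \<in> Obj C. \<forall>s \<in> carrier G.
        \<exists>w. is_homogeneous_walk C G X x y w \<and> walk_degree G X w = s)"

definition connector_walks ::
    "('o, 'k, 'm) kcat \<Rightarrow> ('g, 'h) monoid_scheme \<Rightarrow> ('g \<Rightarrow> 'o \<Rightarrow> 'o \<Rightarrow> 'm set) \<Rightarrow> 'o \<Rightarrow>
     ('o \<Rightarrow> ('o, 'm) virt list) \<Rightarrow> bool" where
  "connector_walks C G X c\<^sub>0 u \<longleftrightarrow>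
     (\<forall>x \<in> Obj C. is_homogeneous_walk C G X c\<^sub>0 x (u x) \<and> walk_degree G X (u x) = \<one>\<^bsub>G\<^esub>) \<and>
     u c\<^sub>0 = [Pos c\<^sub>0 c\<^sub>0 (Idn C c\<^sub>0)]"


section \<open>The CW-complex of a Schurian category\<close>

text \<open>
  The 2-cells: \<open>Tri x y z\<close> for the triples, \<open>Bi {x, y}\<close> for the unordered pairs.
  A point of the complex is a 0-cell, or a point \<open>EdgePt x y t\<close>, \<open>0 < t < 1\<close>, of the open 1-cell
  from \<open>x\<close> to \<open>y\<close>, or a point \<open>FacePt c z\<close>, \<open>|z| < 1\<close>, of the open 2-cell \<open>c\<close>.
\<close>

datatype 'o face = Tri 'o 'o 'o | Bi "'o set"

datatype 'o cw_point = Vertex 'o | EdgePt 'o 'o real | FacePt "'o face" complex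

definition cw_edges :: "('o, 'k, 'm) kcat \<Rightarrow> ('o \<times> 'o) set" where
  "cw_edges C = {(x, y). x \<in> Obj C \<and> y \<in> Obj C \<and> x \<noteq> y \<and> nonzero_space C x y}"

definition cw_faces :: "('o, 'k, 'm) kcat \<Rightarrow> ('o \<Rightarrow> 'o \<Rightarrow> 'm) \<Rightarrow> 'o face set" where
  "cw_faces C e =
     {Tri x y z | x y z. x \<in> Obj C \<and> y \<in> Obj C \<and> z \<in> Obj C \<and> x \<noteq> y \<and> y \<noteq> z \<and> x \<noteq> z \<and>
        nonzero_space C x y \<and> nonzero_space C y z \<and> nonzero_space C x z \<and>
        Cmp C x y z (e y z) (e x y) \<noteq> \<zero>\<^bsub>Mor C x z\<^esub>} \<union>
     {Bi {x, y} | x y. x \<in> Obj C \<and> y \<in> Obj C \<and> x \<noteq> y \<and>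
        nonzero_space C x y \<and> nonzero_space C y x \<and>
        Cmp C x y x (e y x) (e x y) \<noteq> \<zero>\<^bsub>Mor C x x\<^esub>}"

definition cw_points :: "('o, 'k, 'm) kcat \<Rightarrow> ('o \<Rightarrow> 'o \<Rightarrow> 'm) \<Rightarrow> 'o cw_point set" where
  "cw_points C e =
     Vertex ` Obj C \<union>
     {EdgePt x y t | x y t. (x, y) \<in> cw_edges C \<and> 0 < t \<and> t < 1} \<union>
     {FacePt c z | c z. c \<in> cw_faces C e \<and> norm z < 1}"

text \<open>Characteristic map \<open>[0, 1] \<rightarrow> CW(C)\<close> of the 1-cell from \<open>x\<close> to \<open>y\<close>.\<close>

definition edge_map :: "'o \<Rightarrow> 'o \<Rightarrow> real \<Rightarrow> 'o cw_point" where
  "edge_map x y t = (if t \<le> 0 then Vertex x else if t \<ge> 1 then Vertex y else EdgePt x y t)"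

fun virt_path :: "('o, 'm) virt \<Rightarrow> real \<Rightarrow> 'o cw_point" where
  "virt_path (Pos x y f) t = (if x = y then Vertex x else edge_map x y t)"
| "virt_path (Neg x y f) t = (if x = y then Vertex x else edge_map x y (1 - t))"

text \<open>
  The path described by a walk \<open>w = [v\<^sub>n, \<dots>, v\<^sub>1]\<close>: on \<open>[i/n, (i+1)/n]\<close>, \<open>0 \<le> i < n\<close>, it traverses
  \<open>v\<^bsub>i+1\<^esub> = rev w ! i\<close> at constant speed.
\<close>

definition walk_path :: "('o, 'm) virt list \<Rightarrow> real \<Rightarrow> 'o cw_point" where
  "walk_path w t =
     (let n = length w; i = min (n - 1) (nat \<lfloor>real n * t\<rfloor>)
      in virt_path (rev w ! i) (real n * t - real i))"

text \<open>
  The boundary walk of a 2-cell. For an unordered pair the starting point is chosen arbitrarily;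
  the other choice amounts to a half-turn of the disc.
\<close>

fun face_boundary :: "('o \<Rightarrow> 'o \<Rightarrow> 'm) \<Rightarrow> 'o face \<Rightarrow> ('o, 'm) virt list" where
  "face_boundary e (Tri x y z) = [Neg x z (e x z), Pos y z (e y z), Pos x y (e x y)]"
| "face_boundary e (Bi p) =
     (let (x, y) = (SOME q. p = {fst q, snd q}) in [Pos y x (e y x), Pos x y (e x y)])"

text \<open>
  Characteristic map of a 2-cell on the closed unit disc; on the unit circle it is the attaching map
  \<open>exp (2 \<pi> i t) \<mapsto>\<close> (boundary walk at time \<open>t\<close>).
\<close>

definition face_map :: "('o \<Rightarrow> 'o \<Rightarrow> 'm) \<Rightarrow> 'o face \<Rightarrow> complex \<Rightarrow> 'o cw_point" where
  "face_map e c z =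
     (if norm z < 1 then FacePt c z else walk_path (face_boundary e c) (Arg2pi z / (2 * pi)))"

text \<open>
  The weak topology: a set is open iff its preimage under every characteristic map is open. This is
  the quotient topology of the disjoint union of all closed cells along the attaching maps.
\<close>

definition cw_open ::
    "('o, 'k, 'm) kcat \<Rightarrow> ('o \<Rightarrow> 'o \<Rightarrow> 'm) \<Rightarrow> 'o cw_point set \<Rightarrow> bool" where
  "cw_open C e U \<longleftrightarrow>
     U \<subseteq> cw_points C e \<and>
     (\<forall>(x, y) \<in> cw_edges C. openin (top_of_set {0..1}) {t \<in> {0..1}. edge_map x y t \<in> U}) \<and>
     (\<forall>c \<in> cw_faces C e. openin (top_of_set (cball 0 1)) {z \<in> cball 0 1. face_map e c z \<in> U})"

definition CW :: "('o, 'k, 'm) kcat \<Rightarrow> ('o \<Rightarrow> 'o \<Rightarrow> 'm) \<Rightarrow> 'o cw_point topology" where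
  "CW C e = topology (cw_open C e)"

lemma istopology_cw_open: "istopology (cw_open C e)"
  unfolding istopology_def
proof (intro conjI allI impI)
  fix S T assume S: "cw_open C e S" and T: "cw_open C e T"
  have *: "{t \<in> D. f t \<in> S \<inter> T} = {t \<in> D. f t \<in> S} \<inter> {t \<in> D. f t \<in> T}"
    for f :: "'x \<Rightarrow> 'a cw_point" and D by auto
  show "cw_open C e (S \<inter> T)"
    using S T unfolding cw_open_def * by (auto intro: openin_Int)
next
  fix \<U> assume U: "\<forall>S \<in> \<U>. cw_open C e S"
  have *: "{t \<in> D. f t \<in> \<Union>\<U>} = \<Union> ((\<lambda>S. {t \<in> D. f t \<in> S}) ` \<U>)"
    for f :: "'x \<Rightarrow> 'a cw_point" and D by auto
  show "cw_open C e (\<Union>\<U>)"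
    using U unfolding cw_open_def * by (fastforce intro!: openin_Union)
qed

lemma openin_CW: "openin (CW C e) U \<longleftrightarrow> cw_open C e U"
  by (simp add: CW_def istopology_cw_open)


section \<open>The fundamental group\<close>

definition loops_at :: "'a topology \<Rightarrow> 'a \<Rightarrow> (real \<Rightarrow> 'a) set" where
  "loops_at T a = {p. pathin T p \<and> p 0 = a \<and> p 1 = a}"

definition loop_homotopic :: "'a topology \<Rightarrow> 'a \<Rightarrow> (real \<Rightarrow> 'a) \<Rightarrow> (real \<Rightarrow> 'a) \<Rightarrow> bool" where
  "loop_homotopic T a p q \<longleftrightarrow>
     homotopic_with (\<lambda>h. h 0 = a \<and> h 1 = a) (top_of_set {0..1}) T p q"

definition loop_class :: "'a topology \<Rightarrow> 'a \<Rightarrow> (real \<Rightarrow> 'a) \<Rightarrow> (real \<Rightarrow> 'a) set" where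
  "loop_class T a p = {q \<in> loops_at T a. loop_homotopic T a p q}"

text \<open>\<open>p\<close> followed by \<open>q\<close>; \<open>joinpaths\<close> of the library is restricted to topological type classes.\<close>

definition path_then :: "(real \<Rightarrow> 'a) \<Rightarrow> (real \<Rightarrow> 'a) \<Rightarrow> real \<Rightarrow> 'a" where
  "path_then p q t = (if t \<le> 1 / 2 then p (2 * t) else q (2 * t - 1))"

text \<open>Products are written right to left: the product of \<open>[p]\<close> and \<open>[q]\<close> is \<open>[q followed by p]\<close>.\<close>

definition fundamental_group :: "'a topology \<Rightarrow> 'a \<Rightarrow> (real \<Rightarrow> 'a) set monoid" where
  "fundamental_group T a =
     \<lparr>carrier = loop_class T a ` loops_at T a,
      mult = (\<lambda>A B. \<Union>p\<in>A. \<Union>q\<in>B. loop_class T a (path_then q p)),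
      one = loop_class T a (\<lambda>t. a)\<rparr>"

definition pi1_CW ::
    "('o, 'k, 'm) kcat \<Rightarrow> ('o \<Rightarrow> 'o \<Rightarrow> 'm) \<Rightarrow> 'o \<Rightarrow> (real \<Rightarrow> 'o cw_point) set monoid" where
  "pi1_CW C e c\<^sub>0 = fundamental_group (CW C e) (Vertex c\<^sub>0)"

definition walk_class ::
    "('o, 'k, 'm) kcat \<Rightarrow> ('o \<Rightarrow> 'o \<Rightarrow> 'm) \<Rightarrow> 'o \<Rightarrow> ('o, 'm) virt list \<Rightarrow>
     (real \<Rightarrow> 'o cw_point) set" where
  "walk_class C e c\<^sub>0 w = loop_class (CW C e) (Vertex c\<^sub>0) (walk_path w)"


section \<open>The grading by the fundamental group\<close>

text \<open>
  The grading determined by giving \<open>e x y\<close> the degree \<open>[u\<^sub>y\<^sup>-\<^sup>1 (e x y) u\<^sub>x]\<close>: morphism spaces being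
  at most one-dimensional, each one is concentrated in that single degree. That this is a connected
  grading is a property of the construction, not part of the definition.
\<close>

definition Z_grading ::
    "('o, 'k, 'm) kcat \<Rightarrow> ('o \<Rightarrow> 'o \<Rightarrow> 'm) \<Rightarrow> 'o \<Rightarrow> ('o \<Rightarrow> ('o, 'm) virt list) \<Rightarrow>
     (real \<Rightarrow> 'o cw_point) set \<Rightarrow> 'o \<Rightarrow> 'o \<Rightarrow> 'm set" where
  "Z_grading C e c\<^sub>0 u r x y =
     (if r = walk_class C e c\<^sub>0 (walk_inverse (u y) @ [Pos x y (e x y)] @ u x)
      then carrier (Mor C x y) else {\<zero>\<^bsub>Mor C x y\<^esub>})"

end

theory Submission
  imports Defs
begin

text \<open>
  Both halves of the statement rest on the cell structure of the complex. Existence: sending every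
  open cell to its starting vertex, the degrees of the basis morphisms form a locally constant
  cocycle on the open stars of the cells, precisely because they satisfy one relation per 2-cell.
  Paths and squares lift uniquely along it (the lifts are the sections of the associated
  covering), so the total degree of a loop depends only on its homotopy class. Uniqueness: two
  homomorphisms that agree on the classes \<open>[u\<^sub>y\<^sup>-\<^sup>1 e u\<^sub>x]\<close> agree on every path closed up by the connector
  walks, because such paths can locally be pushed radially out of the 2-cells into the graph, and
  inside the graph into edges. The degrees \<open>[u\<^sub>y\<^sup>-\<^sup>1 e u\<^sub>x]\<close> are prescribed by the grading \<open>X\<close>.
\<close>

section \<open>Homotopy of paths\<close>

text \<open>Each half replaces a global construction by a property of paths that is checked locally.
  A vertex may lie on infinitely many cells and the topology is the weak one, so everything is
  pulled back to \<open>{0..1}\<close> or to the unit square and settled there by bisection: lifts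
  are glued from small rectangles, and agreement of two homomorphisms is assembled from subpaths.
  For existence, a lift is a function into the group that is constant up to transport. The remaining
  freedom is a right factor, so \<open>L 1 \<otimes> inv (L 0)\<close> is well defined, and it is
  multiplicative in the right-to-left order of walks. For uniqueness, \<open>lam\<close> closes up
  an arbitrary path by base paths that follow a connector walk to the starting vertex of a cell and
  then run straight inside that cell. These base paths do not vary continuously with the point; what
  counts is that \<open>lam\<close> is multiplicative and homotopy invariant. The straight parts
  become trivial, so paths inside one edge reduce to the full edge. A disc reduces to its boundary
  arcs, since a segment that ends on the circle can be moved to an arc.\<close>

definition path_from_to :: "'a topology \<Rightarrow> 'a \<Rightarrow> 'a \<Rightarrow> (real \<Rightarrow> 'a) \<Rightarrow> bool" where
  "path_from_to T a b p \<longleftrightarrow> pathin T p \<and> p 0 = a \<and> p 1 = b"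

definition path_homotopic :: "'a topology \<Rightarrow> 'a \<Rightarrow> 'a \<Rightarrow> (real \<Rightarrow> 'a) \<Rightarrow> (real \<Rightarrow> 'a) \<Rightarrow> bool" where
  "path_homotopic T a b p q \<longleftrightarrow>
     homotopic_with (\<lambda>h. h 0 = a \<and> h 1 = b) (top_of_set {0..1}) T p q"

definition rev_path :: "(real \<Rightarrow> 'a) \<Rightarrow> real \<Rightarrow> 'a" where
  "rev_path p t = p (1 - t)"

lemma path_homotopic_imp:
  assumes "path_homotopic T a b p q"
  shows "path_from_to T a b p" "path_from_to T a b q"
  using homotopic_with_imp_continuous_maps[OF assms[unfolded path_homotopic_def]]
    homotopic_with_imp_property[OF assms[unfolded path_homotopic_def]]
  by (auto simp: path_from_to_def pathin_def)

lemma path_homotopic_refl: "path_from_to T a b p \<Longrightarrow> path_homotopic T a b p p"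
  by (auto simp: path_from_to_def pathin_def path_homotopic_def)

lemma path_homotopic_sym: "path_homotopic T a b p q \<Longrightarrow> path_homotopic T a b q p"
  unfolding path_homotopic_def by (rule homotopic_with_symD)

lemma path_homotopic_trans [trans]:
  "path_homotopic T a b p q \<Longrightarrow> path_homotopic T a b q r \<Longrightarrow> path_homotopic T a b p r"
  unfolding path_homotopic_def by (rule homotopic_with_trans)

text \<open>A path is a total function on the reals, and two formulas for the same path often
  disagree outside \<open>{0..1}\<close>; such differences are absorbed here.\<close>

lemma path_homotopic_equal:
  assumes "path_from_to T a b p" and "\<And>t. t \<in> {0..1} \<Longrightarrow> p t = q t"
  shows "path_homotopic T a b p q"
  unfolding path_homotopic_def
  using assms by (intro homotopic_with_equal) (auto simp: path_from_to_def pathin_def)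

lemma path_from_to_cong:
  assumes "path_from_to T a b p" and "\<And>t. t \<in> {0..1} \<Longrightarrow> p t = q t"
  shows "path_from_to T a b q"
  using path_homotopic_imp(2)[OF path_homotopic_equal[OF assms]] .

lemma path_from_to_const: "a \<in> topspace T \<Longrightarrow> path_from_to T a a (\<lambda>_. a)"
  by (auto simp: path_from_to_def)

lemma continuous_map_real_comp:
  assumes "continuous_map (top_of_set S) T Q" "continuous_on D f" "f ` D \<subseteq> S"
  shows "continuous_map (top_of_set D) T (\<lambda>x. Q (f x))"
proof -
  have "continuous_map (top_of_set D) (top_of_set S) f"
    using assms(2,3) by (auto simp: continuous_map_subtopology_eu)
  from continuous_map_compose[OF this assms(1)] show ?thesis by (simp add: o_def)
qed

lemma path_from_to_comp:
  assumes "continuous_map (top_of_set S) T Q" "continuous_on {0..1} f" "f ` {0..1} \<subseteq> S"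
  shows "path_from_to T (Q (f 0)) (Q (f 1)) (\<lambda>t. Q (f t))"
  using continuous_map_real_comp[OF assms] by (simp add: path_from_to_def pathin_def)

lemma path_from_to_rev:
  assumes "path_from_to T a b p" shows "path_from_to T b a (rev_path p)"
proof -
  have "continuous_map (top_of_set {0..1}) T (\<lambda>x. p (1 - x))"
    using assms
    by (intro continuous_map_real_comp[where S = "{0..1}" and Q = p and f = "\<lambda>x. 1 - x"])
      (auto simp: path_from_to_def pathin_def intro!: continuous_intros)
  then show ?thesis using assms by (auto simp: path_from_to_def pathin_def rev_path_def[abs_def])
qed

text \<open>The straight-line homotopy between \<open>f\<close> and \<open>g\<close> stays in the
  convex set \<open>S\<close> and is pushed forward by \<open>Q\<close>. With \<open>Q\<close> a
  path this gives changes of time, with \<open>Q\<close> a characteristic map it deforms paths in a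
  closed cell, and with \<open>Q\<close> a homotopy it compares the sides of a square.\<close>

lemma path_homotopic_convex:
  fixes Q :: "'b::real_normed_vector \<Rightarrow> 'a" and f g :: "real \<Rightarrow> 'b"
  assumes Q: "continuous_map (top_of_set S) T Q" and "convex S"
    and f: "continuous_on {0..1} f" "f ` {0..1} \<subseteq> S"
    and g: "continuous_on {0..1} g" "g ` {0..1} \<subseteq> S"
    and "f 0 = g 0" "f 1 = g 1"
    and p: "\<And>t. t \<in> {0..1} \<Longrightarrow> p t = Q (f t)" and q: "\<And>t. t \<in> {0..1} \<Longrightarrow> q t = Q (g t)"
  shows "path_homotopic T (p 0) (p 1) p q"
proof -
  let ?k = "\<lambda>z::real\<times>real. (1 - fst z) *\<^sub>R f (snd z) + fst z *\<^sub>R g (snd z)"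
  have "continuous_on ({0..1} \<times> {0..1}) ?k"
    by (intro continuous_intros continuous_on_compose2[OF f(1)] continuous_on_compose2[OF g(1)]) auto
  moreover have "?k ` ({0..1} \<times> {0..1}) \<subseteq> S"
    using f(2) g(2) \<open>convex S\<close> by (auto intro!: convexD)
  ultimately have "continuous_map (top_of_set ({0..1} \<times> {0..1})) T (\<lambda>z. Q (?k z))"
    by (rule continuous_map_real_comp[OF Q, where f = ?k])
  moreover have "?k (s, 0) = f 0" "?k (s, 1) = f 1" for s
    using assms(7,8) by (simp_all flip: scaleR_add_left)
  moreover have "p 0 = Q (f 0)" "p 1 = Q (f 1)" using p by simp_all
  ultimately have h: "path_homotopic T (p 0) (p 1) (\<lambda>t. Q (f t)) (\<lambda>t. Q (g t))"
    unfolding path_homotopic_def homotopic_with_def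
    by (intro exI[of _ "\<lambda>z. Q (?k z)"]) simp
  have "path_homotopic T (p 0) (p 1) (\<lambda>t. Q (f t)) p"
    using p by (intro path_homotopic_equal path_homotopic_imp(1)[OF h]) auto
  moreover have "path_homotopic T (p 0) (p 1) (\<lambda>t. Q (g t)) q"
    using q by (intro path_homotopic_equal path_homotopic_imp(2)[OF h]) auto
  ultimately show ?thesis using h by (blast intro: path_homotopic_trans path_homotopic_sym)
qed

lemma path_homotopic_reparam:
  assumes P: "path_from_to T a b P"
    and f: "continuous_on {0..1} f" "f ` {0..1} \<subseteq> {0..1}" "f 0 = 0" "f 1 = 1"
    and p: "\<And>t. t \<in> {0..1} \<Longrightarrow> p t = P (f t)"
  shows "path_homotopic T a b p P"
proof -
  have "path_homotopic T (p 0) (p 1) p P"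
    using P f p by (intro path_homotopic_convex[where Q = P and f = f and g = id and S = "{0..1}"])
      (auto simp: path_from_to_def pathin_def)
  moreover have "p 0 = a" "p 1 = b" using P f p by (auto simp: path_from_to_def)
  ultimately show ?thesis by simp
qed

lemma continuous_map_path_then:
  fixes h1 h2 :: "real \<times> real \<Rightarrow> 'a"
  assumes h: "continuous_map (top_of_set ({0..1} \<times> {0..1})) T h1" "continuous_map (top_of_set ({0..1} \<times> {0..1})) T h2"
    and eq: "\<And>s. s \<in> {0..1} \<Longrightarrow> h1 (s, 1) = h2 (s, 0)"
  shows "continuous_map (top_of_set ({0..1} \<times> {0..1})) T
    (\<lambda>z. path_then (\<lambda>t. h1 (fst z, t)) (\<lambda>t. h2 (fst z, t)) (snd z))"
proof -
  let ?D = "{0..1} \<times> {0..1} :: (real \<times> real) set"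
  have "continuous_map (top_of_set ?D) T
    (\<lambda>z. if snd z \<le> 1/2 then h1 (fst z, 2 * snd z) else h2 (fst z, 2 * snd z - 1))"
  proof (rule continuous_map_cases_le)
    show "continuous_map (top_of_set ?D) euclideanreal snd" "continuous_map (top_of_set ?D) euclideanreal (\<lambda>x. 1/2)"
      by (auto intro!: continuous_intros)
    show "continuous_map (subtopology (top_of_set ?D) {x \<in> topspace (top_of_set ?D). snd x \<le> 1/2}) T (\<lambda>z. h1 (fst z, 2 * snd z))"
      unfolding subtopology_subtopology by (rule continuous_map_real_comp[OF h(1), where f = "\<lambda>z. (fst z, 2 * snd z)"]) (auto intro!: continuous_intros)
    show "continuous_map (subtopology (top_of_set ?D) {x \<in> topspace (top_of_set ?D). 1/2 \<le> snd x}) T (\<lambda>z. h2 (fst z, 2 * snd z - 1))"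
      unfolding subtopology_subtopology by (rule continuous_map_real_comp[OF h(2), where f = "\<lambda>z. (fst z, 2 * snd z - 1)"]) (auto intro!: continuous_intros)
    show "h1 (fst x, 2 * snd x) = h2 (fst x, 2 * snd x - 1)" if "x \<in> topspace (top_of_set ?D)" "snd x = 1 / 2" for x
      using that eq[of "fst x"] by (simp add: mem_Times_iff mult.commute[of 2])
  qed
  then show ?thesis by (simp add: path_then_def)
qed

lemma path_homotopic_then:
  assumes "path_homotopic T a b p p'" "path_homotopic T b c q q'"
  shows "path_homotopic T a c (path_then p q) (path_then p' q')"
proof -
  obtain h1 :: "real \<times> real \<Rightarrow> 'a" where h1: "continuous_map (top_of_set ({0..1} \<times> {0..1})) T h1"
     "\<forall>x. h1 (0, x) = p x" "\<forall>x. h1 (1, x) = p' x" "\<forall>s\<in>{0..1}. h1 (s, 0) = a \<and> h1 (s, 1) = b"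
    using assms(1) unfolding path_homotopic_def homotopic_with_def prod_topology_subtopology_eu
    by blast
  obtain h2 :: "real \<times> real \<Rightarrow> 'a" where h2: "continuous_map (top_of_set ({0..1} \<times> {0..1})) T h2"
     "\<forall>x. h2 (0, x) = q x" "\<forall>x. h2 (1, x) = q' x" "\<forall>s\<in>{0..1}. h2 (s, 0) = b \<and> h2 (s, 1) = c"
    using assms(2) unfolding path_homotopic_def homotopic_with_def prod_topology_subtopology_eu
    by blast
  have "continuous_map (top_of_set ({0..1} \<times> {0..1})) T
    (\<lambda>z. path_then (\<lambda>t. h1 (fst z, t)) (\<lambda>t. h2 (fst z, t)) (snd z))"
    using h1 h2 by (intro continuous_map_path_then) auto
  then show ?thesis unfolding path_homotopic_def homotopic_with_def
    using h1 h2
    by (intro exI[of _ "\<lambda>z. path_then (\<lambda>t. h1 (fst z, t)) (\<lambda>t. h2 (fst z, t)) (snd z)"])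
      (auto simp: path_then_def)
qed

lemma path_from_to_then:
  "path_from_to T a b p \<Longrightarrow> path_from_to T b c q \<Longrightarrow> path_from_to T a c (path_then p q)"
  by (blast intro: path_homotopic_imp path_homotopic_then path_homotopic_refl)

lemma path_homotopic_assoc:
  assumes "path_from_to T a b p" "path_from_to T b c q" "path_from_to T c d r"
  shows "path_homotopic T a d (path_then (path_then p q) r) (path_then p (path_then q r))"
proof (rule path_homotopic_reparam)
  show "path_from_to T a d (path_then p (path_then q r))"
    using assms by (intro path_from_to_then)
  \<comment> \<open>The change of time is piecewise linear with slopes 2, 1 and 1/2 and breaks at
    1/4 and 1/2; being concave, it is the minimum of its three pieces.\<close>
  let ?f = "\<lambda>t::real. min (2 * t) (min (t + 1/4) ((t + 1) / 2))"
  show "continuous_on {0..1} ?f" by (intro continuous_intros) simp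
  show "?f ` {0..1} \<subseteq> {0..1}" by (auto simp: min_le_iff_disj)
  show "?f 0 = 0" "?f 1 = 1" by auto
  show "path_then (path_then p q) r t = path_then p (path_then q r) (?f t)" if "t \<in> {0..1}" for t
  proof -
    consider "t \<le> 1/4" | "1/4 < t" "t \<le> 1/2" | "1/2 < t" by linarith
    then show ?thesis
    proof cases
      case 1 then have "?f t = 2 * t" by auto
      with 1 show ?thesis by (simp add: path_then_def)
    next
      case 2 then have "?f t = t + 1/4" by auto
      with 2 show ?thesis by (simp add: path_then_def algebra_simps)
    next
      case 3 then have "?f t = (t + 1)/2" by auto
      with 3 that show ?thesis by (simp add: path_then_def field_simps)
    qed
  qed
qed

lemma path_homotopic_const_then:
  assumes "path_from_to T a b p"
  shows "path_homotopic T a b (path_then (\<lambda>_. a) p) p"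
proof (rule path_homotopic_reparam[OF assms])
  let ?f = "\<lambda>t::real. max 0 (2 * t - 1)"
  show "continuous_on {0..1} ?f" by (intro continuous_intros)
  show "?f ` {0..1} \<subseteq> {0..1}" "?f 0 = 0" "?f 1 = 1" by auto
  show "path_then (\<lambda>_. a) p t = p (?f t)" if "t \<in> {0..1}" for t
    using assms by (cases "2 * t = 1") (auto simp: path_then_def path_from_to_def max_def)
qed

lemma path_homotopic_then_const:
  assumes "path_from_to T a b p"
  shows "path_homotopic T a b (path_then p (\<lambda>_. b)) p"
proof (rule path_homotopic_reparam[OF assms])
  let ?f = "\<lambda>t::real. min 1 (2 * t)"
  show "continuous_on {0..1} ?f" by (intro continuous_intros)
  show "?f ` {0..1} \<subseteq> {0..1}" "?f 0 = 0" "?f 1 = 1" by auto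
  show "path_then p (\<lambda>_. b) t = p (?f t)" if "t \<in> {0..1}" for t
    using assms by (cases "2 * t = 1") (auto simp: path_then_def path_from_to_def min_def)
qed

lemma path_homotopic_then_rev:
  assumes p: "path_from_to T a b p"
  shows "path_homotopic T a a (path_then p (rev_path p)) (\<lambda>_. a)"
proof -
  \<comment> \<open>The tent function runs from 0 to 1 and back; the left side is \<open>p\<close>
    after the tent, and the tent contracts linearly to 0.\<close>
  let ?f = "\<lambda>t::real. 1 - \<bar>2 * t - 1\<bar>"
  have "path_homotopic T (path_then p (rev_path p) 0) (path_then p (rev_path p) 1) (path_then p (rev_path p)) (\<lambda>_. a)"
  proof (rule path_homotopic_convex[where Q = p and f = ?f and g = "\<lambda>_. 0" and S = "{0..1}"])
    show "continuous_on {0..1} ?f" by (intro continuous_intros)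
    show "?f ` {0..1} \<subseteq> {0..1}" by auto
  qed (use p in \<open>auto simp: path_then_def rev_path_def path_from_to_def pathin_def abs_if algebra_simps\<close>)
  then show ?thesis using p by (simp add: path_then_def rev_path_def path_from_to_def)
qed

lemma rev_path_rev_path [simp]: "rev_path (rev_path p) = p"
  by (auto simp: rev_path_def)

lemma path_homotopic_rev_then:
  "path_from_to T a b p \<Longrightarrow> path_homotopic T b b (path_then (rev_path p) p) (\<lambda>_. b)"
  using path_homotopic_then_rev[OF path_from_to_rev] by fastforce

text \<open>Uniqueness of inverses in the fundamental groupoid: insert \<open>q\<close> followed by
  its reverse, replace \<open>q\<close> by \<open>p\<close>, and cancel.\<close>

lemma path_homotopic_rev:
  assumes "path_homotopic T a b p q" shows "path_homotopic T b a (rev_path p) (rev_path q)"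
proof -
  note pq = path_homotopic_imp[OF assms]
  have T: "a \<in> topspace T" "b \<in> topspace T"
    using pq by (auto simp: path_from_to_def dest: path_start_in_topspace path_finish_in_topspace)
  note r = path_from_to_rev[OF pq(1)] path_from_to_rev[OF pq(2)]
  have "path_homotopic T b a (rev_path p) (path_then (rev_path p) (\<lambda>_. a))"
    using r by (intro path_homotopic_sym[OF path_homotopic_then_const])
  also have "path_homotopic T b a \<dots> (path_then (rev_path p) (path_then q (rev_path q)))"
    by (rule path_homotopic_then[OF path_homotopic_refl[OF r(1)] path_homotopic_sym[OF path_homotopic_then_rev[OF pq(2)]]])
  also have "path_homotopic T b a \<dots> (path_then (path_then (rev_path p) q) (rev_path q))"
    using r pq by (intro path_homotopic_sym[OF path_homotopic_assoc])
  also have "path_homotopic T b a \<dots> (path_then (path_then (rev_path p) p) (rev_path q))"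
    by (rule path_homotopic_then[OF path_homotopic_then[OF path_homotopic_refl[OF r(1)] path_homotopic_sym[OF assms]]
        path_homotopic_refl[OF r(2)]])
  also have "path_homotopic T b a \<dots> (path_then (\<lambda>_. b) (rev_path q))"
    by (rule path_homotopic_then[OF path_homotopic_rev_then[OF pq(1)] path_homotopic_refl[OF r(2)]])
  also have "path_homotopic T b a \<dots> (rev_path q)"
    using r by (intro path_homotopic_const_then)
  finally show ?thesis .
qed

section \<open>Loop classes and the product of the fundamental group\<close>

lemma loops_at_iff: "p \<in> loops_at T a \<longleftrightarrow> path_from_to T a a p"
  by (simp add: loops_at_def path_from_to_def)

lemma loop_class_iff: "q \<in> loop_class T a p \<longleftrightarrow> path_homotopic T a a p q"
  by (auto simp: loop_class_def loop_homotopic_def path_homotopic_def[symmetric] loops_at_iff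
      dest: path_homotopic_imp(2))

lemma loop_class_eqI: "path_homotopic T a a p q \<Longrightarrow> loop_class T a p = loop_class T a q"
  by (auto simp: loop_class_iff) (blast dest: path_homotopic_trans path_homotopic_sym)+

lemma loop_class_in_carrier:
  "path_from_to T a a p \<Longrightarrow> loop_class T a p \<in> carrier (fundamental_group T a)"
  by (auto simp: fundamental_group_def loops_at_iff)

lemma fundamental_group_carrierE:
  assumes "r \<in> carrier (fundamental_group T a)"
  obtains p where "path_from_to T a a p" "r = loop_class T a p"
  using assms by (auto simp: fundamental_group_def loops_at_iff)

text \<open>The product is a union over all pairs of representatives. Each pair contributes the same
  class and both factors are nonempty, so the union collapses to one class.\<close>

lemma fundamental_group_mult:
  assumes p: "path_from_to T a a p" and q: "path_from_to T a a q"
  shows "loop_class T a p \<otimes>\<^bsub>fundamental_group T a\<^esub> loop_class T a q = loop_class T a (path_then q p)"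
proof -
  have "loop_class T a (path_then q' p') = loop_class T a (path_then q p)"
    if "p' \<in> loop_class T a p" "q' \<in> loop_class T a q" for p' q'
    using that unfolding loop_class_iff
    by (intro loop_class_eqI path_homotopic_then) (auto intro: path_homotopic_sym)
  moreover have "p \<in> loop_class T a p" "q \<in> loop_class T a q"
    using p q by (auto simp: loop_class_iff path_homotopic_refl)
  ultimately have "(\<Union>p'\<in>loop_class T a p. \<Union>q'\<in>loop_class T a q. loop_class T a (path_then q' p'))
      = loop_class T a (path_then q p)"
    by (metis (no_types, lifting) SUP_eq_const empty_iff)
  then show ?thesis by (simp add: fundamental_group_def)
qed

text \<open>The class of the constant loop is idempotent, hence so is its image, and the only
  idempotent of a group is the unit. Membership in \<open>hom\<close> itself supplies
  multiplicativity only.\<close>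

lemma hom_loop_class_const:
  assumes "group G" and h: "h \<in> hom (fundamental_group T a) G" and a: "a \<in> topspace T"
  shows "h (loop_class T a (\<lambda>_. a)) = \<one>\<^bsub>G\<^esub>"
proof -
  interpret group G by fact
  let ?u = "loop_class T a (\<lambda>_. a)"
  have c: "path_from_to T a a (\<lambda>_. a)" by (rule path_from_to_const[OF a])
  have "?u \<otimes>\<^bsub>fundamental_group T a\<^esub> ?u = ?u"
    unfolding fundamental_group_mult[OF c c] by (rule loop_class_eqI[OF path_homotopic_const_then[OF c]])
  moreover have u: "?u \<in> carrier (fundamental_group T a)" by (rule loop_class_in_carrier[OF c])
  ultimately have "h ?u \<otimes>\<^bsub>G\<^esub> h ?u = h ?u" using hom_mult[OF h u u] by simp
  moreover have "h ?u \<in> carrier G" using hom_in_carrier[OF h u] .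
  ultimately show ?thesis using l_cancel_one by blast
qed

text \<open>A base path to every point turns arbitrary paths into loops at \<open>c\<close>. The
  base paths of neighbouring points are unrelated; \<open>base_c\<close> ensures that a loop at
  \<open>c\<close> keeps its class.\<close>

locale based_paths =
  fixes T :: "'a topology" and c :: 'a and \<kappa> :: "'a \<Rightarrow> real \<Rightarrow> 'a"
  assumes base: "a \<in> topspace T \<Longrightarrow> path_from_to T c a (\<kappa> a)"
    and base_c: "path_homotopic T c c (\<kappa> c) (\<lambda>_. c)"
begin

text \<open>The retraction of the fundamental groupoid of \<open>T\<close> onto its vertex group at
  \<open>c\<close> that the base paths determine.\<close>

definition lam :: "(real \<Rightarrow> 'a) \<Rightarrow> (real \<Rightarrow> 'a) set" where
  "lam q = loop_class T c (path_then (path_then (\<kappa> (q 0)) q) (rev_path (\<kappa> (q 1))))"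

lemma base0: "path_from_to T a b q \<Longrightarrow> path_from_to T c a (\<kappa> a)"
  and base1: "path_from_to T a b q \<Longrightarrow> path_from_to T c b (\<kappa> b)"
  by (metis base path_from_to_def path_start_in_topspace, metis base path_from_to_def path_finish_in_topspace)

lemma lam_path:
  "path_from_to T a b q \<Longrightarrow> path_from_to T c c (path_then (path_then (\<kappa> a) q) (rev_path (\<kappa> b)))"
  by (meson base0 base1 path_from_to_rev path_from_to_then)

lemma lam_eq:
  "path_from_to T a b q \<Longrightarrow> lam q = loop_class T c (path_then (path_then (\<kappa> a) q) (rev_path (\<kappa> b)))"
  by (auto simp: lam_def path_from_to_def)

lemma lam_carrier: "path_from_to T a b q \<Longrightarrow> lam q \<in> carrier (fundamental_group T c)"
  using lam_eq lam_path loop_class_in_carrier by metis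

lemma lam_cong:
  assumes "path_homotopic T a b p q" shows "lam p = lam q"
proof -
  note pq = path_homotopic_imp[OF assms]
  show ?thesis unfolding lam_eq[OF pq(1)] lam_eq[OF pq(2)]
    by (rule loop_class_eqI[OF path_homotopic_then[OF path_homotopic_then[OF path_homotopic_refl[OF base0[OF pq(1)]] assms]
        path_homotopic_refl[OF path_from_to_rev[OF base1[OF pq(1)]]]]])
qed

text \<open>The base path to the middle point \<open>b\<close> is run backwards and then forwards,
  and cancels. The factors are swapped because products are written right to left.\<close>

lemma lam_then:
  assumes p: "path_from_to T a b p" and q: "path_from_to T b d q"
  shows "lam (path_then p q) = lam q \<otimes>\<^bsub>fundamental_group T c\<^esub> lam p"
proof -
  note k = base0[OF p] base1[OF p] base1[OF q] and r = path_from_to_rev[OF base1[OF p]]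
    path_from_to_rev[OF base1[OF q]]
  let ?A = "path_then (\<kappa> a) p" and ?B = "rev_path (\<kappa> b)" and ?R = "path_then q (rev_path (\<kappa> d))"
  have A: "path_from_to T c b ?A" and R: "path_from_to T b c ?R"
    by (rule path_from_to_then[OF k(1) p] path_from_to_then[OF q r(2)])+
  note A' = path_homotopic_refl[OF A] and R' = path_homotopic_refl[OF R]
    and AB = path_from_to_then[OF A r(1)] and kR = path_from_to_then[OF k(2) R]
  have "path_homotopic T c c (path_then (path_then ?A ?B) (path_then (path_then (\<kappa> b) q) (rev_path (\<kappa> d))))
     (path_then (path_then ?A ?B) (path_then (\<kappa> b) ?R))"
    by (rule path_homotopic_then[OF path_homotopic_refl[OF AB] path_homotopic_assoc[OF k(2) q r(2)]])
  also have "path_homotopic T c c \<dots> (path_then ?A (path_then ?B (path_then (\<kappa> b) ?R)))"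
    by (rule path_homotopic_assoc[OF A r(1) kR])
  also have "path_homotopic T c c \<dots> (path_then ?A (path_then (path_then ?B (\<kappa> b)) ?R))"
    by (rule path_homotopic_then[OF A' path_homotopic_sym[OF path_homotopic_assoc[OF r(1) k(2) R]]])
  also have "path_homotopic T c c \<dots> (path_then ?A (path_then (\<lambda>_. b) ?R))"
    by (rule path_homotopic_then[OF A' path_homotopic_then[OF path_homotopic_rev_then[OF k(2)] R']])
  also have "path_homotopic T c c \<dots> (path_then ?A ?R)"
    by (rule path_homotopic_then[OF A' path_homotopic_const_then[OF R]])
  also have "path_homotopic T c c \<dots> (path_then (path_then ?A q) (rev_path (\<kappa> d)))"
    by (rule path_homotopic_sym[OF path_homotopic_assoc[OF A q r(2)]])
  also have "path_homotopic T c c \<dots> (path_then (path_then (\<kappa> a) (path_then p q)) (rev_path (\<kappa> d)))"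
    by (rule path_homotopic_then[OF path_homotopic_assoc[OF k(1) p q] path_homotopic_refl[OF r(2)]])
  finally show ?thesis
    unfolding lam_eq[OF p] lam_eq[OF q] lam_eq[OF path_from_to_then[OF p q]]
      fundamental_group_mult[OF lam_path[OF q] lam_path[OF p]]
    by (rule loop_class_eqI[OF path_homotopic_sym])
qed

text \<open>The closed-up path goes out along \<open>\<kappa> b\<close> and \<open>s\<close>, that
  is along \<open>\<kappa> a\<close>, and returns along \<open>\<kappa> a\<close>. In the same way
  the edges of a spanning tree become trivial in the fundamental group of a graph.\<close>

lemma lam_triv:
  assumes s: "path_from_to T b a s" and k: "path_homotopic T c a (\<kappa> a) (path_then (\<kappa> b) s)"
  shows "lam s = loop_class T c (\<lambda>_. c)"
proof -
  have "path_homotopic T c c (path_then (path_then (\<kappa> b) s) (rev_path (\<kappa> a))) (path_then (\<kappa> a) (rev_path (\<kappa> a)))"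
    by (rule path_homotopic_then[OF path_homotopic_sym[OF k] path_homotopic_refl[OF path_from_to_rev[OF base1[OF s]]]])
  also have "path_homotopic T c c \<dots> (\<lambda>_. c)"
    by (rule path_homotopic_then_rev[OF base1[OF s]])
  finally show ?thesis unfolding lam_eq[OF s] by (rule loop_class_eqI)
qed

lemma lam_const: "a \<in> topspace T \<Longrightarrow> lam (\<lambda>_. a) = loop_class T c (\<lambda>_. c)"
  by (rule lam_triv[OF path_from_to_const path_homotopic_sym[OF path_homotopic_then_const[OF base]]])

lemma lam_loop:
  assumes q: "path_from_to T c c q" shows "lam q = loop_class T c q"
proof -
  have "path_homotopic T c c (path_then (path_then (\<kappa> c) q) (rev_path (\<kappa> c)))
     (path_then (path_then (\<lambda>_. c) q) (rev_path (\<lambda>_. c)))"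
    by (rule path_homotopic_then[OF path_homotopic_then[OF base_c path_homotopic_refl[OF q]] path_homotopic_rev[OF base_c]])
  also have "path_homotopic T c c \<dots> (path_then (\<lambda>_. c) q)"
    using path_homotopic_then_const[OF path_from_to_then[OF path_homotopic_imp(2)[OF base_c] q]]
    by (simp add: rev_path_def[abs_def])
  also have "path_homotopic T c c \<dots> q" by (rule path_homotopic_const_then[OF q])
  finally show ?thesis unfolding lam_eq[OF q] by (rule loop_class_eqI)
qed

end

section \<open>Lifting along a cocycle\<close>

text \<open>\<open>\<rho> a b\<close> transports the fibre over \<open>b\<close>, near \<open>a\<close>, to the fibre over \<open>a\<close>; a lift is then a
  section of the covering with fibre \<open>G\<close> glued by \<open>\<rho>\<close>, and two lifts differ by a right factor.\<close>

locale star_cocycle = group G for G (structure) +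
  fixes T :: "'a topology" and N :: "'a \<Rightarrow> 'a set" and \<rho> :: "'a \<Rightarrow> 'a \<Rightarrow> 'b"
  assumes N_open: "a \<in> topspace T \<Longrightarrow> openin T (N a)"
    and N_self: "a \<in> topspace T \<Longrightarrow> a \<in> N a"
    and \<rho>_closed: "a \<in> topspace T \<Longrightarrow> b \<in> N a \<Longrightarrow> \<rho> a b \<in> carrier G"
    and \<rho>_mult: "a \<in> topspace T \<Longrightarrow> b \<in> N a \<Longrightarrow> x \<in> N b \<Longrightarrow> \<rho> a b \<otimes> \<rho> b x = \<rho> a x"
begin

lemma N_topspace: "a \<in> topspace T \<Longrightarrow> b \<in> N a \<Longrightarrow> b \<in> topspace T"
  using N_open openin_subset by blast

lemma \<rho>_self: "a \<in> topspace T \<Longrightarrow> \<rho> a a = \<one>"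
  using \<rho>_mult[of a a a] \<rho>_closed[of a a] N_self[of a] by auto

text \<open>Local constancy up to transport: values at nearby points agree once they are carried to
  the fibre at \<open>P z\<close>. The condition is centred at \<open>z\<close> because membership
  in \<open>N\<close> is not symmetric, and \<open>\<rho>\<close> carries values from a point of
  \<open>N a\<close> to the centre \<open>a\<close> only.\<close>

definition is_lift :: "'z::topological_space set \<Rightarrow> ('z \<Rightarrow> 'a) \<Rightarrow> ('z \<Rightarrow> 'b) \<Rightarrow> bool" where
  "is_lift S P L \<longleftrightarrow> (\<forall>z\<in>S. P z \<in> topspace T \<and> L z \<in> carrier G \<and>
     (\<exists>U. open U \<and> z \<in> U \<and> (\<forall>z'\<in>S \<inter> U. P z' \<in> N (P z) \<and> L z = \<rho> (P z) (P z') \<otimes> L z')))"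

lemma is_liftD:
  assumes "is_lift S P L" "z \<in> S"
  shows "P z \<in> topspace T" "L z \<in> carrier G"
    "\<exists>U. open U \<and> z \<in> U \<and> (\<forall>z'\<in>S \<inter> U. P z' \<in> N (P z) \<and> L z = \<rho> (P z) (P z') \<otimes> L z')"
  using assms unfolding is_lift_def by blast+

lemma is_lift_compose:
  assumes "is_lift S P L" "continuous_on S' f" "f ` S' \<subseteq> S"
  shows "is_lift S' (\<lambda>z. P (f z)) (\<lambda>z. L (f z))"
  unfolding is_lift_def
proof (intro ballI conjI)
  fix z assume z: "z \<in> S'"
  then have fz: "f z \<in> S" using assms(3) by blast
  show "P (f z) \<in> topspace T" "L (f z) \<in> carrier G" using is_liftD[OF assms(1) fz] by auto
  obtain U where U: "open U" "f z \<in> U"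
    "\<forall>z'\<in>S \<inter> U. P z' \<in> N (P (f z)) \<and> L (f z) = \<rho> (P (f z)) (P z') \<otimes> L z'"
    using is_liftD(3)[OF assms(1) fz] by blast
  obtain V where "open V" "z \<in> V" "\<forall>y\<in>S'. y \<in> V \<longrightarrow> f y \<in> U"
    using assms(2)[unfolded continuous_on_topological] z U by metis
  then show "\<exists>U. open U \<and> z \<in> U \<and> (\<forall>z'\<in>S' \<inter> U. P (f z') \<in> N (P (f z)) \<and> L (f z) = \<rho> (P (f z)) (P (f z')) \<otimes> L (f z'))"
    using U assms(3) by (intro exI[of _ V]) auto
qed

lemma is_lift_cong:
  assumes "is_lift S P L" "\<And>z. z \<in> S \<Longrightarrow> P' z = P z" "\<And>z. z \<in> S \<Longrightarrow> L' z = L z"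
  shows "is_lift S P' L'"
  using assms unfolding is_lift_def by (metis Int_iff)

lemma is_lift_right_mult:
  assumes "is_lift S P L" "c \<in> carrier G"
  shows "is_lift S P (\<lambda>z. L z \<otimes> c)"
  unfolding is_lift_def
proof (intro ballI conjI)
  fix z assume z: "z \<in> S"
  show "P z \<in> topspace T" "L z \<otimes> c \<in> carrier G" using is_liftD[OF assms(1) z] assms(2) by auto
  obtain U where U: "open U" "z \<in> U"
    "\<forall>z'\<in>S \<inter> U. P z' \<in> N (P z) \<and> L z = \<rho> (P z) (P z') \<otimes> L z'"
    using is_liftD(3)[OF assms(1) z] by blast
  have "L z \<otimes> c = \<rho> (P z) (P z') \<otimes> (L z' \<otimes> c)" if "z' \<in> S \<inter> U" for z'
  proof -
    have "L z = \<rho> (P z) (P z') \<otimes> L z'" "\<rho> (P z) (P z') \<in> carrier G" "L z' \<in> carrier G"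
      using U that \<rho>_closed is_liftD[OF assms(1)] z by auto
    then show ?thesis using assms(2) by (simp add: m_assoc)
  qed
  then show "\<exists>U. open U \<and> z \<in> U \<and> (\<forall>z'\<in>S \<inter> U. P z' \<in> N (P z) \<and> L z \<otimes> c = \<rho> (P z) (P z') \<otimes> (L z' \<otimes> c))"
    using U by blast
qed

text \<open>Both lifts change by the same left factor \<open>\<rho>\<close>, which cancels in
  \<open>inv (L z) \<otimes> L' z\<close>; this quotient is therefore locally constant on the
  connected set \<open>S\<close>.\<close>

lemma is_lift_unique:
  assumes L: "is_lift S P L" and L': "is_lift S P L'" and "connected S" "z \<in> S" "w \<in> S"
  shows "inv (L z) \<otimes> L' z = inv (L w) \<otimes> L' w"
proof (rule connected_local_const[OF assms(3-5)], rule ballI)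
  fix z assume z: "z \<in> S"
  obtain U where U: "open U" "z \<in> U"
    "\<forall>z'\<in>S \<inter> U. P z' \<in> N (P z) \<and> L z = \<rho> (P z) (P z') \<otimes> L z'"
    using is_liftD(3)[OF L z] by blast
  obtain U' where U': "open U'" "z \<in> U'"
    "\<forall>z'\<in>S \<inter> U'. P z' \<in> N (P z) \<and> L' z = \<rho> (P z) (P z') \<otimes> L' z'"
    using is_liftD(3)[OF L' z] by blast
  have "inv (L z) \<otimes> L' z = inv (L z') \<otimes> L' z'" if z': "z' \<in> S" "z' \<in> U" "z' \<in> U'" for z'
  proof -
    let ?r = "\<rho> (P z) (P z')"
    have e: "L z = ?r \<otimes> L z'" "L' z = ?r \<otimes> L' z'" and c: "?r \<in> carrier G" "L z' \<in> carrier G" "L' z' \<in> carrier G"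
      using U(3) U'(3) z' \<rho>_closed is_liftD(1,2)[OF L] is_liftD(2)[OF L'] z by auto
    have "inv (L z) \<otimes> L' z = inv (L z') \<otimes> (inv ?r \<otimes> (?r \<otimes> L' z'))"
      unfolding e using c by (simp add: inv_mult_group m_assoc)
    also have "\<dots> = inv (L z') \<otimes> L' z'" using c by (simp flip: m_assoc)
    finally show ?thesis .
  qed
  then show "\<forall>\<^sub>F z' in at z within S. inv (L z) \<otimes> L' z = inv (L z') \<otimes> L' z'"
    unfolding eventually_at_topological using U(1,2) U'(1,2) by (intro exI[of _ "U \<inter> U'"]) auto
qed

text \<open>The candidate is the section whose transport to the centre \<open>a\<close> is the unit;
  the cocycle law \<open>\<rho> a (P z) \<otimes> \<rho> (P z) (P z') = \<rho> a (P z')\<close> says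
  exactly that it is a lift.\<close>

lemma is_lift_local:
  assumes P: "continuous_map (top_of_set S) T P" and a: "a \<in> topspace T" and S: "P ` S \<subseteq> N a"
  shows "is_lift S P (\<lambda>z. inv (\<rho> a (P z)))"
  unfolding is_lift_def
proof (intro ballI conjI)
  fix z assume z: "z \<in> S"
  then have Pz: "P z \<in> N a" "\<rho> a (P z) \<in> carrier G" using S \<rho>_closed[OF a] by auto
  then show "P z \<in> topspace T" "inv (\<rho> a (P z)) \<in> carrier G" using N_topspace[OF a] by auto
  then have "openin (top_of_set S) {x \<in> topspace (top_of_set S). P x \<in> N (P z)}"
    using P N_open openin_continuous_map_preimage by blast
  then obtain U where U: "open U" "{x \<in> S. P x \<in> N (P z)} = S \<inter> U"
    unfolding openin_open by auto
  have "inv (\<rho> a (P z)) = \<rho> (P z) (P z') \<otimes> inv (\<rho> a (P z'))" if "z' \<in> S \<inter> U" for z'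
  proof -
    have z': "z' \<in> S" "P z' \<in> N (P z)" using that U(2) by auto
    have e: "\<rho> a (P z') = \<rho> a (P z) \<otimes> \<rho> (P z) (P z')" using \<rho>_mult[OF a Pz(1) z'(2)] by simp
    have c: "\<rho> (P z) (P z') \<in> carrier G" by (rule \<rho>_closed[OF N_topspace[OF a Pz(1)] z'(2)])
    show ?thesis unfolding e using c Pz(2) by (simp add: inv_mult_group flip: m_assoc)
  qed
  moreover have "z \<in> U" using U(2) z N_self N_topspace[OF a Pz(1)] by blast
  ultimately show "\<exists>U. open U \<and> z \<in> U \<and> (\<forall>z'\<in>S \<inter> U. P z' \<in> N (P z) \<and>
      inv (\<rho> a (P z)) = \<rho> (P z) (P z') \<otimes> inv (\<rho> a (P z')))"
    using U by blast
qed

text \<open>Closedness takes care of a point of one set outside the other: it has a neighbourhood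
  that misses the other set, so no condition arises from there.\<close>

lemma is_lift_union:
  assumes L: "is_lift S P L" "is_lift S' P L" and closed: "closed S" "closed S'"
  shows "is_lift (S \<union> S') P L"
  unfolding is_lift_def
proof (intro ballI conjI)
  fix z assume z: "z \<in> S \<union> S'"
  then show "P z \<in> topspace T" "L z \<in> carrier G" using L is_liftD by blast+
  have *: "\<exists>U. open U \<and> z \<in> U \<and> (\<forall>z'\<in>R \<inter> U. P z' \<in> N (P z) \<and> L z = \<rho> (P z) (P z') \<otimes> L z')"
    if "is_lift R P L" "closed R" for R
  proof (cases "z \<in> R")
    case True then show ?thesis using is_liftD(3)[OF that(1)] by blast
  next
    case False then show ?thesis using that(2) by (intro exI[of _ "- R"]) auto
  qed
  obtain U U' where "open U" "z \<in> U" "\<forall>z'\<in>S \<inter> U. P z' \<in> N (P z) \<and> L z = \<rho> (P z) (P z') \<otimes> L z'"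
    "open U'" "z \<in> U'" "\<forall>z'\<in>S' \<inter> U'. P z' \<in> N (P z) \<and> L z = \<rho> (P z) (P z') \<otimes> L z'"
    using *[OF L(1) closed(1)] *[OF L(2) closed(2)] by blast
  then show "\<exists>U. open U \<and> z \<in> U \<and> (\<forall>z'\<in>(S \<union> S') \<inter> U. P z' \<in> N (P z) \<and> L z = \<rho> (P z) (P z') \<otimes> L z')"
    by (intro exI[of _ "U \<inter> U'"]) auto
qed

lemma is_lift_subset: "is_lift S P L \<Longrightarrow> S' \<subseteq> S \<Longrightarrow> is_lift S' P L"
  using is_lift_compose[of S P L S' "\<lambda>z. z"] by (auto simp: continuous_on_id)

text \<open>The right factor \<open>c\<close> makes the two lifts agree at one common point, and
  connectedness of the overlap spreads the agreement to all of it.\<close>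

lemma lift_glue:
  assumes L: "is_lift S P L" "is_lift S' P L'" and closed: "closed S" "closed S'"
    and conn: "connected (S \<inter> S')" "S \<inter> S' \<noteq> {}"
  shows "\<exists>L. is_lift (S \<union> S') P L"
proof -
  obtain w where w: "w \<in> S" "w \<in> S'" using conn(2) by blast
  define c where "c = inv (L' w) \<otimes> L w"
  have c: "c \<in> carrier G" unfolding c_def using is_liftD(2)[OF L(1) w(1)] is_liftD(2)[OF L(2) w(2)] by auto
  define M where "M z = (if z \<in> S then L z else L' z \<otimes> c)" for z
  have "L z = L' z \<otimes> c" if z: "z \<in> S \<inter> S'" for z
  proof -
    have "inv (L' z) \<otimes> L z = c" unfolding c_def
      by (rule is_lift_unique[OF is_lift_subset[OF L(2)] is_lift_subset[OF L(1)] conn(1) z]) (use w in auto)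
    moreover have "L z \<in> carrier G" "L' z \<in> carrier G"
      using is_liftD(2)[OF L(1)] is_liftD(2)[OF L(2)] z by auto
    ultimately show ?thesis using c by (metis inv_solve_left)
  qed
  then have "is_lift S P M" "is_lift S' P M"
    by (intro is_lift_cong[OF L(1)], auto simp: M_def)
       (intro is_lift_cong[OF is_lift_right_mult[OF L(2) c]], auto simp: M_def)
  then show ?thesis using is_lift_union closed by blast
qed

text \<open>\<open>P\<close> is taken on the whole plane so that every point is the centre of a full
  closed rectangle mapped into one star. Rectangles with a common side are glued by bisection in the
  second coordinate and then in the first; the overlaps are segments, hence connected.\<close>

lemma lift_exists_square:
  fixes P :: "real \<times> real \<Rightarrow> 'a"
  assumes P: "continuous_map euclidean T P"
  shows "\<exists>L. is_lift ({0..1} \<times> {0..1}) P L"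
proof -
  have local: "\<exists>d>0. \<exists>L. is_lift ({fst z - d..fst z + d} \<times> {snd z - d..snd z + d}) P L" for z
  proof -
    have Pz: "P z \<in> topspace T" using P by (auto simp: continuous_map)
    then have "open {x. P x \<in> N (P z)}"
      using openin_continuous_map_preimage[OF P N_open] by simp
    then obtain A B where AB: "open A" "open B" "z \<in> A \<times> B" "A \<times> B \<subseteq> {x. P x \<in> N (P z)}"
      using N_self[OF Pz] by (auto elim: open_prod_elim)
    obtain d1 d2 where "d1 > 0" "cball (fst z) d1 \<subseteq> A" "d2 > 0" "cball (snd z) d2 \<subseteq> B"
      using AB open_contains_cball by (metis mem_Times_iff)
    then have "d1 > 0" "{fst z - d1..fst z + d1} \<subseteq> A" "d2 > 0" "{snd z - d2..snd z + d2} \<subseteq> B"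
      by (auto simp: cball_eq_atLeastAtMost)
    then have "{fst z - min d1 d2..fst z + min d1 d2} \<times> {snd z - min d1 d2..snd z + min d1 d2} \<subseteq> A \<times> B"
      by (intro Sigma_mono) (erule order_trans[rotated], simp)+
    then have d: "min d1 d2 > 0" "P ` ({fst z - min d1 d2..fst z + min d1 d2} \<times> {snd z - min d1 d2..snd z + min d1 d2}) \<subseteq> N (P z)"
      using AB(4) \<open>d1 > 0\<close> \<open>d2 > 0\<close> by (simp, blast)
    have "continuous_map (top_of_set ({fst z - min d1 d2..fst z + min d1 d2} \<times> {snd z - min d1 d2..snd z + min d1 d2})) T P"
      by (rule continuous_map_from_subtopology[OF P])
    from is_lift_local[OF this Pz d(2)] d(1) show ?thesis by blast
  qed
  have strip: "\<exists>d>0. \<exists>L. is_lift ({s - d..s + d} \<times> {0..1}) P L" for s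
  proof -
    \<comment> \<open>The width \<open>d\<close> is quantified inside \<open>Q\<close>, so it may
      shrink whenever two rectangles are stacked.\<close>
    define Q where "Q a b \<longleftrightarrow> (\<exists>d>0. \<exists>L. is_lift ({s - d..s + d} \<times> {a..b}) P L)" for a b
    have "Q 0 1"
    proof (rule Bolzano[where P = Q])
      fix a b c assume ab: "Q a b" and bc: "Q b c" and le: "a \<le> b" "b \<le> c"
      from ab obtain d1 L1 where 1: "d1 > 0" "is_lift ({s - d1..s + d1} \<times> {a..b}) P L1" unfolding Q_def by blast
      from bc obtain d2 L2 where 2: "d2 > 0" "is_lift ({s - d2..s + d2} \<times> {b..c}) P L2" unfolding Q_def by blast
      define d where "d = min d1 d2"
      have d: "d > 0" "d \<le> d1" "d \<le> d2" using 1 2 by (auto simp: d_def)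
      have "is_lift ({s - d..s + d} \<times> {a..b}) P L1" "is_lift ({s - d..s + d} \<times> {b..c}) P L2"
        by (rule is_lift_subset[OF 1(2)], use d in force, rule is_lift_subset[OF 2(2)], use d in force)
      moreover have "({s - d..s + d} \<times> {a..b}) \<inter> ({s - d..s + d} \<times> {b..c}) = {s - d..s + d} \<times> {b}"
        using le by auto
      then have "connected (({s - d..s + d} \<times> {a..b}) \<inter> ({s - d..s + d} \<times> {b..c}))"
        "({s - d..s + d} \<times> {a..b}) \<inter> ({s - d..s + d} \<times> {b..c}) \<noteq> {}"
        using d(1) by (auto intro!: connected_Times)
      ultimately have "\<exists>L. is_lift ({s - d..s + d} \<times> {a..b} \<union> {s - d..s + d} \<times> {b..c}) P L"
        by (intro lift_glue closed_Times) auto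
      moreover have "{s - d..s + d} \<times> {a..b} \<union> {s - d..s + d} \<times> {b..c} = {s - d..s + d} \<times> {a..c}"
        using le by auto
      ultimately show "Q a c" unfolding Q_def using d(1) by auto
    next
      fix t :: real
      obtain d L where d: "d > 0" "is_lift ({s - d..s + d} \<times> {t - d..t + d}) P L" using local[of "(s, t)"] by auto
      have "Q a b" if "a \<le> t" "t \<le> b" "b - a < d" for a b
      proof -
        have "{s - d..s + d} \<times> {a..b} \<subseteq> {s - d..s + d} \<times> {t - d..t + d}" using that by auto
        then show ?thesis unfolding Q_def using is_lift_subset[OF d(2)] d(1) by blast
      qed
      then show "\<exists>d>0. \<forall>a b. a \<le> t \<and> t \<le> b \<and> b - a < d \<longrightarrow> Q a b" using d(1) by blast
    qed simp
    then show ?thesis unfolding Q_def .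
  qed
  define Q where "Q a b \<longleftrightarrow> (\<exists>L. is_lift ({a..b} \<times> {0..1}) P L)" for a b
  have "Q 0 1"
  proof (rule Bolzano[where P = Q])
    fix a b c assume ab: "Q a b" and bc: "Q b c" and le: "a \<le> b" "b \<le> c"
    from ab obtain L1 where 1: "is_lift ({a..b} \<times> {0..1}) P L1" unfolding Q_def by blast
    from bc obtain L2 where 2: "is_lift ({b..c} \<times> {0..1}) P L2" unfolding Q_def by blast
    have "({a..b} \<times> {0..1::real}) \<inter> ({b..c} \<times> {0..1}) = {b} \<times> {0..1}" using le by auto
    then have "connected (({a..b} \<times> {0..1::real}) \<inter> ({b..c} \<times> {0..1}))"
      "({a..b} \<times> {0..1::real}) \<inter> ({b..c} \<times> {0..1}) \<noteq> {}"
      by (auto intro!: connected_Times)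
    with 1 2 have "\<exists>L. is_lift ({a..b} \<times> {0..1} \<union> {b..c} \<times> {0..1}) P L"
      by (intro lift_glue closed_Times) auto
    moreover have "{a..b} \<times> {0..1::real} \<union> {b..c} \<times> {0..1} = {a..c} \<times> {0..1}"
      using le by auto
    ultimately show "Q a c" unfolding Q_def by auto
  next
    fix s :: real
    obtain d L where d: "d > 0" "is_lift ({s - d..s + d} \<times> {0..1}) P L" using strip by blast
    have "Q a b" if "a \<le> s" "s \<le> b" "b - a < d" for a b
    proof -
      have "{a..b} \<times> {0..1::real} \<subseteq> {s - d..s + d} \<times> {0..1}" using that by auto
      then show ?thesis unfolding Q_def using is_lift_subset[OF d(2)] by blast
    qed
    then show "\<exists>d>0. \<forall>a b. a \<le> s \<and> s \<le> b \<and> b - a < d \<longrightarrow> Q a b" using d(1) by blast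
  qed simp
  then show ?thesis unfolding Q_def .
qed

lemma lift_exists_homotopy:
  fixes h :: "real \<times> real \<Rightarrow> 'a"
  assumes h: "continuous_map (top_of_set ({0..1} \<times> {0..1})) T h"
  shows "\<exists>L. is_lift ({0..1} \<times> {0..1}) h L"
proof -
  \<comment> \<open>Clamping both coordinates to \<open>{0..1}\<close> extends \<open>h\<close> from
    the square to the plane.\<close>
  let ?c = "\<lambda>x::real. max 0 (min 1 x)"
  have "continuous_map (top_of_set UNIV) T (\<lambda>z. h (?c (fst z), ?c (snd z)))"
    by (rule continuous_map_real_comp[OF h, where f = "\<lambda>z. (?c (fst z), ?c (snd z))"])
      (auto intro!: continuous_intros)
  then obtain L where "is_lift ({0..1} \<times> {0..1}) (\<lambda>z. h (?c (fst z), ?c (snd z))) L"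
    using lift_exists_square by auto
  then have "is_lift ({0..1} \<times> {0..1}) h L" by (rule is_lift_cong) auto
  then show ?thesis by blast
qed

lemma lift_exists_path:
  assumes p: "pathin T p" shows "\<exists>L. is_lift {0..1} p L"
proof -
  have "continuous_map (top_of_set ({0..1} \<times> {0..1})) T (\<lambda>z::real\<times>real. p (snd z))"
    by (rule continuous_map_real_comp[OF p[unfolded pathin_def]]) (auto intro!: continuous_intros)
  then obtain L where L: "is_lift ({0..1} \<times> {0..1}) (\<lambda>z::real\<times>real. p (snd z)) L"
    using lift_exists_homotopy by blast
  have "is_lift {0..1} (\<lambda>t. p (snd (0::real, t))) (\<lambda>t. L (0, t))"
    by (rule is_lift_compose[OF L]) (auto intro!: continuous_intros)
  then show ?thesis by auto
qed

text \<open>The monodromy of the path. Two lifts differ by a right factor, which cancels in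
  \<open>L 1 \<otimes> inv (L 0)\<close>, so the choice of lift is immaterial.\<close>

definition path_degree :: "(real \<Rightarrow> 'a) \<Rightarrow> 'b" where
  "path_degree p = (let L = (SOME L. is_lift {0..1} p L) in L 1 \<otimes> inv (L 0))"

lemma path_degree_eq:
  assumes L: "is_lift {0..1} p L" shows "path_degree p = L 1 \<otimes> inv (L 0)"
proof -
  define M where "M = (SOME L. is_lift {0..1} p L)"
  have M: "is_lift {0..1} p M" unfolding M_def using L by (rule someI[of "is_lift {0..1} p"])
  have e: "inv (L 1) \<otimes> M 1 = inv (L 0) \<otimes> M 0" by (rule is_lift_unique[OF L M]) auto
  have c: "L 0 \<in> carrier G" "L 1 \<in> carrier G" "M 0 \<in> carrier G" "M 1 \<in> carrier G"
    using is_liftD(2)[OF L] is_liftD(2)[OF M] by auto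
  have "M 1 = L 1 \<otimes> (inv (L 0) \<otimes> M 0)" using e c by (metis inv_closed inv_solve_left m_closed)
  then have "M 1 \<otimes> inv (M 0) = L 1 \<otimes> inv (L 0)" using c by (simp add: m_assoc)
  then show ?thesis by (simp add: path_degree_def M_def)
qed

lemma path_degree_closed: "pathin T p \<Longrightarrow> path_degree p \<in> carrier G"
  using lift_exists_path[of p] path_degree_eq is_liftD(2) by fastforce

lemma path_degree_reparam:
  assumes L: "is_lift {0..1} p L" and "continuous_on {0..1} f" "f ` {0..1} \<subseteq> {0..1}"
    and "\<And>t. t \<in> {0..1} \<Longrightarrow> q t = p (f t)"
  shows "path_degree q = L (f 1) \<otimes> inv (L (f 0))"
  using path_degree_eq[OF is_lift_cong[OF is_lift_compose[OF assms(1-3)]]] assms(4) by simp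

lemma path_degree_star:
  assumes p: "pathin T p" and a: "a \<in> topspace T" and N: "p ` {0..1} \<subseteq> N a"
  shows "path_degree p = inv (\<rho> a (p 1)) \<otimes> \<rho> a (p 0)"
  using path_degree_eq[OF is_lift_local[OF p[unfolded pathin_def] a N]] N \<rho>_closed[OF a, of "p 0"]
  by (simp add: image_subset_iff)

text \<open>Lift the whole homotopy. On the sides where the endpoints rest the transport is trivial
  by \<open>\<rho>_self\<close>, so the lift is constant there, and the first and last path give the
  same quotient.\<close>

lemma path_degree_homotopic:
  assumes "path_homotopic T a b p q" shows "path_degree p = path_degree q"
proof -
  obtain h :: "real \<times> real \<Rightarrow> 'a" where h: "continuous_map (top_of_set ({0..1} \<times> {0..1})) T h"
     "\<forall>x. h (0, x) = p x" "\<forall>x. h (1, x) = q x" "\<forall>s\<in>{0..1}. h (s, 0) = a \<and> h (s, 1) = b"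
    using assms unfolding path_homotopic_def homotopic_with_def prod_topology_subtopology_eu by blast
  obtain L where L: "is_lift ({0..1} \<times> {0..1}) h L" using lift_exists_homotopy[OF h(1)] by blast
  have row: "is_lift {0..1} (\<lambda>t. h (s, t)) (\<lambda>t. L (s, t))" if "s \<in> {0..1}" for s
    by (rule is_lift_compose[OF L]) (use that in \<open>auto intro!: continuous_intros\<close>)
  have col: "L (1, t) = L (0, t)" if t: "t = 0 \<or> t = 1" for t
  proof -
    have "is_lift {0..1} (\<lambda>s. h (s, t)) (\<lambda>s. L (s, t))"
      by (rule is_lift_compose[OF L]) (use t in \<open>auto intro!: continuous_intros\<close>)
    then have l: "is_lift {0..1} (\<lambda>s. h (0, t)) (\<lambda>s. L (s, t))"
      by (rule is_lift_cong) (use t h(4) in auto)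
    have t': "h (0, t) \<in> topspace T" using is_liftD(1)[OF l, of 0] by simp
    have "L (0, t) = L (1, t)"
    proof (rule connected_local_const[of "{0..1::real}" 0 1 "\<lambda>s. L (s, t)"], simp_all, intro ballI)
      fix s :: real assume s: "s \<in> {0..1}"
      obtain U where U: "open U" "s \<in> U" "\<forall>s'\<in>{0..1} \<inter> U. h (0, t) \<in> N (h (0, t)) \<and> L (s, t) = \<rho> (h (0, t)) (h (0, t)) \<otimes> L (s', t)"
        using is_liftD(3)[OF l s] by blast
      have "L (s, t) = L (s', t)" if "s' \<in> {0..1}" "s' \<in> U" for s'
        using U(3) that is_liftD(2)[OF l] t' by (auto simp: \<rho>_self)
      then show "\<forall>\<^sub>F s' in at s within {0..1}. L (s, t) = L (s', t)"
        unfolding eventually_at_topological using U(1,2) by blast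
    qed
    then show ?thesis ..
  qed
  have "path_degree p = L (0, 1) \<otimes> inv (L (0, 0))"
    using path_degree_eq[OF is_lift_cong[OF row[of 0], of p]] h(2) by simp
  moreover have "path_degree q = L (1, 1) \<otimes> inv (L (1, 0))"
    using path_degree_eq[OF is_lift_cong[OF row[of 1], of q]] h(3) by simp
  ultimately show ?thesis using col by simp
qed

lemma path_degree_then:
  assumes p: "path_from_to T a b p" and q: "path_from_to T b c q"
  shows "path_degree (path_then p q) = path_degree q \<otimes> path_degree p"
proof -
  obtain L where L: "is_lift {0..1} (path_then p q) L"
    using lift_exists_path path_from_to_then[OF p q] unfolding path_from_to_def by blast
  have c: "L 0 \<in> carrier G" "L (1/2) \<in> carrier G" "L 1 \<in> carrier G" using is_liftD(2)[OF L] by auto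
  have "path_degree p = L (1/2) \<otimes> inv (L 0)"
  proof -
    have "p t = path_then p q (t / 2)" if "t \<in> {0..1}" for t
      using that by (simp add: path_then_def)
    moreover have "continuous_on {0..1} (\<lambda>t::real. t / 2)" by (intro continuous_intros) simp
    moreover have "(\<lambda>t::real. t / 2) ` {0..1} \<subseteq> {0..1}" by auto
    ultimately show ?thesis using path_degree_reparam[OF L, of "\<lambda>t. t / 2" p] by simp
  qed
  moreover have "path_degree q = L 1 \<otimes> inv (L (1/2))"
  proof -
    have "q t = path_then p q ((t + 1) / 2)" if "t \<in> {0..1}" for t
      using that p q by (cases "t = 0") (auto simp: path_then_def path_from_to_def field_simps)
    moreover have "continuous_on {0..1} (\<lambda>t::real. (t + 1) / 2)" by (intro continuous_intros) simp
    moreover have "(\<lambda>t::real. (t + 1) / 2) ` {0..1} \<subseteq> {0..1}" by auto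
    ultimately show ?thesis
      using path_degree_reparam[OF L, of "\<lambda>t. (t + 1) / 2" q] by simp
  qed
  moreover have "path_degree (path_then p q) = L 1 \<otimes> inv (L 0)" by (rule path_degree_eq[OF L])
  ultimately show ?thesis using c by (simp add: m_assoc inv_solve_left)
qed

lemma path_degree_rev:
  assumes p: "pathin T p" shows "path_degree (rev_path p) = inv (path_degree p)"
proof -
  obtain L where L: "is_lift {0..1} p L" using lift_exists_path[OF p] by blast
  have "path_degree (rev_path p) = L (1 - 1) \<otimes> inv (L (1 - 0))"
    by (rule path_degree_reparam[OF L, where f = "\<lambda>t. 1 - t"]) (auto simp: rev_path_def intro!: continuous_intros)
  moreover have "L 0 \<in> carrier G" "L 1 \<in> carrier G" using is_liftD(2)[OF L] by auto
  ultimately show ?thesis using path_degree_eq[OF L] by (simp add: inv_mult_group)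
qed

lemma path_degree_const: "a \<in> topspace T \<Longrightarrow> path_degree (\<lambda>_. a) = \<one>"
  using path_degree_star[of "\<lambda>_. a" a] N_self[of a] by (simp add: \<rho>_self image_subset_iff)

lemma path_degree_cong:
  "path_from_to T a b p \<Longrightarrow> (\<And>t. t \<in> {0..1} \<Longrightarrow> p t = q t) \<Longrightarrow> path_degree p = path_degree q"
  using path_degree_homotopic[OF path_homotopic_equal] by blast

end

section \<open>The graph and the complex\<close>

definition graph_points :: "('o, 'k, 'm) kcat \<Rightarrow> 'o cw_point set" where
  "graph_points C = Vertex ` Obj C \<union> {EdgePt x y t | x y t. (x, y) \<in> cw_edges C \<and> 0 < t \<and> t < 1}"

text \<open>The 1-skeleton carries its own weak topology; that it is a subspace of the complex is never
  needed, only that its inclusion is continuous.\<close>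

definition graph_open :: "('o, 'k, 'm) kcat \<Rightarrow> 'o cw_point set \<Rightarrow> bool" where
  "graph_open C U \<longleftrightarrow> U \<subseteq> graph_points C \<and>
     (\<forall>(x, y) \<in> cw_edges C. openin (top_of_set {0..1}) {t \<in> {0..1}. edge_map x y t \<in> U})"

definition graph_top :: "('o, 'k, 'm) kcat \<Rightarrow> 'o cw_point topology" where
  "graph_top C = topology (graph_open C)"

lemma istopology_graph_open: "istopology (graph_open C)"
  unfolding istopology_def
proof (intro conjI allI impI)
  fix S T assume S: "graph_open C S" and T: "graph_open C T"
  have *: "{t \<in> D. f t \<in> S \<inter> T} = {t \<in> D. f t \<in> S} \<inter> {t \<in> D. f t \<in> T}"
    for f :: "'x \<Rightarrow> 'a cw_point" and D by auto
  show "graph_open C (S \<inter> T)"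
    using S T unfolding graph_open_def * by (auto intro: openin_Int)
next
  fix \<U> assume U: "\<forall>S \<in> \<U>. graph_open C S"
  have *: "{t \<in> D. f t \<in> \<Union>\<U>} = \<Union> ((\<lambda>S. {t \<in> D. f t \<in> S}) ` \<U>)"
    for f :: "'x \<Rightarrow> 'a cw_point" and D by auto
  show "graph_open C (\<Union>\<U>)"
    using U unfolding graph_open_def * by (fastforce intro!: openin_Union)
qed

lemma openin_graph: "openin (graph_top C) U \<longleftrightarrow> graph_open C U"
  by (simp add: graph_top_def istopology_graph_open)

lemma edge_map_simps [simp]:
  "edge_map x y 0 = Vertex x" "edge_map x y 1 = Vertex y"
  by (auto simp: edge_map_def)

lemma edge_map_in_graph: "(x, y) \<in> cw_edges C \<Longrightarrow> edge_map x y t \<in> graph_points C"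
  by (auto simp: edge_map_def graph_points_def cw_edges_def)

lemma openin_preimage_whole:
  assumes "\<And>t. t \<in> D \<Longrightarrow> f t \<in> U"
  shows "openin (top_of_set D) {t \<in> D. f t \<in> U}"
proof -
  have "{t \<in> D. f t \<in> U} = D" using assms by auto
  then show ?thesis by simp
qed

lemma topspace_graph [simp]: "topspace (graph_top C) = graph_points C"
proof -
  have "graph_open C (graph_points C)"
    by (auto simp: graph_open_def intro!: openin_preimage_whole edge_map_in_graph simp del: atLeastAtMost_iff)
  then show ?thesis
    unfolding topspace_def openin_graph by (auto simp: graph_open_def)
qed

lemma continuous_map_top_of_setI:
  assumes "\<And>s. s \<in> S \<Longrightarrow> f s \<in> topspace T"
    and "\<And>U. openin T U \<Longrightarrow> openin (top_of_set S) {s \<in> S. f s \<in> U}"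
  shows "continuous_map (top_of_set S) T f"
  using assms by (auto simp: continuous_map)

lemma edge_map_continuous_graph:
  "(x, y) \<in> cw_edges C \<Longrightarrow> continuous_map (top_of_set {0..1}) (graph_top C) (edge_map x y)"
  by (rule continuous_map_top_of_setI) (auto simp: edge_map_in_graph openin_graph graph_open_def)

lemma graph_points_subset: "graph_points C \<subseteq> cw_points C e"
  by (auto simp: graph_points_def cw_points_def)

lemma nonzero_mor_edge:
  assumes "nonzero_mor C x y f" shows "x \<in> Obj C" "y \<in> Obj C" "x \<noteq> y \<Longrightarrow> (x, y) \<in> cw_edges C"
  using assms by (auto simp: nonzero_mor_def cw_edges_def nonzero_space_def)

section \<open>Paths described by walks\<close>

lemma virt_path_ends [simp]: "virt_path v 0 = Vertex (vsource v)" "virt_path v 1 = Vertex (vtarget v)"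
  by (cases v; simp)+

lemma virt_path_continuous:
  assumes "is_virtual C v"
  shows "continuous_map (top_of_set {0..1}) (graph_top C) (virt_path v)"
proof -
  have *: "continuous_map (top_of_set {0..1}) (graph_top C) (\<lambda>t. Vertex x)" if "x \<in> Obj C" for x
    using that by (auto simp: graph_points_def)
  show ?thesis
  proof (cases v)
    case (Pos x y f)
    show ?thesis
    proof (cases "x = y")
      case True
      then show ?thesis using Pos assms nonzero_mor_edge[of C x y f] by (intro continuous_map_eq[OF *[of x]]) auto
    next
      case False
      then show ?thesis using Pos assms nonzero_mor_edge[of C x y f]
        by (intro continuous_map_eq[OF edge_map_continuous_graph[of x y C]]) auto
    qed
  next
    case (Neg x y f)
    have "continuous_map (top_of_set {0..1}) (graph_top C) (\<lambda>t. edge_map x y (1 - t))" if "(x, y) \<in> cw_edges C"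
      by (rule continuous_map_real_comp[OF edge_map_continuous_graph[OF that], where f = "\<lambda>t. 1 - t"])
        (auto intro!: continuous_intros)
    note ** = this
    show ?thesis
    proof (cases "x = y")
      case True
      then show ?thesis using Neg assms nonzero_mor_edge[of C x y f] by (intro continuous_map_eq[OF *[of x]]) auto
    next
      case False
      then show ?thesis using Neg assms nonzero_mor_edge[of C x y f] by (intro continuous_map_eq[OF **]) auto
    qed
  qed
qed

text \<open>The walk conditions in order of traversal: the list is stored backwards, so step
  \<open>i\<close>, counted from 0, is \<open>rev w ! i\<close>, as in
  \<open>walk_path\<close>.\<close>

lemma is_walkD:
  assumes "is_walk C x y w"
  shows "w \<noteq> []" "\<And>v. v \<in> set w \<Longrightarrow> is_virtual C v"
    "\<And>i. Suc i < length w \<Longrightarrow> vtarget (rev w ! i) = vsource (rev w ! Suc i)"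
    "vsource (rev w ! 0) = x" "vtarget (rev w ! (length w - 1)) = y"
proof -
  show ne: "w \<noteq> []" and "\<And>v. v \<in> set w \<Longrightarrow> is_virtual C v" using assms by (auto simp: is_walk_def)
  show "vtarget (rev w ! i) = vsource (rev w ! Suc i)" if "Suc i < length w" for i
  proof -
    have "vtarget (w ! Suc (length w - Suc (Suc i))) = vsource (w ! (length w - Suc (Suc i)))"
      using assms that unfolding is_walk_def by auto
    then show ?thesis using that by (simp add: rev_nth Suc_diff_Suc)
  qed
  show "vsource (rev w ! 0) = x" "vtarget (rev w ! (length w - 1)) = y"
    using assms ne by (simp_all add: is_walk_def rev_nth last_conv_nth hd_conv_nth)
qed

text \<open>The right end of the time interval is included although the floor already selects the
  next step there. The two steps agree because the target of one is the source of the next; at time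
  1 the \<open>min\<close> in \<open>walk_path\<close> retains the last step.\<close>

lemma walk_path_piece:
  assumes w: "is_walk C x y w" and i: "i < length w"
    and t: "real i \<le> real (length w) * t" "real (length w) * t \<le> real i + 1"
  shows "walk_path w t = virt_path (rev w ! i) (real (length w) * t - real i)"
proof (cases "real (length w) * t < real i + 1")
  case True
  then have "\<lfloor>real (length w) * t\<rfloor> = int i" using t by (simp add: floor_eq_iff)
  then show ?thesis using i by (simp add: walk_path_def Let_def)
next
  case False
  then have e: "real (length w) * t = real i + 1" using t by simp
  then have "\<lfloor>real (length w) * t\<rfloor> = int (Suc i)" by (simp add: floor_eq_iff)
  then have n: "nat \<lfloor>real (length w) * t\<rfloor> = Suc i" by simp
  show ?thesis
  proof (cases "Suc i < length w")
    case True
    then show ?thesis using is_walkD(3)[OF w True] n e by (simp add: walk_path_def Let_def)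
  next
    case F: False
    then have "length w - 1 = i" using i by simp
    then show ?thesis using n by (simp add: walk_path_def Let_def)
  qed
qed

lemma walk_piece_exists:
  assumes w: "w \<noteq> []" and t: "t \<in> {0..1::real}"
  obtains i where "i < length w" "real i \<le> real (length w) * t" "real (length w) * t \<le> real i + 1"
proof -
  define i where "i = min (length w - 1) (nat \<lfloor>real (length w) * t\<rfloor>)"
  have "real (length w) * t \<le> real (length w)" using t by (simp add: mult_left_le)
  moreover have "0 \<le> real (length w) * t" using t by simp
  ultimately have "real i \<le> real (length w) * t" "real (length w) * t \<le> real i + 1" "i < length w"
    using w unfolding i_def by (auto simp: min_def; linarith)+
  then show ?thesis using that by blast
qed

lemma walk_path_ends:
  assumes "is_walk C x y w" shows "walk_path w 0 = Vertex x" "walk_path w 1 = Vertex y"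
proof -
  have n: "0 < length w" using is_walkD(1)[OF assms] by simp
  show "walk_path w 0 = Vertex x"
    using walk_path_piece[OF assms n, of 0] is_walkD(4)[OF assms] by simp
  show "walk_path w 1 = Vertex y"
    using walk_path_piece[OF assms, of "length w - 1" 1] is_walkD(5)[OF assms] n by (simp add: of_nat_diff)
qed

lemma walk_path_continuous:
  assumes w: "is_walk C x y w"
  shows "path_from_to (graph_top C) (Vertex x) (Vertex y) (walk_path w)"
proof -
  define n where "n = real (length w)"
  have n: "n > 0" using is_walkD(1)[OF w] by (simp add: n_def)
  define T where "T i = {t \<in> {0..1}. real i \<le> n * t \<and> n * t \<le> real i + 1}" for i
  have "continuous_map (top_of_set {0..1}) (graph_top C) (walk_path w)"
  proof (rule pasting_lemma_closed[where I = "{..<length w}" and T = T and f = "\<lambda>_. walk_path w"])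
    fix i assume i: "i \<in> {..<length w}"
    have "closed (T i)" unfolding T_def
      by (intro closed_Collect_conj closed_Collect_le continuous_intros | simp add: Collect_conj_eq closed_Int)+
    then show "closedin (top_of_set {0..1}) (T i)"
      by (intro closed_subset) (auto simp: T_def)
    have c: "continuous_map (top_of_set {0..1}) (graph_top C) (virt_path (rev w ! i))"
      by (rule virt_path_continuous, rule is_walkD(2)[OF w]) (use i nth_mem[of i "rev w"] in auto)
    have "continuous_map (top_of_set (T i)) (graph_top C) (\<lambda>t. virt_path (rev w ! i) (n * t - real i))"
      by (rule continuous_map_real_comp[OF c, where f = "\<lambda>t. n * t - real i"])
        (auto simp: T_def intro!: continuous_intros)
    then have "continuous_map (top_of_set (T i)) (graph_top C) (walk_path w)"
      by (rule continuous_map_eq) (use walk_path_piece[OF w] i in \<open>auto simp: T_def n_def\<close>)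
    moreover have "subtopology (top_of_set {0..1}) (T i) = top_of_set (T i)"
      unfolding subtopology_subtopology by (rule arg_cong[of _ _ "\<lambda>S. top_of_set S"]) (auto simp: T_def)
    ultimately show "continuous_map (subtopology (top_of_set {0..1}) (T i)) (graph_top C) (walk_path w)" by simp
  next
    fix t :: real assume "t \<in> topspace (top_of_set {0..1})"
    then show "\<exists>j. j \<in> {..<length w} \<and> t \<in> T j \<and> walk_path w t = walk_path w t"
      using walk_piece_exists[OF is_walkD(1)[OF w], of t] unfolding T_def n_def by auto
  qed auto
  then show ?thesis using walk_path_ends[OF w] by (simp add: path_from_to_def pathin_def)
qed

fun virt_edge :: "('o, 'm) virt \<Rightarrow> 'o \<times> 'o" where
  "virt_edge (Pos x y f) = (x, y)"
| "virt_edge (Neg x y f) = (x, y)"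

lemma virt_path_cases:
  "virt_path v t \<in> {Vertex (vsource v), Vertex (vtarget v)} \<union> {EdgePt x y s | x y s. virt_edge v = (x, y)}"
  by (cases v) (auto simp: edge_map_def)

lemma walk_path_cases:
  assumes w: "is_walk C x y w" and t: "t \<in> {0..1}"
  shows "\<exists>v\<in>set w. walk_path w t \<in> {Vertex (vsource v), Vertex (vtarget v)} \<union> {EdgePt x y s | x y s. virt_edge v = (x, y)}"
proof -
  obtain i where i: "i < length w" "real i \<le> real (length w) * t" "real (length w) * t \<le> real i + 1"
    using walk_piece_exists[OF is_walkD(1)[OF w] t] .
  have "rev w ! i \<in> set w" using i nth_mem[of i "rev w"] by simp
  then show ?thesis
    unfolding walk_path_piece[OF w i] by (intro bexI[of _ "rev w ! i"] virt_path_cases)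
qed

text \<open>The image of the point 1 of the circle. For a pair it is whichever object the choice in
  \<open>face_boundary\<close> starts from.\<close>

definition face_base :: "('o \<Rightarrow> 'o \<Rightarrow> 'm) \<Rightarrow> 'o face \<Rightarrow> 'o" where
  "face_base e c = vsource (last (face_boundary e c))"

fun cell_base :: "('o \<Rightarrow> 'o \<Rightarrow> 'm) \<Rightarrow> 'o cw_point \<Rightarrow> 'o" where
  "cell_base e (Vertex x) = x"
| "cell_base e (EdgePt x y t) = x"
| "cell_base e (FacePt c z) = face_base e c"

section \<open>Characteristic maps and open sets of the complex\<close>

locale based_category =
  fixes C :: "('o, 'k, 'm) kcat" and e :: "'o \<Rightarrow> 'o \<Rightarrow> 'm"
  assumes basis: "basis_choice C e"
begin

abbreviation "W \<equiv> CW C e"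
abbreviation "\<G> \<equiv> graph_top C"

lemma e_nonzero: "x \<in> Obj C \<Longrightarrow> y \<in> Obj C \<Longrightarrow> nonzero_space C x y \<Longrightarrow> nonzero_mor C x y (e x y)"
  using basis by (auto simp: basis_choice_def)

text \<open>For a pair, \<open>face_boundary\<close> may start at either object, whereas membership
  in \<open>cw_faces\<close> records the composite at one of them only. Hence the disjunction about
  the two composites.\<close>

lemma face_cases [consumes 1, case_names Tri Bi]:
  assumes "c \<in> cw_faces C e"
  obtains x y z where "face_boundary e c = [Neg x z (e x z), Pos y z (e y z), Pos x y (e x y)]"
      "x \<in> Obj C" "y \<in> Obj C" "z \<in> Obj C" "x \<noteq> y" "y \<noteq> z" "x \<noteq> z"
      "nonzero_space C x y" "nonzero_space C y z" "nonzero_space C x z"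
      "Cmp C x y z (e y z) (e x y) \<noteq> \<zero>\<^bsub>Mor C x z\<^esub>"
    | x y where "face_boundary e c = [Pos y x (e y x), Pos x y (e x y)]"
      "x \<in> Obj C" "y \<in> Obj C" "x \<noteq> y" "nonzero_space C x y" "nonzero_space C y x"
      "Cmp C x y x (e y x) (e x y) \<noteq> \<zero>\<^bsub>Mor C x x\<^esub> \<or> Cmp C y x y (e x y) (e y x) \<noteq> \<zero>\<^bsub>Mor C y y\<^esub>"
proof -
  have "(\<exists>x y z. c = Tri x y z \<and> x \<in> Obj C \<and> y \<in> Obj C \<and> z \<in> Obj C \<and> x \<noteq> y \<and> y \<noteq> z \<and> x \<noteq> z \<and>
      nonzero_space C x y \<and> nonzero_space C y z \<and> nonzero_space C x z \<and> Cmp C x y z (e y z) (e x y) \<noteq> \<zero>\<^bsub>Mor C x z\<^esub>)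
    \<or> (\<exists>x y. c = Bi {x, y} \<and> x \<in> Obj C \<and> y \<in> Obj C \<and> x \<noteq> y \<and>
      nonzero_space C x y \<and> nonzero_space C y x \<and> Cmp C x y x (e y x) (e x y) \<noteq> \<zero>\<^bsub>Mor C x x\<^esub>)"
    using assms unfolding cw_faces_def by blast
  then consider (a) x y z where "c = Tri x y z" "x \<in> Obj C" "y \<in> Obj C" "z \<in> Obj C" "x \<noteq> y" "y \<noteq> z" "x \<noteq> z"
      "nonzero_space C x y" "nonzero_space C y z" "nonzero_space C x z" "Cmp C x y z (e y z) (e x y) \<noteq> \<zero>\<^bsub>Mor C x z\<^esub>"
    | (b) x y where "c = Bi {x, y}" "x \<in> Obj C" "y \<in> Obj C" "x \<noteq> y"
      "nonzero_space C x y" "nonzero_space C y x" "Cmp C x y x (e y x) (e x y) \<noteq> \<zero>\<^bsub>Mor C x x\<^esub>"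
    by blast
  then show ?thesis
  proof cases
    case a then show ?thesis using that(1)[of x z y] by simp
  next
    case b
    define q where "q = (SOME q. {x, y} = {fst q, snd q})"
    have "{x, y} = {fst q, snd q}" unfolding q_def by (rule someI[of _ "(x, y)"]) simp
    then have q: "q = (x, y) \<or> q = (y, x)" using b(4) by (cases q) (auto simp: doubleton_eq_iff)
    have "face_boundary e c = [Pos (snd q) (fst q) (e (snd q) (fst q)), Pos (fst q) (snd q) (e (fst q) (snd q))]"
      using b(1) by (simp add: q_def case_prod_beta Let_def)
    then show ?thesis using q that(2)[of y x] that(2)[of x y] b by auto
  qed
qed

lemma face_boundary_walk:
  assumes c: "c \<in> cw_faces C e"
  shows "is_walk C (face_base e c) (face_base e c) (face_boundary e c)"
  using c
proof (cases rule: face_cases)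
  case (Tri x y z)
  have "vtarget ([Neg x z (e x z), Pos y z (e y z), Pos x y (e x y)] ! Suc i)
      = vsource ([Neg x z (e x z), Pos y z (e y z), Pos x y (e x y)] ! i)" if "i < 2" for i
    using that by (auto simp: less_2_cases_iff)
  then show ?thesis using Tri e_nonzero by (auto simp: is_walk_def face_base_def)
next
  case (Bi x y)
  then show ?thesis using e_nonzero by (auto simp: is_walk_def face_base_def)
qed

lemma face_base_Obj: "c \<in> cw_faces C e \<Longrightarrow> face_base e c \<in> Obj C"
  by (erule face_cases) (auto simp: face_base_def)

lemma boundary_in_graph:
  assumes "c \<in> cw_faces C e" "t \<in> {0..1}"
  shows "walk_path (face_boundary e c) t \<in> graph_points C"
  using walk_path_continuous[OF face_boundary_walk[OF assms(1)]] assms(2)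
  by (auto simp: path_from_to_def pathin_def continuous_map)

lemma Arg2pi_unit: "Arg2pi z / (2 * pi) \<in> {0..1}"
  using Arg2pi_ge_0[of z] Arg2pi_lt_2pi[of z] by auto

lemma face_map_in: "c \<in> cw_faces C e \<Longrightarrow> face_map e c z \<in> cw_points C e"
  using subsetD[OF graph_points_subset boundary_in_graph[OF _ Arg2pi_unit]]
  by (cases "norm z < 1") (simp_all add: face_map_def, simp add: cw_points_def)

lemma edge_map_in: "(x, y) \<in> cw_edges C \<Longrightarrow> edge_map x y t \<in> cw_points C e"
  by (rule subsetD[OF graph_points_subset edge_map_in_graph])

lemma topspace_CW [simp]: "topspace W = cw_points C e"
proof -
  have "cw_open C e (cw_points C e)"
    by (auto simp: cw_open_def intro!: openin_preimage_whole edge_map_in face_map_in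
        simp del: atLeastAtMost_iff mem_cball_0 mem_cball)
  then show ?thesis
    unfolding topspace_def openin_CW by (auto simp: cw_open_def)
qed

lemma face_map_continuous:
  "c \<in> cw_faces C e \<Longrightarrow> continuous_map (top_of_set (cball 0 1)) W (face_map e c)"
  by (rule continuous_map_top_of_setI) (auto simp: face_map_in openin_CW cw_open_def)

lemma graph_CW_continuous: "continuous_map \<G> W (\<lambda>a. a)"
  unfolding continuous_map
proof (intro conjI allI impI)
  fix U assume "openin W U"
  then have U: "cw_open C e U" by (simp add: openin_CW)
  have "{t \<in> {0..1}. edge_map x y t \<in> {a \<in> graph_points C. a \<in> U}} = {t \<in> {0..1}. edge_map x y t \<in> U}"
    if "(x, y) \<in> cw_edges C" for x y using edge_map_in_graph[OF that] by auto
  then have "graph_open C {a \<in> graph_points C. a \<in> U}"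
    using U unfolding graph_open_def cw_open_def by auto
  then show "openin \<G> {a \<in> topspace \<G>. a \<in> U}" by (simp add: openin_graph)
qed (use graph_points_subset in auto)

lemma pathin_graph_CW: "path_from_to \<G> a b p \<Longrightarrow> path_from_to W a b p"
  using continuous_map_compose[OF _ graph_CW_continuous] by (fastforce simp: path_from_to_def pathin_def o_def)

lemma path_homotopic_graph_CW: "path_homotopic \<G> a b p q \<Longrightarrow> path_homotopic W a b p q"
  using homotopic_with_compose_continuous_map_left[OF _ graph_CW_continuous]
  unfolding path_homotopic_def by (fastforce simp: o_def)

lemma edge_map_continuous:
  "(x, y) \<in> cw_edges C \<Longrightarrow> continuous_map (top_of_set {0..1}) W (edge_map x y)"
  using continuous_map_compose[OF edge_map_continuous_graph graph_CW_continuous] by (simp add: o_def)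

text \<open>The attaching map on the unit circle; it is not evidently continuous, as \<open>Arg2pi\<close> jumps at \<open>1\<close>.\<close>

definition attach :: "'o face \<Rightarrow> complex \<Rightarrow> 'o cw_point" where
  "attach c z = walk_path (face_boundary e c) (Arg2pi z / (2 * pi))"

lemma attach_exp:
  assumes c: "c \<in> cw_faces C e" and t: "t \<in> {0..1}"
  shows "attach c (exp (2 * pi * \<i> * t)) = walk_path (face_boundary e c) t"
\<comment> \<open>At \<open>t = 1\<close> the exponential is 1 and \<open>Arg2pi\<close> returns 0
  instead of the full angle; the formula survives because the boundary walk is closed.\<close>
proof (cases "t = 1")
  case True
  have "exp (2 * pi * \<i> * complex_of_real 1) = 1" by (simp add: mult_ac)
  then show ?thesis using walk_path_ends[OF face_boundary_walk[OF c]] True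
    by (simp add: attach_def Arg2pi_of_real[of 1, simplified])
next
  case False
  have "Arg2pi (exp (2 * pi * \<i> * t)) = 2 * pi * t"
    using t False by (subst Arg2pi_exp) auto
  then show ?thesis by (simp add: attach_def)
qed

lemma attach_in: "c \<in> cw_faces C e \<Longrightarrow> attach c z \<in> graph_points C"
  unfolding attach_def by (rule boundary_in_graph[OF _ Arg2pi_unit])

lemma exp_Arg2pi: "norm z = 1 \<Longrightarrow> exp (2 * pi * \<i> * (Arg2pi z / (2 * pi))) = z"
  using complex_norm_eq_1_exp[of z] by simp

text \<open>The exponential maps the interval onto the circle, so the preimage of a closed set under
  \<open>attach c\<close> is the image of a compact set of times, hence closed. This bypasses the
  jump of \<open>Arg2pi\<close>.\<close>

lemma attach_continuous:
  assumes c: "c \<in> cw_faces C e"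
  shows "continuous_map (top_of_set (sphere 0 1)) \<G> (attach c)"
  unfolding continuous_map_closedin
proof (intro conjI allI impI ballI)
  fix A assume A: "closedin \<G> A"
  let ?E = "\<lambda>t::real. exp (2 * pi * \<i> * t)"
  have "pathin \<G> (walk_path (face_boundary e c))"
    using walk_path_continuous[OF face_boundary_walk[OF c]] by (simp add: path_from_to_def)
  then have "closedin (top_of_set {0..1}) {t \<in> {0..1}. walk_path (face_boundary e c) t \<in> A}"
    using closedin_continuous_map_preimage[OF _ A] unfolding pathin_def by fastforce
  then have "compact {t \<in> {0..1}. walk_path (face_boundary e c) t \<in> A}"
    using closedin_compact by blast
  then have "compact (?E ` {t \<in> {0..1}. walk_path (face_boundary e c) t \<in> A})"
    by (intro compact_continuous_image continuous_intros)
  moreover have "?E ` {t \<in> {0..1}. walk_path (face_boundary e c) t \<in> A} = {z \<in> sphere 0 1. attach c z \<in> A}"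
  proof (intro equalityI subsetI)
    fix z assume "z \<in> ?E ` {t \<in> {0..1}. walk_path (face_boundary e c) t \<in> A}"
    then show "z \<in> {z \<in> sphere 0 1. attach c z \<in> A}" using attach_exp[OF c] by auto
  next
    fix z assume z: "z \<in> {z \<in> sphere 0 1. attach c z \<in> A}"
    then show "z \<in> ?E ` {t \<in> {0..1}. walk_path (face_boundary e c) t \<in> A}"
      using Arg2pi_unit[of z] exp_Arg2pi[of z]
      by (intro image_eqI[of _ _ "Arg2pi z / (2 * pi)"]) (auto simp: attach_def)
  qed
  ultimately show "closedin (top_of_set (sphere 0 1)) {z \<in> topspace (top_of_set (sphere 0 1)). attach c z \<in> A}"
    by (auto intro!: closed_subset dest: compact_imp_closed)
qed (simp add: attach_in[OF c])

lemma face_map_sphere: "norm z \<ge> 1 \<Longrightarrow> face_map e c z = attach c z"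
  by (simp add: face_map_def attach_def)

text \<open>Made for open stars of cells. If \<open>U\<close> meets the closed disc of a face at
  all, it contains the open face; what its preimage misses is then a closed part of the circle,
  which is determined by the graph.\<close>

lemma cw_openI:
  assumes U: "U \<subseteq> cw_points C e" and G: "graph_open C (U \<inter> graph_points C)"
    and F: "\<And>c z z'. c \<in> cw_faces C e \<Longrightarrow> norm z \<le> 1 \<Longrightarrow> face_map e c z \<in> U \<Longrightarrow> norm z' < 1 \<Longrightarrow> FacePt c z' \<in> U"
  shows "openin W U"
  unfolding openin_CW cw_open_def
proof (intro conjI U ballI)
  fix p assume p: "p \<in> cw_edges C"
  obtain x y where xy: "p = (x, y)" by (cases p)
  have "{t \<in> {0..1}. edge_map x y t \<in> U \<inter> graph_points C} = {t \<in> {0..1}. edge_map x y t \<in> U}"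
    using edge_map_in_graph[of x y C] p xy by auto
  then show "case p of (x, y) \<Rightarrow> openin (top_of_set {0..1}) {t \<in> {0..1}. edge_map x y t \<in> U}"
    using G p xy by (auto simp: graph_open_def)
next
  fix c assume c: "c \<in> cw_faces C e"
  show "openin (top_of_set (cball 0 1)) {z \<in> cball 0 1. face_map e c z \<in> U}"
  proof (cases "{z \<in> cball 0 1. face_map e c z \<in> U} = {}")
    case True then show ?thesis by (metis openin_empty)
  next
    case False
    then have "\<forall>z'. norm z' < 1 \<longrightarrow> FacePt c z' \<in> U" using F[OF c] by auto
    then have e: "{z \<in> cball 0 1. face_map e c z \<in> U} = cball 0 1 - (sphere 0 1 - {z \<in> sphere 0 1. attach c z \<in> U \<inter> graph_points C})"
      using attach_in[OF c] by (auto simp: face_map_def attach_def)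
    have "openin (top_of_set (sphere 0 1)) {z \<in> topspace (top_of_set (sphere 0 1)). attach c z \<in> U \<inter> graph_points C}"
      using G by (intro openin_continuous_map_preimage[OF attach_continuous[OF c]]) (simp add: openin_graph)
    then have "closedin (top_of_set (sphere 0 1)) (sphere 0 1 - {z \<in> sphere 0 1. attach c z \<in> U \<inter> graph_points C})"
      by (intro closedin_diff closedin_subtopology_refl[THEN iffD2]) auto
    then have "closed (sphere 0 1 - {z \<in> sphere 0 1. attach c z \<in> U \<inter> graph_points C})"
      using closedin_closed_trans closed_sphere by blast
    then have "closedin (top_of_set (cball 0 1)) (sphere 0 1 - {z \<in> sphere 0 1. attach c z \<in> U \<inter> graph_points C})"
      by (intro closed_subset) auto
    then show ?thesis unfolding e by (intro openin_diff openin_subtopology_self)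
  qed
qed

end

text \<open>What the topology asks of a grading: degrees of the chosen basis morphisms and one
  relation for each nonzero composite. The objects in \<open>d_comp\<close> may coincide;
  \<open>z = x\<close> together with \<open>d_self\<close> yields the relation of the cell of a
  pair.\<close>

locale graded_complex = based_category C e + group G
  for C :: "('o, 'k, 'm) kcat" and e :: "'o \<Rightarrow> 'o \<Rightarrow> 'm" and G :: "('g, 'h) monoid_scheme" (structure) +
  fixes d :: "'o \<Rightarrow> 'o \<Rightarrow> 'g"
  assumes d_closed: "x \<in> Obj C \<Longrightarrow> y \<in> Obj C \<Longrightarrow> nonzero_space C x y \<Longrightarrow> d x y \<in> carrier G"
    and d_self: "d x x = \<one>"
    and d_comp: "x \<in> Obj C \<Longrightarrow> y \<in> Obj C \<Longrightarrow> z \<in> Obj C \<Longrightarrow> nonzero_space C x y \<Longrightarrow>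
      nonzero_space C y z \<Longrightarrow> Cmp C x y z (e y z) (e x y) \<noteq> \<zero>\<^bsub>Mor C x z\<^esub> \<Longrightarrow> d y z \<otimes> d x y = d x z"
begin

text \<open>\<open>in_star a b\<close>: the open cell of \<open>a\<close> lies in the closure of the open cell of \<open>b\<close>.\<close>

fun in_star :: "'o cw_point \<Rightarrow> 'o cw_point \<Rightarrow> bool" where
  "in_star (Vertex x) b = (case b of Vertex y \<Rightarrow> y = x | EdgePt y z t \<Rightarrow> x = y \<or> x = z
     | FacePt c z \<Rightarrow> x \<in> vsource ` set (face_boundary e c))"
| "in_star (EdgePt x y s) b = (case b of Vertex z \<Rightarrow> False | EdgePt x' y' t \<Rightarrow> x' = x \<and> y' = y
     | FacePt c z \<Rightarrow> (x, y) \<in> virt_edge ` set (face_boundary e c))"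
| "in_star (FacePt c s) b = (case b of FacePt c' z \<Rightarrow> c' = c | _ \<Rightarrow> False)"

definition star :: "'o cw_point \<Rightarrow> 'o cw_point set" where
  "star a = {b \<in> cw_points C e. in_star a b}"

text \<open>\<open>face_cases\<close> leaves open which of the two composites is nonzero. In a group
  a product that is the unit may be taken in either order.\<close>

lemma d_bi:
  assumes "x \<in> Obj C" "y \<in> Obj C" "nonzero_space C x y" "nonzero_space C y x"
    "Cmp C x y x (e y x) (e x y) \<noteq> \<zero>\<^bsub>Mor C x x\<^esub> \<or> Cmp C y x y (e x y) (e y x) \<noteq> \<zero>\<^bsub>Mor C y y\<^esub>"
  shows "d y x \<otimes> d x y = \<one>"
  using assms(5)
proof
  assume "Cmp C x y x (e y x) (e x y) \<noteq> \<zero>\<^bsub>Mor C x x\<^esub>"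
  then show ?thesis using d_comp[of x y x] assms by (simp add: d_self)
next
  assume "Cmp C y x y (e x y) (e y x) \<noteq> \<zero>\<^bsub>Mor C y y\<^esub>"
  then have "d x y \<otimes> d y x = \<one>" using d_comp[of y x y] assms by (simp add: d_self)
  then show ?thesis by (rule inv_comm) (use d_closed assms in blast)+
qed

lemma boundary_target: "c \<in> cw_faces C e \<Longrightarrow> v \<in> set (face_boundary e c) \<Longrightarrow> vtarget v \<in> vsource ` set (face_boundary e c)"
  by (erule face_cases) auto

text \<open>The last conclusion is the relation of the 2-cell in cocycle form:
  \<open>d (face_base e c)\<close> is a potential for \<open>d\<close> along the boundary. For edges
  that leave the base it is trivial, and for the remaining edge it is the relation itself.\<close>

lemma boundary_edge:
  assumes "c \<in> cw_faces C e" "(x, y) \<in> virt_edge ` set (face_boundary e c)"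
  shows "x \<in> vsource ` set (face_boundary e c)" "y \<in> vsource ` set (face_boundary e c)" "(x, y) \<in> cw_edges C"
    "d x y \<otimes> d (face_base e c) x = d (face_base e c) y"
proof -
  have "x \<in> vsource ` set (face_boundary e c) \<and> y \<in> vsource ` set (face_boundary e c) \<and> (x, y) \<in> cw_edges C \<and>
    d x y \<otimes> d (face_base e c) x = d (face_base e c) y"
    using assms(1)
  proof (cases rule: face_cases)
    case (Tri p q r)
    then have "d p q \<in> carrier G" "d p r \<in> carrier G" "d q r \<otimes> d p q = d p r" by (auto intro: d_closed d_comp)
    then show ?thesis using Tri assms(2) by (auto simp: cw_edges_def face_base_def d_self)
  next
    case (Bi p q)
    then have "d p q \<in> carrier G" "d q p \<otimes> d p q = \<one>" by (auto intro: d_closed d_bi)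
    then show ?thesis using Bi assms(2) by (auto simp: cw_edges_def face_base_def d_self)
  qed
  then show "x \<in> vsource ` set (face_boundary e c)" "y \<in> vsource ` set (face_boundary e c)" "(x, y) \<in> cw_edges C"
    "d x y \<otimes> d (face_base e c) x = d (face_base e c) y" by auto
qed

lemma boundary_vertex:
  assumes "c \<in> cw_faces C e" "x \<in> vsource ` set (face_boundary e c)"
  shows "d (face_base e c) x \<in> carrier G"
  using assms(1)
proof (cases rule: face_cases)
  case (Tri p q r)
  then have "d p q \<in> carrier G" "d p r \<in> carrier G" by (auto intro: d_closed)
  then show ?thesis using Tri assms(2) by (auto simp: face_base_def d_self)
next
  case (Bi p q)
  then have "d p q \<in> carrier G" by (auto intro: d_closed)
  then show ?thesis using Bi assms(2) by (auto simp: face_base_def d_self)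
qed

text \<open>The transport from a cell to a cell in its closure is the degree between their starting
  vertices. The cocycle law has content only for a chain of a vertex, an edge and a face, where it
  is \<open>boundary_edge(4)\<close>; in every other chain one factor has the form
  \<open>d x x\<close>.\<close>

lemma star_cocycle: "star_cocycle G (CW C e) star (\<lambda>a b. d (cell_base e b) (cell_base e a))"
proof (unfold_locales, unfold topspace_CW)
  fix a assume a: "a \<in> cw_points C e"
  show "a \<in> star a" using a by (cases a) (auto simp: star_def)
  show "openin (CW C e) (star a)"
  proof (rule cw_openI)
    show "star a \<subseteq> cw_points C e" by (auto simp: star_def)
    have "openin (top_of_set {0..1}) {t \<in> {0..1}. edge_map x y t \<in> star a \<inter> graph_points C}"
      if xy: "(x, y) \<in> cw_edges C" for x y
    proof -
      note in_g = edge_map_in_graph[OF xy] and in_w = edge_map_in[OF xy]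
      have ne: "x \<noteq> y" using xy by (auto simp: cw_edges_def)
      have eq: "{t \<in> {0..1}. edge_map x y t \<in> star a \<inter> graph_points C} = {0..1} \<inter> {t. in_star a (edge_map x y t)}"
        using in_g in_w by (auto simp: star_def)
      \<comment> \<open>A star meets a closed edge in nothing, in all but its end, in all but its
        start, or in its interior; never in the whole edge, as the two ends are distinct.\<close>
      have "{0..1} \<inter> {t. in_star a (edge_map x y t)} \<in> {{}, {0..1} \<inter> {..<1}, {0..1} \<inter> {0<..}, {0..1} \<inter> {0<..<1}}"
      proof (cases a)
        case (Vertex z)
        have "in_star a (edge_map x y t) \<longleftrightarrow> (if z = x then t < 1 else if z = y then t > 0 else False)" for t
          using ne Vertex by (simp add: edge_map_def)
        then show ?thesis by (cases "z = x"; cases "z = y") (simp_all add: lessThan_def greaterThan_def)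
      next
        case (EdgePt x' y' s)
        have h: "in_star a (edge_map x y t) \<longleftrightarrow> (x' = x \<and> y' = y) \<and> t \<in> {0<..<1}" for t
          unfolding EdgePt by (simp add: edge_map_def eq_commute)
        show ?thesis unfolding h by (cases "x' = x \<and> y' = y") (simp_all only: simp_thms Collect_mem_eq insertI1 insertI2 insert_iff Collect_const if_False Int_empty_right)
      next
        case (FacePt c s)
        then have "\<not> in_star a (edge_map x y t)" for t by (simp add: edge_map_def)
        then show ?thesis by simp
      qed
      then show ?thesis unfolding eq by (elim insertE) (simp_all add: openin_open_Int)
    qed
    then show "graph_open C (star a \<inter> graph_points C)" by (auto simp: graph_open_def)
  next
    fix c z z' assume c: "c \<in> cw_faces C e" and z: "norm z \<le> 1" "face_map e c z \<in> star a" and z': "norm (z' :: complex) < 1"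
    have "in_star a (FacePt c z')"
    proof (cases "norm z < 1")
      case True
      then have "in_star a (FacePt c z)" using z by (simp add: face_map_def star_def)
      then show ?thesis by (cases a) auto
    next
      case False
      then have "in_star a (walk_path (face_boundary e c) (Arg2pi z / (2 * pi)))"
        using z by (simp add: face_map_def star_def)
      moreover obtain v where v: "v \<in> set (face_boundary e c)" "walk_path (face_boundary e c) (Arg2pi z / (2 * pi))
          \<in> {Vertex (vsource v), Vertex (vtarget v)} \<union> {EdgePt x y s | x y s. virt_edge v = (x, y)}"
        using walk_path_cases[OF face_boundary_walk[OF c] Arg2pi_unit] by blast
      ultimately consider y where "in_star a (Vertex y)" "y \<in> vsource ` set (face_boundary e c)"
        | x y s where "in_star a (EdgePt x y s)" "(x, y) \<in> virt_edge ` set (face_boundary e c)"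
        using boundary_target[OF c v(1)] by force
      then show ?thesis
      proof cases
        case 1 then show ?thesis by (cases a) auto
      next
        case 2 then show ?thesis using boundary_edge[OF c 2(2)] by (cases a) auto
      qed
    qed
    then show "FacePt c z' \<in> star a" using c z' by (auto simp: star_def cw_points_def)
  qed
next
  fix a b assume a: "a \<in> cw_points C e" and b: "b \<in> star a"
  then have b': "b \<in> cw_points C e" "in_star a b" by (auto simp: star_def)
  have face: "c \<in> cw_faces C e" if "FacePt c z \<in> cw_points C e" for c z
    using that by (auto simp: cw_points_def)
  have edge: "(x, y) \<in> cw_edges C" if "EdgePt x y t \<in> cw_points C e" for x y t
    using that by (auto simp: cw_points_def)
  have edge_d: "d x y \<in> carrier G" if "(x, y) \<in> cw_edges C" for x y
    using that d_closed by (auto simp: cw_edges_def)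
  show bc: "d (cell_base e b) (cell_base e a) \<in> carrier G"
    using b' 
    by (cases a; cases b) (auto simp: d_self dest!: face edge intro: boundary_vertex edge_d dest: boundary_edge(1))
  fix x assume "x \<in> star b"
  then have x: "x \<in> cw_points C e" "in_star b x" by (auto simp: star_def)
  have cl: "d (cell_base e x) (cell_base e b) \<in> carrier G"
    using x by (cases b; cases x) (auto simp: d_self dest!: face edge intro: boundary_vertex edge_d dest: boundary_edge(1))
  show "d (cell_base e b) (cell_base e a) \<otimes> d (cell_base e x) (cell_base e b) = d (cell_base e x) (cell_base e a)"
    using b' x cl bc
    by (cases a; cases b; cases x)
      (auto simp: d_self dest!: face edge intro: boundary_vertex edge_d dest: boundary_edge(1) boundary_edge(4))
qed

sublocale star_cocycle G "CW C e" star "\<lambda>a b. d (cell_base e b) (cell_base e a)"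
  by (rule star_cocycle)

text \<open>Cut at the midpoint. The first half lies in the star of \<open>Vertex x\<close>, where
  the transport is \<open>d x x\<close>. The second half lies in the star of
  \<open>Vertex y\<close>, where passing from the open edge, whose starting vertex is
  \<open>x\<close>, to \<open>y\<close> contributes \<open>d x y\<close>.\<close>

lemma path_degree_edge:
  assumes xy: "(x, y) \<in> cw_edges C"
  shows "path_degree (edge_map x y) = d x y"
proof -
  have o: "x \<in> Obj C" "y \<in> Obj C" "x \<noteq> y" "d x y \<in> carrier G" using xy d_closed by (auto simp: cw_edges_def)
  then have v: "Vertex x \<in> cw_points C e" "Vertex y \<in> cw_points C e" by (auto simp: cw_points_def)
  let ?p = "\<lambda>t. edge_map x y (t / 2)" and ?q = "\<lambda>t. edge_map x y ((t + 1) / 2)"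
  have p: "path_from_to W (Vertex x) (edge_map x y (1/2)) ?p"
    using path_from_to_comp[OF edge_map_continuous[OF xy], of "\<lambda>t. t / 2"] by (simp add: continuous_on_divide image_subset_iff)
  have q: "path_from_to W (edge_map x y (1/2)) (Vertex y) ?q"
    using path_from_to_comp[OF edge_map_continuous[OF xy], of "\<lambda>t. (t + 1) / 2"]
    by (simp add: continuous_on_divide continuous_on_add image_subset_iff)
  have pq: "path_then ?p ?q t = edge_map x y t" if "t \<in> {0..1}" for t
    by (auto simp: path_then_def)
  have sx: "edge_map x y t \<in> star (Vertex x)" if "t < 1" for t
    using that edge_map_in[OF xy, of t] by (simp add: star_def) (simp add: edge_map_def)
  have sy: "edge_map x y t \<in> star (Vertex y)" if "0 < t" for t
    using that edge_map_in[OF xy, of t] by (simp add: star_def) (simp add: edge_map_def)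
  have "?p ` {0..1} \<subseteq> star (Vertex x)" "?q ` {0..1} \<subseteq> star (Vertex y)"
    by (auto intro!: sx sy)
  moreover have "cell_base e (edge_map x y (1/2)) = x" by (simp add: edge_map_def)
  ultimately have "path_degree ?p = \<one>" "path_degree ?q = d x y"
    using path_degree_star[of ?p "Vertex x"] path_degree_star[of ?q "Vertex y"] p q v o
    by (simp_all add: path_from_to_def d_self)
  then have "path_degree (path_then ?p ?q) = d x y"
    using path_degree_then[OF p q] o by simp
  then show ?thesis using path_degree_cong[OF path_from_to_then[OF p q] pq] by simp
qed

fun virt_degree :: "('o, 'm) virt \<Rightarrow> 'g" where
  "virt_degree (Pos x y f) = d x y"
| "virt_degree (Neg x y f) = inv (d x y)"

lemma path_degree_virt:
  assumes v: "is_virtual C v" shows "path_degree (virt_path v) = virt_degree v"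
proof (cases v)
  case (Pos x y f)
  then have n: "nonzero_mor C x y f" using v by simp
  show ?thesis
  proof (cases "x = y")
    case True
    then have "virt_path v = (\<lambda>t. Vertex x)" using Pos by auto
    then show ?thesis using path_degree_const[of "Vertex x"] nonzero_mor_edge[OF n] Pos True
      by (simp add: cw_points_def d_self)
  next
    case False
    then have "virt_path v = edge_map x y" using Pos by auto
    then show ?thesis using path_degree_edge nonzero_mor_edge[OF n] Pos False by simp
  qed
next
  case (Neg x y f)
  then have n: "nonzero_mor C x y f" using v by simp
  show ?thesis
  proof (cases "x = y")
    case True
    then have "virt_path v = (\<lambda>t. Vertex x)" using Neg by auto
    then show ?thesis using path_degree_const[of "Vertex x"] nonzero_mor_edge[OF n] Neg True
      by (simp add: cw_points_def d_self)
  next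
    case False
    then have "virt_path v = rev_path (edge_map x y)" using Neg by (auto simp: rev_path_def)
    then show ?thesis using path_degree_rev[of "edge_map x y"] path_degree_edge nonzero_mor_edge[OF n] Neg False
      edge_map_continuous by (simp add: pathin_def)
  qed
qed

lemma virt_degree_closed: "is_virtual C v \<Longrightarrow> virt_degree v \<in> carrier G"
  using d_closed by (cases v) (auto simp: nonzero_mor_def nonzero_space_def)

abbreviation "total_degree w \<equiv> foldr (\<lambda>v g. virt_degree v \<otimes> g) w \<one>"

lemma path_degree_walk:
  assumes w: "is_walk C x y w"
  shows "path_degree (walk_path w) = total_degree w"
proof -
  define n where "n = length w"
  have n: "n > 0" using is_walkD(1)[OF w] by (simp add: n_def)
  have "pathin W (walk_path w)" using pathin_graph_CW[OF walk_path_continuous[OF w]] by (simp add: path_from_to_def)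
  then obtain L where L: "is_lift {0..1} (walk_path w) L" using lift_exists_path by blast
  have Lc: "L t \<in> carrier G" if "t \<in> {0..1}" for t using is_liftD(2)[OF L that] .
  \<comment> \<open>A lift sampled at the times \<open>i / n\<close> accumulates the degrees of the
    steps made so far. These are the last \<open>i\<close> entries of the list, which is stored
    backwards.\<close>
  have "i \<le> n \<Longrightarrow> L (real i / n) \<otimes> inv (L 0) = total_degree (drop (n - i) w)" for i
  proof (induction i)
    case 0 then show ?case using Lc[of 0] by (simp add: n_def)
  next
    case (Suc i)
    define v where "v = rev w ! i"
    have i: "i < length w" using Suc.prems by (simp add: n_def)
    have v: "v \<in> set w" unfolding v_def using i nth_mem[of i "rev w"] by simp
    have "drop (n - Suc i) w = w ! (n - Suc i) # drop (Suc (n - Suc i)) w"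
      using Suc.prems n by (intro Cons_nth_drop_Suc[symmetric]) (auto simp: n_def)
    moreover have "w ! (n - Suc i) = v" using i by (simp add: v_def rev_nth n_def)
    moreover have "Suc (n - Suc i) = n - i" using Suc.prems by simp
    ultimately have dr: "drop (n - Suc i) w = v # drop (n - i) w" by simp
    have "path_degree (virt_path v) = L ((real i + 1) / n) \<otimes> inv (L ((real i + 0) / n))"
    proof (rule path_degree_reparam[OF L])
      show "continuous_on {0..1} (\<lambda>t. (real i + t) / n)" using n by (intro continuous_intros) auto
      show "(\<lambda>t. (real i + t) / n) ` {0..1} \<subseteq> {0..1}" using Suc.prems n by (auto simp: field_simps)
      show "virt_path v t = walk_path w ((real i + t) / n)" if "t \<in> {0..1}" for t
        using walk_path_piece[OF w i, of "(real i + t) / n"] that n by (simp add: n_def v_def)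
    qed
    then have e: "virt_degree v = L ((real i + 1) / n) \<otimes> inv (L (real i / n))"
      using path_degree_virt is_walkD(2)[OF w v] by simp
    have "L ((real i + 1) / n) \<in> carrier G" "L (real i / n) \<in> carrier G" "L 0 \<in> carrier G"
      using Suc.prems n by (auto intro!: Lc simp: field_simps)
    then have "virt_degree v \<otimes> (L (real i / n) \<otimes> inv (L 0)) = L ((real i + 1) / n) \<otimes> inv (L 0)"
      unfolding e by (simp add: m_assoc inv_solve_left')
    then show ?case using Suc dr by (simp add: add.commute)
  qed
  from this[of n] show ?thesis using path_degree_eq[OF L] n by simp
qed

end

section \<open>Connecting paths and straight-line homotopies\<close>

lemma path_from_to_top_of_set:
  "path_from_to (top_of_set S) a b f \<longleftrightarrow> continuous_on {0..1} f \<and> f ` {0..1} \<subseteq> S \<and> f 0 = a \<and> f 1 = b"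
  by (auto simp: path_from_to_def pathin_def continuous_map_subtopology_eu)

lemma path_homotopic_image:
  fixes Q :: "'b::real_normed_vector \<Rightarrow> 'a"
  assumes Q: "continuous_map (top_of_set S) T Q" and S: "convex S"
    and f: "path_from_to (top_of_set S) a b f" and g: "path_from_to (top_of_set S) a b g"
    and p: "\<And>t. t \<in> {0..1} \<Longrightarrow> p t = Q (f t)" and q: "\<And>t. t \<in> {0..1} \<Longrightarrow> q t = Q (g t)"
  shows "path_homotopic T (Q a) (Q b) p q"
proof -
  note f' = f[unfolded path_from_to_top_of_set] and g' = g[unfolded path_from_to_top_of_set]
  have "path_homotopic T (p 0) (p 1) p q"
    by (rule path_homotopic_convex[OF Q S, of f g]) (use f' g' p q in auto)
  moreover have "p 0 = Q a" "p 1 = Q b" using p f' by auto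
  ultimately show ?thesis by simp
qed

text \<open>Homotopies out of the complex are checked cell by cell: since \<open>J\<close> is compact, the tube lemma in
  each cell makes \<open>{a. H a ` J \<subseteq> V}\<close> open in the weak topology.\<close>

lemma openin_tube:
  fixes D :: "'s::topological_space set"
  assumes D: "openin (top_of_set D) {s \<in> D. k s \<in> U}"
    and H: "continuous_map (top_of_set ({s \<in> D. k s \<in> U} \<times> {0..1})) T (\<lambda>z. H (k (fst z)) (snd z :: real))"
    and J: "compact J" "J \<subseteq> {0..1}" and V: "openin T V"
  shows "openin (top_of_set D) {s \<in> D. k s \<in> {a \<in> U. \<forall>t\<in>J. H a t \<in> V}}"
proof -
  let ?D = "{s \<in> D. k s \<in> U}"
  let ?P = "prod_topology (top_of_set ?D) (top_of_set {0..1::real})"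
  have W: "openin ?P {z \<in> ?D \<times> {0..1}. H (k (fst z)) (snd z) \<in> V}"
    using openin_continuous_map_preimage[OF H V] by simp
  have "openin (top_of_set ?D) {s \<in> ?D. \<forall>t\<in>J. H (k s) t \<in> V}"
  proof (subst openin_subopen, intro ballI)
    fix s assume s: "s \<in> {s \<in> ?D. \<forall>t\<in>J. H (k s) t \<in> V}"
    have "\<exists>A B. openin (top_of_set ?D) A \<and> openin (top_of_set {0..1}) B \<and> s \<in> A \<and> J \<subseteq> B \<and>
        A \<times> B \<subseteq> {z \<in> ?D \<times> {0..1}. H (k (fst z)) (snd z) \<in> V}"
      by (rule tube_lemma_right[OF W]) (use s J in \<open>auto simp: compactin_subtopology\<close>)
    then obtain A B where "openin (top_of_set ?D) A" "s \<in> A" "J \<subseteq> B" 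
      "A \<times> B \<subseteq> {z \<in> ?D \<times> {0..1}. H (k (fst z)) (snd z) \<in> V}" by blast
    moreover from this have "A \<subseteq> {s \<in> ?D. \<forall>t\<in>J. H (k s) t \<in> V}"
      using openin_imp_subset by fastforce
    ultimately show "\<exists>A. openin (top_of_set ?D) A \<and> s \<in> A \<and> A \<subseteq> {s \<in> ?D. \<forall>t\<in>J. H (k s) t \<in> V}"
      by blast
  qed
  then have "openin (top_of_set D) {s \<in> ?D. \<forall>t\<in>J. H (k s) t \<in> V}"
    using D openin_trans by blast
  moreover have "{s \<in> ?D. \<forall>t\<in>J. H (k s) t \<in> V} = {s \<in> D. k s \<in> {a \<in> U. \<forall>t\<in>J. H a t \<in> V}}" by auto
  ultimately show ?thesis by simp
qed

text \<open>Only the pullback along a path is claimed, so the domain is a plane square. Near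
  \<open>(s, t)\<close>, a compact interval \<open>J\<close> around \<open>t\<close> is chosen with
  \<open>H (p s)\<close> mapping \<open>J\<close> into \<open>V\<close>; the tube over
  \<open>J\<close> is then an open set around \<open>p s\<close>, and its preimage under
  \<open>p\<close> gives the other side of a neighbourhood.\<close>

lemma homotopy_from_tubes:
  assumes U: "openin T U" and pt: "\<And>a. a \<in> U \<Longrightarrow> continuous_map (top_of_set {0..1::real}) T' (H a)"
    and tubes: "\<And>J V. compact J \<Longrightarrow> J \<subseteq> {0..1} \<Longrightarrow> openin T' V \<Longrightarrow> openin T {a \<in> U. \<forall>t\<in>J. H a t \<in> V}"
    and p: "pathin T p" "p ` {0..1} \<subseteq> U"
  shows "continuous_map (top_of_set ({0..1} \<times> {0..1})) T' (\<lambda>z. H (p (fst z)) (snd z))"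
proof (rule continuous_map_top_of_setI)
  fix z :: "real \<times> real" assume "z \<in> {0..1} \<times> {0..1}"
  then show "H (p (fst z)) (snd z) \<in> topspace T'"
    using pt[of "p (fst z)"] p(2) by (fastforce simp: continuous_map mem_Times_iff)
next
  fix V assume V: "openin T' V"
  let ?R = "{z \<in> {0..1} \<times> {0..1}. H (p (fst z)) (snd z) \<in> V}"
  show "openin (top_of_set ({0..1} \<times> {0..1})) ?R"
  proof (subst openin_subopen, intro ballI)
    fix z assume z: "z \<in> ?R"
    obtain s t where st: "z = (s, t)" "s \<in> {0..1}" "t \<in> {0..1}" "H (p s) t \<in> V" using z by (cases z) auto
    have "openin (top_of_set {0..1}) {t \<in> topspace (top_of_set {0..1}). H (p s) t \<in> V}"
      using st(2) p(2) by (intro openin_continuous_map_preimage[OF pt V]) auto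
    then obtain d where d: "d > 0" "ball t d \<inter> {0..1} \<subseteq> {t \<in> {0..1}. H (p s) t \<in> V}"
      using st unfolding openin_contains_ball by auto
    define J where "J = cball t (d / 2) \<inter> {0..1}"
    have J: "compact J" "J \<subseteq> {0..1}" unfolding J_def by (auto intro!: compact_Int_closed)
    define A where "A = {a \<in> U. \<forall>t\<in>J. H a t \<in> V}"
    have "openin T A" unfolding A_def by (rule tubes[OF J V])
    then have A: "openin (top_of_set {0..1}) {s \<in> topspace (top_of_set {0..1}). p s \<in> A}"
      using p(1)[unfolded pathin_def] openin_continuous_map_preimage by blast
    have "J \<subseteq> ball t d \<inter> {0..1}" using d(1) by (auto simp: J_def)
    then have "p s \<in> A" using st(2) p(2) d(2) by (auto simp: A_def)
    let ?N = "{s \<in> {0..1}. p s \<in> A} \<times> ({0..1} \<inter> ball t (d / 2))"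
    have "openin (prod_topology (top_of_set {0..1}) (top_of_set {0..1})) ?N"
      using A by (intro openin_prod_Times_iff[THEN iffD2] disjI2 conjI openin_open_Int) auto
    then have "openin (top_of_set ({0..1} \<times> {0..1})) ?N" by simp
    moreover have "z \<in> ?N" using st \<open>p s \<in> A\<close> d by auto
    moreover have "?N \<subseteq> ?R" by (auto simp: A_def J_def)
    ultimately show "\<exists>N. openin (top_of_set ({0..1} \<times> {0..1})) N \<and> z \<in> N \<and> N \<subseteq> ?R" by blast
  qed
qed

section \<open>Composition and inversion of walks\<close>

lemma is_walk_append:
  assumes "is_walk C x y w" "is_walk C y z w'"
  shows "is_walk C x z (w' @ w)"
proof -
  have ne: "w \<noteq> []" "w' \<noteq> []" using assms by (auto simp: is_walk_def)
  have "vtarget ((w' @ w) ! Suc i) = vsource ((w' @ w) ! i)" if "Suc i < length (w' @ w)" for i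
  proof -
    consider "Suc i < length w'" | "Suc i = length w'" | "length w' \<le> i" by linarith
    then show ?thesis
    proof cases
      case 1 then show ?thesis using assms(2) by (simp add: nth_append is_walk_def)
    next
      case 2
      then have "i = length w' - 1" by simp
      then show ?thesis using assms 2 ne by (simp add: nth_append is_walk_def hd_conv_nth last_conv_nth)
    next
      case 3
      then have "(w' @ w) ! Suc i = w ! Suc (i - length w')" "(w' @ w) ! i = w ! (i - length w')"
        by (simp_all add: nth_append Suc_diff_le)
      then show ?thesis using assms(1) 3 that by (simp add: is_walk_def)
    qed
  qed
  then show ?thesis using assms ne by (auto simp: is_walk_def)
qed

lemma vinverse_simps [simp]: "vsource (vinverse v) = vtarget v" "vtarget (vinverse v) = vsource v"
  "is_virtual C (vinverse v) = is_virtual C v"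
  by (cases v; simp)+

lemma virt_path_vinverse: "virt_path (vinverse v) t = virt_path v (1 - t)"
  by (cases v) auto

lemma is_walk_inverse:
  assumes w: "is_walk C x y w" shows "is_walk C y x (walk_inverse w)"
proof -
  note D = is_walkD[OF w]
  have "vtarget (walk_inverse w ! Suc i) = vsource (walk_inverse w ! i)" if "Suc i < length w" for i
    using D(3)[OF that] that by (simp add: walk_inverse_def rev_map)
  moreover have "hd (rev w) = rev w ! 0" "last (rev w) = rev w ! (length w - 1)"
    using D(1) by (simp_all add: hd_conv_nth last_conv_nth)
  ultimately show ?thesis using D
    by (auto simp: is_walk_def walk_inverse_def rev_map hd_map last_map)
qed

lemma walk_path_inverse:
  assumes w: "is_walk C x y w" and t: "t \<in> {0..1}"
  shows "walk_path (walk_inverse w) t = rev_path (walk_path w) t"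
proof -
  obtain i where i: "i < length w" "real i \<le> real (length w) * (1 - t)" "real (length w) * (1 - t) \<le> real i + 1"
    using walk_piece_exists[OF is_walkD(1)[OF w], of "1 - t"] t by auto
  \<comment> \<open>Step \<open>i\<close> of \<open>w\<close>, counted from 0 and run backwards, is
    step \<open>j\<close> of the inverse walk.\<close>
  define j where "j = length w - 1 - i"
  have j: "real j = real (length w) - 1 - real i" "j < length (walk_inverse w)"
    using i by (auto simp: j_def walk_inverse_def)
  have l: "length (walk_inverse w) = length w" by (simp add: walk_inverse_def)
  have "walk_path (walk_inverse w) t = virt_path (rev (walk_inverse w) ! j) (real (length w) * t - real j)"
    using walk_path_piece[OF is_walk_inverse[OF w] j(2), of t] i unfolding l j(1) by (simp add: algebra_simps)
  also have "rev (walk_inverse w) ! j = vinverse (rev w ! i)"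
    using i by (simp add: walk_inverse_def rev_nth j_def)
  also have "virt_path \<dots> (real (length w) * t - real j) = virt_path (rev w ! i) (real (length w) * (1 - t) - real i)"
    by (simp add: virt_path_vinverse j(1) algebra_simps)
  also have "\<dots> = walk_path w (1 - t)" using walk_path_piece[OF w i] by simp
  finally show ?thesis by (simp add: rev_path_def)
qed

lemma walk_path_append:
  assumes w: "is_walk C x y w" and w': "is_walk C y z w'"
  shows "path_homotopic (graph_top C) (Vertex x) (Vertex z) (walk_path (w' @ w)) (path_then (walk_path w) (walk_path w'))"
proof (rule path_homotopic_reparam)
  define n m where "n = real (length w)" and "m = real (length w')"
  have nm: "n > 0" "m > 0" using is_walkD(1)[OF w] is_walkD(1)[OF w'] by (auto simp: n_def m_def)
  note ww = is_walk_append[OF w w']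
  have l: "real (length (w' @ w)) = n + m" by (simp add: n_def m_def)
  show "path_from_to (graph_top C) (Vertex x) (Vertex z) (path_then (walk_path w) (walk_path w'))"
    by (rule path_from_to_then[OF walk_path_continuous[OF w] walk_path_continuous[OF w']])
  \<comment> \<open>The two paths differ in speed only: the concatenated walk finishes
    \<open>w\<close> at time \<open>n / (n + m)\<close>, \<open>path_then\<close> at
    \<open>1/2\<close>. The first summand of \<open>?f\<close> rises to \<open>1/2\<close> and then
    rests, the second rests until then; \<open>lo\<close> and \<open>hi\<close> are the resulting
    linear pieces.\<close>
  let ?f = "\<lambda>t. min ((n + m) * t / (2 * n)) (1/2) + max 0 (((n + m) * t - n) / (2 * m))"
  show "continuous_on {0..1} ?f" using nm by (intro continuous_intros) auto
  show f01: "?f 0 = 0" "?f 1 = 1" using nm by (simp_all add: field_simps)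
  have lo: "?f t = (n + m) * t / (2 * n)" if "(n + m) * t \<le> n" for t
    using that nm by (simp add: min_def max_def divide_simps)
  have hi: "?f t = 1/2 + ((n + m) * t - n) / (2 * m)" if "n \<le> (n + m) * t" for t
    using that nm by (auto simp: min_def max_def divide_simps)
  show "?f ` {0..1} \<subseteq> {0..1}"
  proof clarify
    fix t :: real assume t: "t \<in> {0..1}"
    then have b: "0 \<le> (n + m) * t" "(n + m) * t \<le> n + m" using nm by (simp_all add: mult_left_le)
    show "?f t \<in> {0..1}"
    proof (cases "(n + m) * t \<le> n")
      case True then show ?thesis unfolding lo[OF True] using b nm by (simp add: divide_simps)
    next
      case False
      then have "n \<le> (n + m) * t" by simp
      moreover have "(n + m) * t - n \<le> m" using b by linarith
      then have "((n + m) * t - n) / (2 * m) \<le> 1/2" using nm by (simp add: pos_divide_le_eq)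
      moreover have "0 \<le> ((n + m) * t - n) / (2 * m)" using calculation(1) nm by simp
      ultimately show ?thesis
        unfolding hi[OF \<open>n \<le> (n + m) * t\<close>] by (simp only: atLeastAtMost_iff) linarith
    qed
  qed
  fix t :: real assume t: "t \<in> {0..1}"
  have b: "0 \<le> (n + m) * t" "(n + m) * t \<le> n + m" using nm t by (simp_all add: mult_left_le)
  show "walk_path (w' @ w) t = path_then (walk_path w) (walk_path w') (?f t)"
  proof (cases "(n + m) * t \<le> n")
    case True
    define s where "s = (n + m) * t / n"
    have s: "s \<in> {0..1}" "n * s = (n + m) * t" using True b nm by (simp_all add: s_def)
    obtain i where i: "i < length w" "real i \<le> n * s" "n * s \<le> real i + 1"
      using walk_piece_exists[OF is_walkD(1)[OF w] s(1)] unfolding n_def by blast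
    have ft: "?f t = s / 2" unfolding lo[OF True] by (simp add: s_def)
    have "path_then (walk_path w) (walk_path w') (?f t) = walk_path w s"
      unfolding ft using s(1) by (simp add: path_then_def)
    also have "\<dots> = virt_path (rev w ! i) (n * s - i)"
      using walk_path_piece[OF w i(1)] i by (simp add: n_def)
    also have "\<dots> = walk_path (w' @ w) t"
      using walk_path_piece[OF ww, of i t] i unfolding l s(2) by (simp add: nth_append)
    finally show ?thesis by simp
  next
    case False
    define s where "s = ((n + m) * t - n) / m"
    have "(n + m) * t - n \<le> m" using b by linarith
    then have s: "s \<in> {0<..1}" "m * s = (n + m) * t - n" using False nm by (simp_all add: s_def)
    then obtain i where i: "i < length w'" "real i \<le> m * s" "m * s \<le> real i + 1"
      using walk_piece_exists[OF is_walkD(1)[OF w'], of s] unfolding m_def by auto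
    have "n \<le> (n + m) * t" using False by simp
    then have ft: "?f t = 1/2 + s / 2" unfolding hi[OF \<open>n \<le> (n + m) * t\<close>] by (simp add: s_def)
    have "path_then (walk_path w) (walk_path w') (?f t) = walk_path w' s"
      unfolding ft using s(1) by (simp add: path_then_def)
    also have "\<dots> = virt_path (rev w' ! i) (m * s - i)"
      using walk_path_piece[OF w' i(1)] i by (simp add: m_def)
    also have "\<dots> = walk_path (w' @ w) t"
    proof -
      have "rev (w' @ w) ! (length w + i) = rev w' ! i" by (simp add: nth_append)
      moreover have "real (length w + i) = n + real i" by (simp add: n_def)
      moreover have "(n + m) * t = n + m * s" using s(2) by simp
      ultimately show ?thesis
        using walk_path_piece[OF ww, of "length w + i" t] i unfolding l by simp
    qed
    finally show ?thesis by simp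
  qed
qed

section \<open>Base paths along the connector walks\<close>

locale connected_complex = based_category C e
  for C :: "('o, 'k, 'm) kcat" and e :: "'o \<Rightarrow> 'o \<Rightarrow> 'm" +
  fixes c :: 'o and u :: "'o \<Rightarrow> ('o, 'm) virt list" and i :: 'm
  assumes c: "c \<in> Obj C" and u: "x \<in> Obj C \<Longrightarrow> is_walk C c x (u x)" and u_c: "u c = [Pos c c i]"
begin

text \<open>The straight segment to the point within its closed cell, starting at parameter 0 of the
  interval or 1 of the disc; both represent \<open>cell_base\<close>.\<close>

fun seg :: "'o cw_point \<Rightarrow> real \<Rightarrow> 'o cw_point" where
  "seg (Vertex x) t = Vertex x"
| "seg (EdgePt x y s) t = edge_map x y (s * t)"
| "seg (FacePt f z) t = face_map e f (1 - of_real t + of_real t * z)"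

lemma seg_Vertex: "seg (Vertex x) = (\<lambda>_. Vertex x)"
  by auto

definition conn :: "'o cw_point \<Rightarrow> real \<Rightarrow> 'o cw_point" where
  "conn a = path_then (walk_path (u (cell_base e a))) (seg a)"

lemma face_map_1: "f \<in> cw_faces C e \<Longrightarrow> face_map e f 1 = Vertex (face_base e f)"
  using attach_exp[of f 0] walk_path_ends[OF face_boundary_walk] by (simp add: face_map_sphere)

lemma segment_in_disc:
  assumes "norm (z::complex) \<le> 1" "t \<in> {0..1}" shows "norm (1 - of_real t + of_real t * z) \<le> 1"
proof -
  have "norm (1 - of_real t + of_real t * z) \<le> norm (of_real (1 - t) :: complex) + norm (of_real t * z)"
    by (metis norm_triangle_ineq of_real_1 of_real_diff)
  also have "\<dots> \<le> (1 - t) + t * 1"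
    using assms by (intro add_mono) (auto simp: norm_mult mult_left_le simp del: of_real_diff)
  finally show ?thesis by simp
qed

lemma face_segment_path:
  assumes f: "f \<in> cw_faces C e" and z: "norm z \<le> 1"
  shows "path_from_to W (Vertex (face_base e f)) (face_map e f z) (\<lambda>t. face_map e f (1 - of_real t + of_real t * z))"
  using path_from_to_comp[OF face_map_continuous[OF f], of "\<lambda>t. 1 - of_real t + of_real t * z"]
    segment_in_disc[OF z] face_map_1[OF f]
  by (simp add: image_subset_iff continuous_on_add continuous_on_diff continuous_on_mult continuous_on_of_real_id continuous_on_of_real)

lemma seg_path:
  assumes a: "a \<in> cw_points C e"
  shows "cell_base e a \<in> Obj C" "path_from_to W (Vertex (cell_base e a)) a (seg a)"
proof -
  have "cell_base e a \<in> Obj C \<and> path_from_to W (Vertex (cell_base e a)) a (seg a)"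
  proof (cases a)
    case (Vertex x)
    then have "x \<in> Obj C" "seg a = (\<lambda>t. Vertex x)" using a by (auto simp: cw_points_def)
    then show ?thesis using Vertex a by (simp add: path_from_to_const)
  next
    case (EdgePt x y s)
    then have xy: "(x, y) \<in> cw_edges C" and s: "0 < s" "s < 1" using a by (auto simp: cw_points_def)
    have "path_from_to W (edge_map x y (s * 0)) (edge_map x y (s * 1)) (\<lambda>t. edge_map x y (s * t))"
      by (rule path_from_to_comp[OF edge_map_continuous[OF xy], of "\<lambda>t. s * t"])
        (use s in \<open>auto intro!: continuous_intros mult_le_one\<close>)
    moreover have "seg a = (\<lambda>t. edge_map x y (s * t))" using EdgePt by auto
    moreover have "edge_map x y s = a" using s EdgePt by (simp add: edge_map_def)
    ultimately show ?thesis using xy EdgePt by (simp add: cw_edges_def)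
  next
    case (FacePt f z)
    then have f: "f \<in> cw_faces C e" "norm z < 1" using a by (auto simp: cw_points_def)
    moreover have "seg a = (\<lambda>t. face_map e f (1 - of_real t + of_real t * z))" using FacePt by auto
    moreover have "face_map e f z = a" using f FacePt by (simp add: face_map_def)
    ultimately show ?thesis using face_segment_path[of f z] face_base_Obj FacePt by simp
  qed
  then show "cell_base e a \<in> Obj C" "path_from_to W (Vertex (cell_base e a)) a (seg a)" by auto
qed

lemma walk_path_W: "is_walk C x y w \<Longrightarrow> path_from_to W (Vertex x) (Vertex y) (walk_path w)"
  by (rule pathin_graph_CW[OF walk_path_continuous])

lemma walk_path_u_c: "walk_path (u c) = (\<lambda>t. Vertex c)"
  by (auto simp: u_c walk_path_def)

lemma conn_path: "a \<in> cw_points C e \<Longrightarrow> path_from_to W (Vertex c) a (conn a)"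
  unfolding conn_def by (rule path_from_to_then[OF walk_path_W[OF u] seg_path(2)]) (auto dest: seg_path)

lemma vertex_in [simp]: "Vertex x \<in> cw_points C e \<longleftrightarrow> x \<in> Obj C"
  by (auto simp: cw_points_def)

lemma conn_vertex:
  "x \<in> Obj C \<Longrightarrow> path_homotopic W (Vertex c) (Vertex x) (conn (Vertex x)) (walk_path (u x))"
  using path_homotopic_then_const[OF walk_path_W[OF u]] by (simp add: conn_def seg_Vertex)

sublocale based_paths W "Vertex c" conn
proof
  show "path_homotopic W (Vertex c) (Vertex c) (conn (Vertex c)) (\<lambda>_. Vertex c)"
    using conn_vertex[OF c] by (simp add: walk_path_u_c)
qed (auto intro: conn_path)

text \<open>Up to homotopy \<open>conn a\<close> is the base path of \<open>cell_base e a\<close>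
  followed by \<open>seg a\<close>, by construction, so \<open>lam_triv\<close> applies.\<close>

lemma lam_seg:
  assumes a: "a \<in> cw_points C e" shows "lam (seg a) = loop_class W (Vertex c) (\<lambda>_. Vertex c)"
proof (rule lam_triv[OF seg_path(2)[OF a]])
  show "path_homotopic W (Vertex c) a (conn a) (path_then (conn (Vertex (cell_base e a))) (seg a))"
    unfolding conn_def[of a]
    by (rule path_homotopic_then[OF path_homotopic_sym[OF conn_vertex] path_homotopic_refl])
      (use seg_path[OF a] in auto)
qed

text \<open>At vertices the base paths reduce to the connector walks, so a closed-up edge is the
  degree of \<open>e x y\<close> in the grading by the fundamental group. This ties
  \<open>lam\<close> to the walk classes of the statement.\<close>

lemma lam_edge:
  assumes xy: "(x, y) \<in> cw_edges C"
  shows "lam (edge_map x y) = walk_class C e c (walk_inverse (u y) @ [Pos x y (e x y)] @ u x)"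
proof -
  have o: "x \<in> Obj C" "y \<in> Obj C" "x \<noteq> y" "nonzero_mor C x y (e x y)"
    using xy e_nonzero by (auto simp: cw_edges_def)
  have E: "is_walk C x y [Pos x y (e x y)]" using o by (auto simp: is_walk_def)
  have e: "path_from_to W (Vertex x) (Vertex y) (edge_map x y)"
    using edge_map_continuous[OF xy] by (simp add: path_from_to_def pathin_def)
  have eE: "path_homotopic W (Vertex x) (Vertex y) (walk_path [Pos x y (e x y)]) (edge_map x y)"
  proof (rule path_homotopic_equal[OF walk_path_W[OF E]])
    fix t :: real assume "t \<in> {0..1}"
    then show "walk_path [Pos x y (e x y)] t = edge_map x y t"
      using walk_path_piece[OF E, of 0 t] o by simp
  qed
  note wx = walk_path_W[OF u[OF o(1)]] and wy = walk_path_W[OF u[OF o(2)]] and iy = is_walk_inverse[OF u[OF o(2)]]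
  have r: "path_homotopic W (Vertex y) (Vertex c) (walk_path (walk_inverse (u y))) (rev_path (walk_path (u y)))"
    by (rule path_homotopic_equal[OF walk_path_W[OF iy] walk_path_inverse[OF u[OF o(2)]]])
  have "path_homotopic W (Vertex c) (Vertex c) (walk_path (walk_inverse (u y) @ [Pos x y (e x y)] @ u x))
     (path_then (walk_path ([Pos x y (e x y)] @ u x)) (walk_path (walk_inverse (u y))))"
    by (rule path_homotopic_graph_CW[OF walk_path_append[OF is_walk_append[OF u[OF o(1)] E] iy]])
  also have "path_homotopic W (Vertex c) (Vertex c) \<dots>
     (path_then (path_then (conn (Vertex x)) (edge_map x y)) (rev_path (conn (Vertex y))))"
  proof (rule path_homotopic_then)
    have "path_homotopic W (Vertex c) (Vertex y) (walk_path ([Pos x y (e x y)] @ u x))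
       (path_then (walk_path (u x)) (walk_path [Pos x y (e x y)]))"
      by (rule path_homotopic_graph_CW[OF walk_path_append[OF u[OF o(1)] E]])
    also have "path_homotopic W (Vertex c) (Vertex y) \<dots> (path_then (conn (Vertex x)) (edge_map x y))"
      by (rule path_homotopic_then[OF path_homotopic_sym[OF conn_vertex[OF o(1)]] eE])
    finally show "path_homotopic W (Vertex c) (Vertex y) (walk_path ([Pos x y (e x y)] @ u x))
      (path_then (conn (Vertex x)) (edge_map x y))" .
    show "path_homotopic W (Vertex y) (Vertex c) (walk_path (walk_inverse (u y))) (rev_path (conn (Vertex y)))"
      by (rule path_homotopic_trans[OF r path_homotopic_rev[OF path_homotopic_sym[OF conn_vertex[OF o(2)]]]])
  qed
  finally show ?thesis unfolding lam_eq[OF e] walk_class_def by (rule loop_class_eqI[symmetric])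
qed

end

section \<open>Retraction onto the graph\<close>

text \<open>In a convex set a path may be replaced by the detour through a fixed point
  \<open>v\<close>. Thus the segments issuing from a single point control all paths of a
  cell.\<close>

lemma path_homotopic_rev_segments:
  fixes Q :: "'b::real_normed_vector \<Rightarrow> 'a"
  assumes Q: "continuous_map (top_of_set S) T Q" and S: "convex S" and v: "v \<in> S"
    and f: "continuous_on {0..1} f" "f ` {0..1} \<subseteq> S"
  shows "path_homotopic T (Q (f 0)) (Q (f 1)) (\<lambda>t. Q (f t))
    (path_then (rev_path (\<lambda>t. Q ((1 - t) *\<^sub>R v + t *\<^sub>R f 0))) (\<lambda>t. Q ((1 - t) *\<^sub>R v + t *\<^sub>R f 1)))"
proof -
  let ?l = "\<lambda>s t. (1 - t) *\<^sub>R v + t *\<^sub>R s"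
  have l: "path_from_to (top_of_set S) v s (?l s)" if "s \<in> S" for s
    using that v S by (auto simp: path_from_to_top_of_set convex_alt intro!: continuous_intros)
  have S01: "f 0 \<in> S" "f 1 \<in> S" using f(2) by auto
  show ?thesis
  proof (rule path_homotopic_image[OF Q S])
    show "path_from_to (top_of_set S) (f 0) (f 1) f" using f by (simp add: path_from_to_top_of_set)
    show "path_from_to (top_of_set S) (f 0) (f 1) (path_then (rev_path (?l (f 0))) (?l (f 1)))"
      by (rule path_from_to_then[OF path_from_to_rev[OF l[OF S01(1)]] l[OF S01(2)]])
  qed (simp_all add: path_then_def rev_path_def)
qed

definition subpath_of :: "(real \<Rightarrow> 'a) \<Rightarrow> real \<Rightarrow> real \<Rightarrow> real \<Rightarrow> 'a" where
  "subpath_of p a b t = p (a + (b - a) * t)"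

lemma subpath_of_path:
  assumes p: "pathin T p" and ab: "0 \<le> a" "a \<le> b" "b \<le> 1"
  shows "path_from_to T (p a) (p b) (subpath_of p a b)" "subpath_of p a b ` {0..1} \<subseteq> p ` {a..b}"
proof -
  have "a \<le> a + (b - a) * t \<and> a + (b - a) * t \<le> b" if "t \<in> {0..1}" for t
    using that ab mult_left_le[of t "b - a"] by simp
  then have *: "(\<lambda>t. a + (b - a) * t) ` {0..1} \<subseteq> {a..b}" by (simp add: image_subset_iff)
  have "path_from_to T (p (a + (b - a) * 0)) (p (a + (b - a) * 1)) (\<lambda>t. p (a + (b - a) * t))"
  proof (rule path_from_to_comp[OF p[unfolded pathin_def], of "\<lambda>t. a + (b - a) * t"])
    show "(\<lambda>t. a + (b - a) * t) ` {0..1} \<subseteq> {0..1}"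
      by (rule order_trans[OF *]) (use ab in auto)
  qed (intro continuous_intros)
  then show "path_from_to T (p a) (p b) (subpath_of p a b)" by (simp add: subpath_of_def[abs_def])
  show "subpath_of p a b ` {0..1} \<subseteq> p ` {a..b}"
    using * by (auto simp: subpath_of_def)
qed

text \<open>Both sides are images under \<open>p\<close> of paths from \<open>a\<close> to
  \<open>c\<close> in the convex interval \<open>{0..1}\<close>, which spares a formula for the
  change of time.\<close>

lemma subpath_of_split:
  assumes p: "pathin T p" and abc: "0 \<le> a" "a \<le> b" "b \<le> c" "c \<le> 1"
  shows "path_homotopic T (p a) (p c) (path_then (subpath_of p a b) (subpath_of p b c)) (subpath_of p a c)"
proof (rule path_homotopic_image[OF p[unfolded pathin_def]])
  have i: "pathin (top_of_set {0..1}) (\<lambda>t::real. t)" by (simp add: pathin_def)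
  show "path_from_to (top_of_set {0..1}) a c (path_then (subpath_of (\<lambda>t. t) a b) (subpath_of (\<lambda>t. t) b c))"
    by (rule path_from_to_then; rule subpath_of_path(1)[OF i]) (use abc in auto)
  show "path_from_to (top_of_set {0..1}) a c (subpath_of (\<lambda>t. t) a c)"
    by (rule subpath_of_path(1)[OF i]) (use abc in auto)
qed (auto simp: path_then_def subpath_of_def)

context based_category
begin

text \<open>At the centre of a 2-cell, where \<open>norm z = 0\<close>, the values of \<open>radial\<close> are junk.\<close>

fun radial :: "'o cw_point \<Rightarrow> real \<Rightarrow> 'o cw_point" where
  "radial (FacePt f z) t = face_map e f (of_real (1 - t + t / norm z) * z)"
| "radial a t = a"

definition punctured :: "'o cw_point set" where
  "punctured = {a \<in> cw_points C e. \<forall>f. a \<noteq> FacePt f 0}"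

lemma radial_graph: "a \<in> graph_points C \<Longrightarrow> radial a t = a"
  by (auto simp: graph_points_def)

text \<open>Points of the circle rest, and the factor equals 1 there. The formula therefore holds up
  to the boundary of the disc, as continuity on the closed cell requires.\<close>

lemma radial_face_map:
  assumes f: "f \<in> cw_faces C e" and z: "z \<noteq> 0" "norm z \<le> 1"
  shows "radial (face_map e f z) t = face_map e f (of_real (1 - t + t / norm z) * z)"
proof (cases "norm z < 1")
  case True then show ?thesis by (simp add: face_map_def)
next
  case False
  then have "norm z = 1" using z by simp
  then show ?thesis using radial_graph[OF attach_in[OF f]] by (simp add: face_map_sphere)
qed

text \<open>The norm is \<open>(1 - t) * norm z + t\<close>: the point moves linearly along its ray
  and reaches the circle at \<open>t = 1\<close>.\<close>

lemma radial_norm: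
  fixes z :: complex
  assumes z: "z \<noteq> 0" "norm z \<le> 1" and t: "t \<in> {0..1::real}"
  shows "norm (of_real (1 - t + t / norm z) * z) \<le> 1"
proof -
  have "norm (of_real (1 - t + t / norm z) * z) = \<bar>1 - t + t / norm z\<bar> * norm z"
    by (simp only: norm_mult norm_of_real)
  also have "\<dots> = (1 - t + t / norm z) * norm z" using t by simp
  also have "\<dots> = (1 - t) * norm z + t" using z by (simp add: field_simps)
  also have "\<dots> \<le> 1" using z t mult_left_le[of "norm z" "1 - t"] by simp
  finally show ?thesis .
qed

lemma punctured_edge: "(x, y) \<in> cw_edges C \<Longrightarrow> edge_map x y t \<in> punctured"
  using edge_map_in[of x y t] by (auto simp: punctured_def edge_map_def split: if_splits)

lemma punctured_face:
  assumes f: "f \<in> cw_faces C e"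
  shows "{z \<in> cball 0 1. face_map e f z \<in> punctured} = cball 0 1 - {0}"
proof -
  have "face_map e f z \<in> punctured \<longleftrightarrow> z \<noteq> 0" if "norm z \<le> 1" for z
  proof (cases "norm z < 1")
    case True
    then show ?thesis using f by (auto simp: face_map_def punctured_def cw_points_def)
  next
    case False
    then have "face_map e f z \<in> graph_points C" "z \<noteq> 0" using attach_in[OF f] by (auto simp: face_map_sphere)
    then show ?thesis using face_map_in[OF f, of z] by (auto simp: punctured_def graph_points_def)
  qed
  then show ?thesis by auto
qed

lemma punctured_disc_open: "openin (top_of_set (cball 0 1)) (cball 0 1 - {0::complex})"
  by (intro openin_diff closed_subset) auto

lemma punctured_open: "openin W punctured"
  unfolding openin_CW cw_open_def
  using punctured_face punctured_disc_open
  by (auto simp: punctured_def[symmetric] intro!: openin_preimage_whole punctured_edge simp del: atLeastAtMost_iff)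
    (auto simp: punctured_def)

lemma radial_face_continuous:
  assumes f: "f \<in> cw_faces C e"
  shows "continuous_map (top_of_set ((cball 0 1 - {0}) \<times> {0..1})) W (\<lambda>z. radial (face_map e f (fst z)) (snd z))"
proof -
  have "continuous_map (top_of_set ((cball 0 1 - {0}) \<times> {0..1})) W
    (\<lambda>z. face_map e f (of_real (1 - snd z + snd z / norm (fst z)) * fst z))"
  proof (rule continuous_map_real_comp[OF face_map_continuous[OF f]])
    show "(\<lambda>z. of_real (1 - snd z + snd z / norm (fst z)) * fst z) ` ((cball 0 1 - {0}) \<times> {0..1}) \<subseteq> cball (0::complex) 1"
      unfolding image_subset_iff mem_cball_0 by (intro ballI radial_norm) auto
  qed (intro continuous_intros; force)
  then show ?thesis
  proof (rule continuous_map_eq)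
    fix z :: "complex \<times> real" assume "z \<in> topspace (top_of_set ((cball 0 1 - {0}) \<times> {0..1}))"
    then show "face_map e f (of_real (1 - snd z + snd z / norm (fst z)) * fst z) = radial (face_map e f (fst z)) (snd z)"
      by (intro radial_face_map[OF f, symmetric]) auto
  qed
qed

lemma cw_points_cases [consumes 1, case_names Graph Face]:
  assumes "a \<in> cw_points C e"
  obtains "a \<in> graph_points C" | f z where "a = FacePt f z" "f \<in> cw_faces C e" "norm z < 1" "a = face_map e f z"
  using assms unfolding cw_points_def graph_points_def by (auto simp: face_map_def)

lemma radial_point_continuous:
  assumes a: "a \<in> punctured" shows "continuous_map (top_of_set {0..1}) W (radial a)"
proof -
  have "a \<in> cw_points C e" using a by (simp add: punctured_def)
  then show ?thesis
  proof (cases rule: cw_points_cases)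
    case Graph
    then have "radial a = (\<lambda>_. a)" using radial_graph by auto
    then show ?thesis using \<open>a \<in> cw_points C e\<close> by simp
  next
    case (Face f z)
    then have z: "z \<noteq> 0" using a by (auto simp: punctured_def)
    have "continuous_map (top_of_set {0..1}) W (\<lambda>t. radial (face_map e f (fst (z, t))) (snd (z, t)))"
      by (rule continuous_map_real_comp[OF radial_face_continuous[OF Face(2)], where f = "\<lambda>t. (z, t)"])
        (use Face z in \<open>auto intro!: continuous_intros\<close>)
    then show ?thesis using Face(4) by (simp add: eta_contract_eq)
  qed
qed

text \<open>Tubes are checked cell by cell: \<open>radial\<close> is stationary on edges, and on a
  punctured closed disc it is covered by \<open>radial_face_continuous\<close>.\<close>

lemma radial_homotopy:
  assumes p: "pathin W p" "p ` {0..1} \<subseteq> punctured"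
  shows "continuous_map (top_of_set ({0..1} \<times> {0..1})) W (\<lambda>z. radial (p (fst z)) (snd z))"
proof (rule homotopy_from_tubes[OF punctured_open radial_point_continuous _ p])
  fix J V assume J: "compact J" "J \<subseteq> {0..1::real}" and V: "openin W V"
  let ?A = "{a \<in> punctured. \<forall>t\<in>J. radial a t \<in> V}"
  have "openin (top_of_set {0..1}) {s \<in> {0..1}. edge_map x y s \<in> ?A}" if xy: "(x, y) \<in> cw_edges C" for x y
  proof (rule openin_tube[OF _ _ J V])
    have e: "{s \<in> {0..1}. edge_map x y s \<in> punctured} = {0..1}" using punctured_edge[OF xy] by auto
    show "openin (top_of_set {0..1}) {s \<in> {0..1}. edge_map x y s \<in> punctured}" unfolding e by simp
    have "continuous_map (top_of_set ({0..1} \<times> {0..1})) W (\<lambda>z. edge_map x y (fst z))"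
      by (rule continuous_map_real_comp[OF edge_map_continuous[OF xy]]) (auto intro!: continuous_intros)
    then show "continuous_map (top_of_set ({s \<in> {0..1}. edge_map x y s \<in> punctured} \<times> {0..1})) W
       (\<lambda>z. radial (edge_map x y (fst z)) (snd z))"
      unfolding e using radial_graph[OF edge_map_in_graph[OF xy]] by simp
  qed
  moreover have "openin (top_of_set (cball 0 1)) {s \<in> cball 0 1. face_map e f s \<in> ?A}" if f: "f \<in> cw_faces C e" for f
  proof (rule openin_tube[OF _ _ J V])
    show "openin (top_of_set (cball 0 1)) {s \<in> cball 0 1. face_map e f s \<in> punctured}"
      unfolding punctured_face[OF f] by (rule punctured_disc_open)
    show "continuous_map (top_of_set ({s \<in> cball 0 1. face_map e f s \<in> punctured} \<times> {0..1})) W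
       (\<lambda>z. radial (face_map e f (fst z)) (snd z))"
      unfolding punctured_face[OF f] by (rule radial_face_continuous[OF f])
  qed
  ultimately show "openin W ?A" unfolding openin_CW cw_open_def by (auto simp: punctured_def)
qed

text \<open>The end of the push is wanted as a path in \<open>\<G>\<close>, not merely in
  \<open>W\<close>. Continuity into \<open>\<G>\<close> is therefore checked directly on the cells
  of \<open>punctured\<close>; on a disc the map is \<open>attach f (z / norm z)\<close>, to which
  \<open>attach_continuous\<close> applies.\<close>

lemma radial_1_graph:
  assumes p: "pathin W p" "p ` {0..1} \<subseteq> punctured"
  shows "pathin \<G> (\<lambda>s. radial (p s) 1)"
proof -
  have r: "radial (face_map e f z) 1 = attach f (z / norm z)" if "f \<in> cw_faces C e" "z \<noteq> 0" "norm z \<le> 1" for f z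
    using radial_face_map[OF that, of 1] that(2) by (simp add: face_map_sphere norm_divide)
  have rG: "radial a 1 \<in> graph_points C" if a: "a \<in> punctured" for a
  proof -
    have "a \<in> cw_points C e" using a by (simp add: punctured_def)
    then show ?thesis
    proof (cases rule: cw_points_cases)
      case Graph then show ?thesis by (simp add: radial_graph)
    next
      case (Face f z)
      moreover from this have "z \<noteq> 0" using a by (auto simp: punctured_def)
      ultimately show ?thesis using r[of f z] attach_in by simp
    qed
  qed
  have "openin W {a \<in> punctured. radial a 1 \<in> V}" if V: "openin \<G> V" for V
    unfolding openin_CW cw_open_def
  proof (intro conjI ballI)
    show "{a \<in> punctured. radial a 1 \<in> V} \<subseteq> cw_points C e" by (auto simp: punctured_def)
    fix q assume q: "q \<in> cw_edges C"
    obtain x y where xy: "q = (x, y)" by (cases q)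
    have "{t \<in> {0..1}. edge_map x y t \<in> {a \<in> punctured. radial a 1 \<in> V}} = {t \<in> {0..1}. edge_map x y t \<in> V}"
      using q xy by (auto simp: punctured_edge radial_graph edge_map_in_graph)
    then show "case q of (x, y) \<Rightarrow> openin (top_of_set {0..1}) {t \<in> {0..1}. edge_map x y t \<in> {a \<in> punctured. radial a 1 \<in> V}}"
      using q xy V by (auto simp: openin_graph graph_open_def)
  next
    fix f assume f: "f \<in> cw_faces C e"
    have "{z \<in> cball 0 1. face_map e f z \<in> {a \<in> punctured. radial a 1 \<in> V}}
      = {z \<in> {z \<in> cball 0 1. face_map e f z \<in> punctured}. radial (face_map e f z) 1 \<in> V}" by auto
    also have "\<dots> = {z \<in> topspace (top_of_set (cball 0 1 - {0::complex})). attach f (z / norm z) \<in> V}"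
      unfolding punctured_face[OF f] using r[OF f] by auto
    finally have eq: "{z \<in> cball 0 1. face_map e f z \<in> {a \<in> punctured. radial a 1 \<in> V}}
      = {z \<in> topspace (top_of_set (cball 0 1 - {0::complex})). attach f (z / norm z) \<in> V}" .
    have "continuous_map (top_of_set (cball 0 1 - {0::complex})) \<G> (\<lambda>z. attach f (z / norm z))"
      by (rule continuous_map_real_comp[OF attach_continuous[OF f]])
        (auto intro!: continuous_intros simp: norm_divide split: if_splits)
    from openin_continuous_map_preimage[OF this V]
    show "openin (top_of_set (cball 0 1)) {z \<in> cball 0 1. face_map e f z \<in> {a \<in> punctured. radial a 1 \<in> V}}"
      unfolding eq using openin_trans punctured_disc_open by blast
  qed
  then have "continuous_map (subtopology W punctured) \<G> (\<lambda>a. radial a 1)"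
    unfolding continuous_map using rG punctured_open
    by (auto simp: openin_open_subtopology punctured_def Int_def conj_commute)
  moreover have "continuous_map (top_of_set {0..1}) (subtopology W punctured) p"
    using p by (auto simp: pathin_def continuous_map_in_subtopology)
  ultimately show ?thesis
    using continuous_map_compose[of _ "subtopology W punctured" p \<G> "\<lambda>a. radial a 1"] by (simp add: pathin_def o_def)
qed

text \<open>The star of \<open>x\<close> in the graph with every edge cut at its midpoint.
  Half-edges, rather than whole edges, leave each edge point at most one vertex to be pulled
  to.\<close>

definition half_star :: "'o \<Rightarrow> 'o cw_point set" where
  "half_star x = {a \<in> graph_points C. a = Vertex x \<or> (\<exists>y t. a = EdgePt x y t \<and> t < 1/2) \<or> (\<exists>y t. a = EdgePt y x t \<and> t > 1/2)}"

text \<open>Each half-edge shrinks linearly to its nearer vertex. The jump at \<open>s = 1/2\<close>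
  is harmless, as midpoints belong to no \<open>half_star\<close>.\<close>

fun contract :: "'o cw_point \<Rightarrow> real \<Rightarrow> 'o cw_point" where
  "contract (EdgePt x y s) t = edge_map x y (if s < 1/2 then s * (1 - t) else s + t * (1 - s))"
| "contract a t = a"

lemma half_star_edge:
  assumes xy: "(x, y) \<in> cw_edges C"
  shows "{s \<in> {0..1}. edge_map x y s \<in> half_star v} =
    (if v = x then {0..<1/2} else if v = y then {1/2<..1} else {})"
proof -
  have "x \<noteq> y" using xy by (simp add: cw_edges_def)
  moreover have "edge_map x y s \<in> half_star v \<longleftrightarrow> (v = x \<and> s < 1/2) \<or> (v = y \<and> s > 1/2)" if "s \<in> {0..1}" for s
    using that edge_map_in_graph[OF xy, of s] \<open>x \<noteq> y\<close> by (auto simp: half_star_def edge_map_def split: if_splits)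
  ultimately show ?thesis by auto
qed

lemma contract_edge:
  "s \<in> {0..1} \<Longrightarrow> contract (edge_map x y s) t = edge_map x y (if s < 1/2 then s * (1 - t) else s + t * (1 - s))"
  by (auto simp: edge_map_def)

lemma half_star_open: "openin \<G> (half_star x)"
proof -
  have "openin (top_of_set {0..1}) {s \<in> {0..1}. edge_map y z s \<in> half_star x}" if "(y, z) \<in> cw_edges C" for y z
  proof -
    have "{0..<1/2::real} = {0..1} \<inter> {..<1/2}" "{1/2<..1::real} = {0..1} \<inter> {1/2<..}" by auto
    then have "openin (top_of_set {0..1::real}) {0..<1/2}" "openin (top_of_set {0..1::real}) {1/2<..1}"
      by (simp_all only: openin_open_Int open_lessThan open_greaterThan)
    then show ?thesis unfolding half_star_edge[OF that] by simp
  qed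
  then show ?thesis unfolding openin_graph graph_open_def by (auto simp: half_star_def)
qed

lemma contract_edge_continuous:
  assumes xy: "(x, y) \<in> cw_edges C"
  shows "continuous_map (top_of_set ({s \<in> {0..1}. edge_map x y s \<in> half_star v} \<times> {0..1})) \<G>
    (\<lambda>z. contract (edge_map x y (fst z)) (snd z))"
proof -
  have 1: "continuous_map (top_of_set ({0..<1/2} \<times> {0..1})) \<G> (\<lambda>z. contract (edge_map x y (fst z)) (snd z))"
  proof (rule continuous_map_eq)
    show "continuous_map (top_of_set ({0..<1/2} \<times> {0..1})) \<G> (\<lambda>z::real\<times>real. edge_map x y (fst z * (1 - snd z)))"
      by (rule continuous_map_real_comp[OF edge_map_continuous_graph[OF xy], where f = "\<lambda>z. fst z * (1 - snd z)"])
        (auto intro!: continuous_intros mult_le_one)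
  qed (auto simp: contract_edge)
  have 2: "continuous_map (top_of_set ({1/2<..1} \<times> {0..1})) \<G> (\<lambda>z. contract (edge_map x y (fst z)) (snd z))"
  proof (rule continuous_map_eq)
    have "s + t * (1 - s) \<le> 1" if "1/2 < s" "s \<le> 1" "0 \<le> t" "t \<le> 1" for s t :: real
      using that mult_right_mono[of t 1 "1 - s"] by simp
    then show "continuous_map (top_of_set ({1/2<..1} \<times> {0..1})) \<G> (\<lambda>z::real\<times>real. edge_map x y (fst z + snd z * (1 - fst z)))"
      by (intro continuous_map_real_comp[OF edge_map_continuous_graph[OF xy], where f = "\<lambda>z. fst z + snd z * (1 - fst z)"])
        (auto intro!: continuous_intros)
  qed (auto simp: contract_edge)
  show ?thesis unfolding half_star_edge[OF xy] using 1 2 by auto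
qed

lemma graph_points_cases [consumes 1, case_names Vertex Edge]:
  assumes "a \<in> graph_points C"
  obtains x where "x \<in> Obj C" "a = Vertex x" | x y t where "(x, y) \<in> cw_edges C" "0 < t" "t < 1" "a = EdgePt x y t" "a = edge_map x y t"
  using assms unfolding graph_points_def by (auto simp: edge_map_def)

lemma contract_homotopy:
  assumes p: "pathin \<G> p" "p ` {0..1} \<subseteq> half_star v"
  shows "continuous_map (top_of_set ({0..1} \<times> {0..1})) \<G> (\<lambda>z. contract (p (fst z)) (snd z))"
proof (rule homotopy_from_tubes[OF half_star_open _ _ p])
  fix a assume a: "a \<in> half_star v"
  then have "a \<in> graph_points C" by (simp add: half_star_def)
  then show "continuous_map (top_of_set {0..1}) \<G> (contract a)"
  proof (cases rule: graph_points_cases)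
    case (Vertex x)
    then have "contract a = (\<lambda>_. a)" by auto
    then show ?thesis using \<open>a \<in> graph_points C\<close> by simp
  next
    case (Edge x y s)
    have "continuous_map (top_of_set {0..1}) \<G> (\<lambda>t. contract (edge_map x y (fst (s, t))) (snd (s, t)))"
      by (rule continuous_map_real_comp[OF contract_edge_continuous[OF Edge(1)], where f = "\<lambda>t. (s, t)"])
        (use Edge a in \<open>auto intro!: continuous_intros\<close>)
    then show ?thesis using Edge(5) by (simp add: eta_contract_eq)
  qed
next
  fix J V assume J: "compact J" "J \<subseteq> {0..1::real}" and V: "openin \<G> V"
  let ?A = "{a \<in> half_star v. \<forall>t\<in>J. contract a t \<in> V}"
  have "openin (top_of_set {0..1}) {s \<in> {0..1}. edge_map x y s \<in> ?A}" if xy: "(x, y) \<in> cw_edges C" for x y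
    by (rule openin_tube[OF _ contract_edge_continuous[OF xy] J V])
      (use half_star_open[of v] xy in \<open>auto simp: openin_graph graph_open_def\<close>)
  then show "openin \<G> ?A" unfolding openin_graph graph_open_def by (auto simp: half_star_def)
qed

lemma contract_1: "a \<in> half_star v \<Longrightarrow> contract a 1 = Vertex v"
  by (cases a) (auto simp: half_star_def)

text \<open>An open set of coordinates in the interior of an edge is an open set of the graph,
  because the interior meets no other closed edge.\<close>

lemma edge_coordinate_continuous:
  assumes p: "pathin \<G> p" and xy: "(x, y) \<in> cw_edges C"
    and f: "\<And>s. s \<in> {0..1} \<Longrightarrow> p s = EdgePt x y (f s)"
  shows "continuous_on {0..1} f"
proof -
  have "continuous_map (top_of_set {0..1}) euclidean f"
  proof (rule continuous_map_top_of_setI)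
    fix V :: "real set" assume "openin euclidean V"
    then have V: "open V" by simp
    let ?A = "{EdgePt x y t | t. t \<in> V \<inter> {0<..<1}}"
    have "{t \<in> {0..1}. edge_map x' y' t \<in> ?A} = (if x' = x \<and> y' = y then {0..1} \<inter> (V \<inter> {0<..<1}) else {})" for x' y'
      by (auto simp: edge_map_def)
    then have "openin (top_of_set {0..1}) {t \<in> {0..1}. edge_map x' y' t \<in> ?A}" for x' y'
      using V by (simp add: openin_open_Int open_Int)
    then have "openin \<G> ?A" using xy unfolding openin_graph graph_open_def by (auto simp: graph_points_def)
    from openin_continuous_map_preimage[OF p[unfolded pathin_def] this]
    have "openin (top_of_set {0..1}) {s \<in> {0..1}. p s \<in> ?A}" by simp
    moreover have "0 < f s \<and> f s < 1" if "s \<in> {0..1}" for s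
    proof -
      have "p s \<in> graph_points C" using p that by (auto simp: pathin_def continuous_map)
      then show ?thesis using f[OF that] by (auto simp: graph_points_def)
    qed
    then have "{s \<in> {0..1}. p s \<in> ?A} = {s \<in> {0..1}. f s \<in> V}" using f by auto
    ultimately show "openin (top_of_set {0..1}) {s \<in> {0..1}. f s \<in> V}" by simp
  qed simp
  then show ?thesis by simp
qed

definition open_face :: "'o face \<Rightarrow> 'o cw_point set" where
  "open_face f = {FacePt f z | z. norm z < 1}"

text \<open>Attaching maps land in the graph, so the characteristic map of any other cell misses the
  set. This makes the disc coordinate of a path inside one face continuous.\<close>

lemma face_subset_open:
  assumes f: "f \<in> cw_faces C e" and V: "open V"
  shows "openin W {FacePt f z | z. z \<in> V \<inter> ball 0 1}"
proof -
  let ?A = "{FacePt f z | z. z \<in> V \<inter> ball 0 1}"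
  have "{t \<in> {0..1}. edge_map x y t \<in> ?A} = {}" for x y by (auto simp: edge_map_def)
  then have "openin (top_of_set {0..1}) {t \<in> {0..1}. edge_map x y t \<in> ?A}" for x y by (metis openin_empty)
  moreover have "face_map e g z \<in> ?A \<longleftrightarrow> g = f \<and> z \<in> V \<inter> ball 0 1" if "g \<in> cw_faces C e" for g z
    using attach_in[OF that, of z] by (cases "norm z < 1") (auto simp: face_map_def attach_def graph_points_def)
  then have "{z \<in> cball 0 1. face_map e g z \<in> ?A} = (if g = f then cball 0 1 \<inter> (V \<inter> ball 0 1) else {})"
    if "g \<in> cw_faces C e" for g using that by auto
  then have "openin (top_of_set (cball 0 1)) {z \<in> cball 0 1. face_map e g z \<in> ?A}" if "g \<in> cw_faces C e" for g
    using that V by (simp add: openin_open_Int open_Int)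
  ultimately have "cw_open C e ?A"
    unfolding cw_open_def using f by (intro conjI) (auto simp: cw_points_def simp del: mem_Collect_eq atLeastAtMost_iff mem_cball mem_cball_0)
  then show ?thesis by (simp add: openin_CW)
qed

lemma open_face_open: "f \<in> cw_faces C e \<Longrightarrow> openin W (open_face f)"
  using face_subset_open[of f UNIV] by (simp add: open_face_def)

lemma face_coordinate_continuous:
  assumes p: "pathin W p" and g: "g \<in> cw_faces C e"
    and f: "\<And>s. s \<in> {0..1} \<Longrightarrow> p s = FacePt g (f s)"
  shows "continuous_on {0..1} f"
proof -
  have "continuous_map (top_of_set {0..1}) euclidean f"
  proof (rule continuous_map_top_of_setI)
    fix V :: "complex set" assume "openin euclidean V"
    then have V: "open V" by simp
    let ?A = "{FacePt g z | z. z \<in> V \<inter> ball 0 1}"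
    from openin_continuous_map_preimage[OF p[unfolded pathin_def] face_subset_open[OF g V]]
    have "openin (top_of_set {0..1}) {s \<in> {0..1}. p s \<in> ?A}" by simp
    moreover have "norm (f s) < 1" if "s \<in> {0..1}" for s
    proof -
      have "p s \<in> cw_points C e" using p that by (auto simp: pathin_def continuous_map)
      then show ?thesis using f[OF that] by (auto simp: cw_points_def)
    qed
    then have "{s \<in> {0..1}. p s \<in> ?A} = {s \<in> {0..1}. f s \<in> V}" using f by auto
    ultimately show "openin (top_of_set {0..1}) {s \<in> {0..1}. f s \<in> V}" by simp
  qed simp
  then show ?thesis by simp
qed

end

section \<open>Generation by edges\<close>

locale agreeing_homs = connected_complex C e c u i + group G
  for C :: "('o, 'k, 'm) kcat" and e :: "'o \<Rightarrow> 'o \<Rightarrow> 'm" and c u i and G :: "('g, 'h) monoid_scheme" (structure) +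
  fixes \<phi> \<psi> :: "(real \<Rightarrow> 'o cw_point) set \<Rightarrow> 'g"
  assumes hom: "\<phi> \<in> hom (fundamental_group W (Vertex c)) G" "\<psi> \<in> hom (fundamental_group W (Vertex c)) G"
    and agree: "(x, y) \<in> cw_edges C \<Longrightarrow>
      \<phi> (walk_class C e c (walk_inverse (u y) @ [Pos x y (e x y)] @ u x)) =
      \<psi> (walk_class C e c (walk_inverse (u y) @ [Pos x y (e x y)] @ u x))"
begin

text \<open>The closed-up path lies in the equaliser of the two homomorphisms. This survives
  homotopy, concatenation and reversal, and can therefore be established locally.\<close>

definition good :: "(real \<Rightarrow> 'o cw_point) \<Rightarrow> bool" where
  "good q \<longleftrightarrow> \<phi> (lam q) = \<psi> (lam q)"

lemma hom_const:
  "\<phi> (loop_class W (Vertex c) (\<lambda>_. Vertex c)) = \<one>" "\<psi> (loop_class W (Vertex c) (\<lambda>_. Vertex c)) = \<one>"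
  by (rule hom_loop_class_const[OF is_group hom(1)], use c in simp)
     (rule hom_loop_class_const[OF is_group hom(2)], use c in simp)

lemma good_homotopic: "path_homotopic W a b p q \<Longrightarrow> good p \<Longrightarrow> good q"
  by (simp add: good_def lam_cong)

lemma good_cong: "path_from_to W a b p \<Longrightarrow> (\<And>t. t \<in> {0..1} \<Longrightarrow> p t = q t) \<Longrightarrow> good p \<Longrightarrow> good q"
  by (blast intro: good_homotopic path_homotopic_equal)

lemma good_const: "a \<in> cw_points C e \<Longrightarrow> good (\<lambda>_. a)"
  by (simp add: good_def lam_const hom_const)

lemma good_seg: "a \<in> cw_points C e \<Longrightarrow> good (seg a)"
  by (simp add: good_def lam_seg hom_const)

lemma good_then:
  "path_from_to W a b p \<Longrightarrow> path_from_to W b d q \<Longrightarrow> good p \<Longrightarrow> good q \<Longrightarrow> good (path_then p q)"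
  using hom_mult[OF hom(1)] hom_mult[OF hom(2)] by (simp add: good_def lam_then lam_carrier)

lemma good_rev:
  assumes p: "path_from_to W a b p" and g: "good p" shows "good (rev_path p)"
proof -
  note r = path_from_to_rev[OF p]
  have a: "a \<in> topspace W" using p by (auto simp: path_from_to_def dest: path_start_in_topspace)
  have "lam (rev_path p) \<otimes>\<^bsub>fundamental_group W (Vertex c)\<^esub> lam p = loop_class W (Vertex c) (\<lambda>_. Vertex c)"
    using lam_cong[OF path_homotopic_then_rev[OF p]] lam_const[OF a] by (simp add: lam_then[OF p r])
  then have *: "h (lam (rev_path p)) = inv (h (lam p))"
    if h: "h \<in> hom (fundamental_group W (Vertex c)) G" and "h (loop_class W (Vertex c) (\<lambda>_. Vertex c)) = \<one>" for h
    using hom_mult[OF h lam_carrier[OF r] lam_carrier[OF p]] that(2)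
      hom_in_carrier[OF h lam_carrier[OF p]] hom_in_carrier[OF h lam_carrier[OF r]]
    by (metis inv_equality)
  show ?thesis using *[OF hom(1) hom_const(1)] *[OF hom(2) hom_const(2)] g by (simp add: good_def)
qed

text \<open>By \<open>path_homotopic_rev_segments\<close> a path in \<open>S\<close> is, up to
  homotopy, a reversed ray from \<open>v\<close> followed by a ray from \<open>v\<close>.\<close>

lemma good_convex:
  fixes Q :: "'b::real_normed_vector \<Rightarrow> 'o cw_point"
  assumes Q: "continuous_map (top_of_set S) W Q" and S: "convex S" and v: "v \<in> S"
    and rays: "\<And>s. s \<in> S \<Longrightarrow> good (\<lambda>t. Q ((1 - t) *\<^sub>R v + t *\<^sub>R s))"
    and f: "continuous_on {0..1} f" "f ` {0..1} \<subseteq> S"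
  shows "good (\<lambda>t. Q (f t))"
proof -
  have p: "path_from_to W (Q v) (Q s) (\<lambda>t. Q ((1 - t) *\<^sub>R v + t *\<^sub>R s))" if "s \<in> S" for s
  proof -
    have "path_from_to W (Q ((1 - 0) *\<^sub>R v + 0 *\<^sub>R s)) (Q ((1 - 1) *\<^sub>R v + 1 *\<^sub>R s)) (\<lambda>t. Q ((1 - t) *\<^sub>R v + t *\<^sub>R s))"
      by (rule path_from_to_comp[OF Q, where f = "\<lambda>t. (1 - t) *\<^sub>R v + t *\<^sub>R s"])
        (use that v S in \<open>auto simp: convex_alt intro!: continuous_intros\<close>)
    then show ?thesis by simp
  qed
  have s: "f 0 \<in> S" "f 1 \<in> S" using f(2) by auto
  show ?thesis
    by (rule good_homotopic[OF path_homotopic_sym[OF path_homotopic_rev_segments[OF Q S v f]]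
      good_then[OF path_from_to_rev[OF p[OF s(1)]] p[OF s(2)] good_rev[OF p[OF s(1)] rays[OF s(1)]] rays[OF s(2)]]])
qed

lemma good_edge_path:
  assumes xy: "(x, y) \<in> cw_edges C" and f: "continuous_on {0..1} f" "f ` {0..1} \<subseteq> {0..1}"
  shows "good (\<lambda>t. edge_map x y (f t))"
proof (rule good_convex[OF edge_map_continuous[OF xy] _ _ _ f])
  fix s :: real assume s: "s \<in> {0..1}"
  \<comment> \<open>A ray that ends inside the edge is a \<open>seg\<close>, made trivial by the
    choice of base paths. The full edge is the one place where \<open>agree\<close> enters.\<close>
  consider "s = 0" | "0 < s" "s < 1" | "s = 1" using s by fastforce
  then have "good (\<lambda>t. edge_map x y (s * t))"
  proof cases
    case 1
    then show ?thesis using good_const[of "Vertex x"] xy by (simp add: cw_edges_def)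
  next
    case 2
    then have "EdgePt x y s \<in> cw_points C e" using xy by (auto simp: cw_points_def)
    moreover have "seg (EdgePt x y s) = (\<lambda>t. edge_map x y (s * t))" by auto
    ultimately show ?thesis using good_seg by metis
  next
    case 3
    then show ?thesis using agree[OF xy] lam_edge[OF xy] by (simp add: good_def)
  qed
  then show "good (\<lambda>t. edge_map x y ((1 - t) *\<^sub>R 0 + t *\<^sub>R s))" by (simp add: mult.commute)
qed auto

lemma good_virt_path:
  assumes v: "is_virtual C v" and f: "continuous_on {0..1} f" "f ` {0..1} \<subseteq> {0..1}"
  shows "good (\<lambda>t. virt_path v (f t))"
proof (cases v)
  case (Pos x y g)
  then show ?thesis using nonzero_mor_edge[of C x y g] v good_edge_path[of x y f] f good_const[of "Vertex x"]
    by (cases "x = y") auto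
next
  case (Neg x y g)
  have "continuous_on {0..1} (\<lambda>t. 1 - f t)" "(\<lambda>t. 1 - f t) ` {0..1} \<subseteq> {0..1}"
    using f by (auto intro!: continuous_intros)
  then show ?thesis using Neg nonzero_mor_edge[of C x y g] v good_edge_path[of x y "\<lambda>t. 1 - f t"] good_const[of "Vertex x"]
    by (cases "x = y") auto
qed

lemma good_subpath_trans:
  assumes p: "pathin W p" and abc: "0 \<le> r" "r \<le> s" "s \<le> t" "t \<le> 1"
    and g: "good (subpath_of p r s)" "good (subpath_of p s t)"
  shows "good (subpath_of p r t)"
  by (rule good_homotopic[OF subpath_of_split[OF p abc] good_then[OF subpath_of_path(1)[OF p] subpath_of_path(1)[OF p] g]])
    (use abc in auto)

text \<open>Induction on the number of steps, the last of which may be partial. The application is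
  to boundary arcs of 2-cells, which may stop inside an edge.\<close>

lemma good_walk_initial:
  assumes w: "is_walk C x y w" and \<theta>: "\<theta> \<in> {0..1}"
  shows "good (subpath_of (walk_path w) 0 \<theta>)"
proof -
  define n where "n = real (length w)"
  have n: "n > 0" using is_walkD(1)[OF w] by (simp add: n_def)
  have p: "pathin W (walk_path w)" using walk_path_W[OF w] by (simp add: path_from_to_def)
  have "\<forall>\<theta>. 0 \<le> \<theta> \<and> \<theta> \<le> real k / n \<longrightarrow> good (subpath_of (walk_path w) 0 \<theta>)" if "k \<le> length w" for k
    using that
  proof (induction k)
    case 0
    have "subpath_of (walk_path w) 0 0 = (\<lambda>_. Vertex x)" using walk_path_ends[OF w] by (auto simp: subpath_of_def)
    moreover have "x \<in> Obj C"
      using walk_path_ends(1)[OF w] p path_start_in_topspace[of W "walk_path w"] by simp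
    ultimately have "good (subpath_of (walk_path w) 0 0)" using good_const[of "Vertex x"] by simp
    then show ?case by auto
  next
    case (Suc k)
    show ?case
    proof (intro allI impI)
      fix \<theta> assume t: "0 \<le> \<theta> \<and> \<theta> \<le> real (Suc k) / n"
      show "good (subpath_of (walk_path w) 0 \<theta>)"
      proof (cases "\<theta> \<le> real k / n")
        case True then show ?thesis using Suc t by simp
      next
        case False
        have k: "k < length w" using Suc.prems by simp
        have "real (Suc k) / n \<le> 1" using Suc.prems n by (simp add: n_def)
        then have le: "\<theta> \<le> 1" using t by simp
        have b: "real k \<le> n * \<theta>" "n * \<theta> \<le> real k + 1" using False t n by (simp_all add: field_simps)
        have v: "is_virtual C (rev w ! k)" using is_walkD(2)[OF w] nth_mem[of k "rev w"] k by simp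
        let ?f = "\<lambda>t. (n * \<theta> - real k) * t"
        have gv: "good (\<lambda>t. virt_path (rev w ! k) (?f t))"
          by (rule good_virt_path[OF v]) (use b in \<open>auto intro!: continuous_intros mult_le_one\<close>)
        have kn: "0 \<le> real k / n" "real k / n \<le> \<theta>" using n False by auto
        have eq: "subpath_of (walk_path w) (real k / n) \<theta> t = virt_path (rev w ! k) (?f t)" if "t \<in> {0..1}" for t
        proof -
          have "n * (real k / n + (\<theta> - real k / n) * t) = real k + ?f t"
            using n by (simp add: algebra_simps)
          moreover have "0 \<le> ?f t" "?f t \<le> 1" using b that by (auto intro!: mult_le_one)
          ultimately show ?thesis
            using walk_path_piece[OF w k, of "real k / n + (\<theta> - real k / n) * t"] unfolding subpath_of_def n_def[symmetric]
            by simp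
        qed
        note sp = subpath_of_path(1)[OF p kn le]
        have "good (subpath_of (walk_path w) (real k / n) \<theta>)"
          by (rule good_cong[OF path_from_to_cong[OF sp eq] eq[symmetric] gv])
        moreover have "good (subpath_of (walk_path w) 0 (real k / n))" using Suc kn by simp
        ultimately show ?thesis using good_subpath_trans[OF p order_refl kn le] by blast
      qed
    qed
  qed
  from this[of "length w"] show ?thesis using \<theta> n by (simp add: n_def)
qed

lemma good_face_path:
  assumes f: "f \<in> cw_faces C e" and p: "continuous_on {0..1} p" "p ` {0..1} \<subseteq> cball 0 1"
  shows "good (\<lambda>t. face_map e f (p t))"
proof (rule good_convex[OF face_map_continuous[OF f] _ _ _ p, where v = 1])
  fix z :: complex assume z: "z \<in> cball 0 1"
  have "good (\<lambda>t. face_map e f (1 - of_real t + of_real t * z))"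
  proof (cases "norm z < 1")
    case True
    then have "FacePt f z \<in> cw_points C e" using f by (auto simp: cw_points_def)
    moreover have "seg (FacePt f z) = (\<lambda>t. face_map e f (1 - of_real t + of_real t * z))" by auto
    ultimately show ?thesis using good_seg by metis
  next
    case False
    then have z1: "norm z = 1" using z by simp
    \<comment> \<open>A ray from 1 to a point of the circle is homotopic, inside the disc, to the
      arc from 1 to that point, and the arc is an initial piece of the boundary walk.\<close>
    define \<theta> where "\<theta> = Arg2pi z / (2 * pi)"
    have \<theta>: "\<theta> \<in> {0..1}" unfolding \<theta>_def by (rule Arg2pi_unit)
    have ez: "exp (2 * pi * \<i> * \<theta>) = z" unfolding \<theta>_def by (rule exp_Arg2pi[OF z1])
    have "path_homotopic W (face_map e f 1) (face_map e f z) (subpath_of (walk_path (face_boundary e f)) 0 \<theta>)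
        (\<lambda>t. face_map e f (1 - of_real t + of_real t * z))"
    proof (rule path_homotopic_image[OF face_map_continuous[OF f] convex_cball])
      show "path_from_to (top_of_set (cball 0 1)) 1 z (\<lambda>t. exp (2 * pi * \<i> * (\<theta> * t)))"
        using ez by (auto simp: path_from_to_top_of_set mult.assoc norm_exp_i_times intro!: continuous_intros)
      show "path_from_to (top_of_set (cball 0 1)) 1 z (\<lambda>t. 1 - of_real t + of_real t * z)"
        using segment_in_disc z by (auto simp: path_from_to_top_of_set intro!: continuous_intros)
      fix t :: real assume t: "t \<in> {0..1}"
      then have "\<theta> * t \<in> {0..1}" using \<theta> by (auto intro: mult_le_one)
      from attach_exp[OF f this]
      show "subpath_of (walk_path (face_boundary e f)) 0 \<theta> t = face_map e f (exp (2 * pi * \<i> * (\<theta> * t)))"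
        by (subst face_map_sphere) (auto simp: subpath_of_def)
    qed auto
    from good_homotopic[OF this good_walk_initial[OF face_boundary_walk[OF f] \<theta>]] show ?thesis .
  qed
  then show "good (\<lambda>t. face_map e f ((1 - t) *\<^sub>R 1 + t *\<^sub>R z))"
    by (simp add: scaleR_conv_of_real)
qed auto

text \<open>One side of a square is homotopic to the way round along the other three. With
  \<open>K\<close> a deformation, the path at \<open>t = 0\<close> is traded for the deformed path
  at \<open>t = 1\<close> and the tracks of its two endpoints.\<close>

lemma good_square:
  fixes K :: "real \<times> real \<Rightarrow> 'o cw_point"
  assumes K: "continuous_map (top_of_set ({0..1} \<times> {0..1})) W K"
    and l: "good (\<lambda>t. K (0, t))" and t: "good (\<lambda>s. K (s, 1))" and r: "good (\<lambda>t. K (1, t))"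
  shows "good (\<lambda>s. K (s, 0))"
proof -
  let ?S = "{0..1} \<times> {0..1} :: (real \<times> real) set"
  have P: "path_from_to (top_of_set ?S) (f 0) (f 1) f" "path_from_to W (K (f 0)) (K (f 1)) (\<lambda>t. K (f t))"
    if "continuous_on {0..1} f" "f ` {0..1} \<subseteq> ?S" for f
    using that path_from_to_comp[OF K that] by (auto simp: path_from_to_top_of_set)
  have cp: "continuous_on {0..1} (\<lambda>t::real. (a::real, t))" "continuous_on {0..1} (\<lambda>t::real. (t, a::real))" for a
    by (intro continuous_intros)+
  have L: "path_from_to (top_of_set ?S) (0, 0) (0, 1) (\<lambda>t. (0, t))" "path_from_to W (K (0, 0)) (K (0, 1)) (\<lambda>t. K (0, t))"
    using P[of "\<lambda>t. (0, t)"] cp by (simp_all add: image_subset_iff)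
  have T: "path_from_to (top_of_set ?S) (0, 1) (1, 1) (\<lambda>t. (t, 1))" "path_from_to W (K (0, 1)) (K (1, 1)) (\<lambda>t. K (t, 1))"
    using P[of "\<lambda>t. (t, 1)"] cp by (simp_all add: image_subset_iff)
  have R: "path_from_to (top_of_set ?S) (1, 0) (1, 1) (\<lambda>t. (1, t))" "path_from_to W (K (1, 0)) (K (1, 1)) (\<lambda>t. K (1, t))"
    using P[of "\<lambda>t. (1, t)"] cp by (simp_all add: image_subset_iff)
  have "path_homotopic W (K (0, 0)) (K (1, 0))
    (path_then (path_then (\<lambda>t. K (0, t)) (\<lambda>t. K (t, 1))) (rev_path (\<lambda>t. K (1, t)))) (\<lambda>s. K (s, 0))"
  proof (rule path_homotopic_image[OF K])
    show "convex ?S" by (intro convex_Times) auto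
    show "path_from_to (top_of_set ?S) (0, 0) (1, 0) (path_then (path_then (\<lambda>t. (0, t)) (\<lambda>t. (t, 1))) (rev_path (\<lambda>t. (1, t))))"
      by (rule path_from_to_then[OF path_from_to_then[OF L(1) T(1)] path_from_to_rev[OF R(1)]])
    show "path_from_to (top_of_set ?S) (0, 0) (1, 0) (\<lambda>s. (s, 0))"
      using P(1)[of "\<lambda>s. (s, 0)"] cp by (simp add: image_subset_iff)
  qed (auto simp: path_then_def rev_path_def)
  then show ?thesis
    by (rule good_homotopic[OF _ good_then[OF path_from_to_then[OF L(2) T(2)] path_from_to_rev[OF R(2)]
      good_then[OF L(2) T(2) l t] good_rev[OF R(2) r]]])
qed

text \<open>Bisection cuts \<open>p\<close> into subpaths that each stay in one \<open>U\<close>,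
  and \<open>good_subpath_trans\<close> joins them again. \<open>T\<close> stands for the topology
  of the graph or of the complex.\<close>

lemma good_by_cover:
  assumes TW: "\<And>q. pathin T q \<Longrightarrow> pathin W q" and p: "pathin T p"
    and cover: "\<And>t. t \<in> {0..1} \<Longrightarrow> \<exists>U. openin T U \<and> p t \<in> U \<and> (\<forall>q. pathin T q \<longrightarrow> q ` {0..1} \<subseteq> U \<longrightarrow> good q)"
  shows "good p"
proof -
  define Q where "Q a b \<longleftrightarrow> (0 \<le> a \<and> b \<le> 1 \<longrightarrow> good (subpath_of p a b))" for a b
  have "Q 0 1"
  proof (rule Bolzano[where P = Q])
    fix a b d assume "Q a b" "Q b d" "a \<le> b" "b \<le> d"
    then show "Q a d" unfolding Q_def using good_subpath_trans[OF TW[OF p], of a b d] by auto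
  next
    fix x :: real assume x: "0 \<le> x" "x \<le> 1"
    then obtain U where U: "openin T U" "p x \<in> U" "\<And>q. pathin T q \<Longrightarrow> q ` {0..1} \<subseteq> U \<Longrightarrow> good q"
      using cover[of x] by auto
    have "openin (top_of_set {0..1}) {s \<in> topspace (top_of_set {0..1}). p s \<in> U}"
      using openin_continuous_map_preimage[OF p[unfolded pathin_def] U(1)] .
    then obtain d where d: "d > 0" "ball x d \<inter> {0..1} \<subseteq> {s \<in> {0..1}. p s \<in> U}"
      using x U(2) unfolding openin_contains_ball by auto
    have "Q a b" if ab: "a \<le> x" "x \<le> b" "b - a < d" for a b
      unfolding Q_def
    proof
      assume 01: "0 \<le> a \<and> b \<le> 1"
      have "{a..b} \<subseteq> ball x d \<inter> {0..1}" using ab 01 by (auto simp: dist_real_def)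
      then have "p ` {a..b} \<subseteq> U" using d(2) by auto
      then show "good (subpath_of p a b)"
        using subpath_of_path[OF p, of a b] ab 01 by (intro U(3)) (auto simp: path_from_to_def)
    qed
    then show "\<exists>d>0. \<forall>a b. a \<le> x \<and> x \<le> b \<and> b - a < d \<longrightarrow> Q a b" using d(1) by blast
  qed simp
  then show ?thesis unfolding Q_def by (simp add: subpath_of_def[abs_def])
qed

lemma pathin_graph: "pathin \<G> q \<Longrightarrow> pathin W q"
  using pathin_graph_CW[of "q 0" "q 1" q] by (simp add: path_from_to_def)

lemma good_graph_path:
  assumes p: "pathin \<G> p" shows "good p"
proof (rule good_by_cover[OF pathin_graph p])
  fix t :: real assume "t \<in> {0..1}"
  then have "p t \<in> graph_points C" using p by (auto simp: pathin_def continuous_map)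
  then show "\<exists>U. openin \<G> U \<and> p t \<in> U \<and> (\<forall>q. pathin \<G> q \<longrightarrow> q ` {0..1} \<subseteq> U \<longrightarrow> good q)"
  proof (cases rule: graph_points_cases)
    case (Vertex x)
    \<comment> \<open>Inside a half-star the whole path contracts to the vertex, while the tracks of
      its endpoints run along single edges.\<close>
    have "good q" if q: "pathin \<G> q" "q ` {0..1} \<subseteq> half_star x" for q
    proof -
      let ?K = "\<lambda>z. contract (q (fst z)) (snd z)"
      have K: "continuous_map (top_of_set ({0..1} \<times> {0..1})) W ?K"
        using continuous_map_compose[OF contract_homotopy[OF q] graph_CW_continuous] by (simp add: o_def)
      have side: "good (\<lambda>t. contract a t)" if "a \<in> half_star x" for a
      proof -
        have "a \<in> graph_points C" using that by (simp add: half_star_def)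
        then show ?thesis
        proof (cases rule: graph_points_cases)
          case (Vertex y) then show ?thesis using good_const[of "Vertex y"] by simp
        next
          case (Edge y z s)
          have "s + t * (1 - s) \<le> 1" if "0 \<le> t" "t \<le> 1" for t
          proof -
            have "t * (1 - s) \<le> 1 * (1 - s)" using Edge(3) that by (intro mult_right_mono) auto
            then show ?thesis by simp
          qed
          then have "good (\<lambda>t. edge_map y z (if s < 1/2 then s * (1 - t) else s + t * (1 - s)))"
            using Edge by (cases "s < 1/2") (auto intro!: good_edge_path continuous_intros mult_le_one)
          then show ?thesis using Edge(4) by simp
        qed
      qed
      have "good (\<lambda>s. ?K (s, 0))"
      proof (rule good_square[OF K])
        have x: "Vertex x \<in> cw_points C e" using Vertex by simp
        have "Vertex x = ?K (s, 1)" if "s \<in> {0..1}" for s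
          using contract_1[of "q s" x] q(2) that by (simp add: image_subset_iff)
        then show "good (\<lambda>s. ?K (s, 1))"
          by (intro good_cong[OF path_from_to_const _ good_const[OF x]]) (use x in simp_all)
      qed (use side[of "q 0"] side[of "q 1"] q(2) in \<open>simp_all add: image_subset_iff\<close>)
      moreover have "?K (s, 0) = q s" if "s \<in> {0..1}" for s
      proof -
        have "q s \<in> graph_points C" using q(2) that by (simp add: half_star_def image_subset_iff)
        then show ?thesis by (cases rule: graph_points_cases) (auto simp: edge_map_def)
      qed
      moreover have "path_from_to W (?K (0, 0)) (?K (1, 0)) (\<lambda>s. ?K (s, 0))"
        by (rule path_from_to_comp[OF K, where f = "\<lambda>s. (s, 0)"]) (auto intro!: continuous_intros)
      ultimately show ?thesis by (blast intro: good_cong)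
    qed
    moreover have "p t \<in> half_star x" using Vertex \<open>p t \<in> graph_points C\<close> by (simp add: half_star_def)
    ultimately show ?thesis using half_star_open by blast
  next
    case (Edge x y s)
    \<comment> \<open>The open edge; it also covers the midpoint, which no half-star
      contains.\<close>
    let ?U = "{a \<in> graph_points C. \<exists>s. a = EdgePt x y s}"
    have "{t \<in> {0..1}. edge_map x' y' t \<in> ?U} = (if x' = x \<and> y' = y then {0..1} \<inter> {0<..<1} else {})"
      if "(x', y') \<in> cw_edges C" for x' y'
      using edge_map_in_graph[OF that] by (auto simp: edge_map_def split: if_splits)
    then have "openin (top_of_set {0..1}) {t \<in> {0..1}. edge_map x' y' t \<in> ?U}" if "(x', y') \<in> cw_edges C" for x' y'
      using that by (simp add: openin_open_Int)
    then have "openin \<G> ?U" unfolding openin_graph graph_open_def by auto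
    moreover have "good q" if q: "pathin \<G> q" "q ` {0..1} \<subseteq> ?U" for q
    proof -
      define f where "f s = (case q s of EdgePt _ _ r \<Rightarrow> r | _ \<Rightarrow> 0)" for s
      have f: "q s = EdgePt x y (f s) \<and> 0 < f s \<and> f s < 1" if "s \<in> {0..1}" for s
        using q(2) that by (force simp: f_def graph_points_def)
      have c: "continuous_on {0..1} f"
        by (rule edge_coordinate_continuous[OF q(1) Edge(1)]) (use f in blast)
      have "good (\<lambda>s. edge_map x y (f s))"
        by (rule good_edge_path[OF Edge(1) c]) (use f in force)
      moreover have "edge_map x y (f s) = q s" if "s \<in> {0..1}" for s using f[OF that] by (simp add: edge_map_def)
      moreover have "path_from_to W (edge_map x y (f 0)) (edge_map x y (f 1)) (\<lambda>s. edge_map x y (f s))"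
        by (rule path_from_to_comp[OF edge_map_continuous[OF Edge(1)] c]) (use f in force)
      ultimately show ?thesis by (blast intro: good_cong)
    qed
    moreover have "p t \<in> ?U" using Edge \<open>p t \<in> graph_points C\<close> by simp
    ultimately show ?thesis by blast
  qed
qed

text \<open>Under the radial push the endpoints either rest or stay in one closed disc, where
  \<open>good_face_path\<close> applies, and the final path runs in the graph.\<close>

lemma good_punctured_path:
  assumes q: "pathin W q" "q ` {0..1} \<subseteq> punctured" shows "good q"
proof -
  let ?K = "\<lambda>z. radial (q (fst z)) (snd z)"
  note K = radial_homotopy[OF q]
  have side: "good (\<lambda>t. radial a t)" if a: "a \<in> punctured" for a
  proof -
    have "a \<in> cw_points C e" using a by (simp add: punctured_def)
    then show ?thesis
    proof (cases rule: cw_points_cases)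
      case Graph then show ?thesis using good_const[of a] \<open>a \<in> cw_points C e\<close> by (simp add: radial_graph)
    next
      case (Face f z)
      then have z: "z \<noteq> 0" "norm z \<le> 1" using a by (auto simp: punctured_def)
      have "good (\<lambda>t. face_map e f (of_real (1 - t + t / norm z) * z))"
      proof (rule good_face_path[OF Face(2)])
        show "(\<lambda>t. of_real (1 - t + t / norm z) * z) ` {0..1} \<subseteq> cball 0 1"
          unfolding image_subset_iff mem_cball_0 by (intro ballI radial_norm[OF z])
        show "continuous_on {0..1} (\<lambda>t. of_real (1 - t + t / norm z) * z)"
          using z by (intro continuous_intros) auto
      qed
      then show ?thesis unfolding Face(1) radial.simps .
    qed
  qed
  have "good (\<lambda>s. ?K (s, 0))"
  proof (rule good_square[OF K])
    show "good (\<lambda>s. ?K (s, 1))" using good_graph_path[OF radial_1_graph[OF q]] by simp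
  qed (use side[of "q 0"] side[of "q 1"] q(2) in \<open>simp_all add: image_subset_iff\<close>)
  moreover have "?K (s, 0) = q s" if "s \<in> {0..1}" for s
  proof -
    have "q s \<in> cw_points C e" using q(2) that by (simp add: punctured_def image_subset_iff)
    then show ?thesis by (cases rule: cw_points_cases) (auto simp: radial_graph face_map_def)
  qed
  moreover have "path_from_to W (?K (0, 0)) (?K (1, 0)) (\<lambda>s. ?K (s, 0))"
    by (rule path_from_to_comp[OF K, where f = "\<lambda>s. (s, 0)"]) (auto intro!: continuous_intros)
  ultimately show ?thesis by (blast intro: good_cong)
qed

text \<open>The complex is covered by \<open>punctured\<close> and by the open faces, which contain
  the missing centres and are handled by their disc coordinate.\<close>

lemma good_path:
  assumes p: "pathin W p" shows "good p"
proof (rule good_by_cover[OF _ p])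
  fix t :: real assume "t \<in> {0..1}"
  then have pt: "p t \<in> cw_points C e" using p by (auto simp: pathin_def continuous_map)
  show "\<exists>U. openin W U \<and> p t \<in> U \<and> (\<forall>q. pathin W q \<longrightarrow> q ` {0..1} \<subseteq> U \<longrightarrow> good q)"
    using pt
  proof (cases rule: cw_points_cases)
    case Graph
    then have "p t \<in> punctured" using pt by (auto simp: punctured_def graph_points_def)
    then show ?thesis using punctured_open good_punctured_path by blast
  next
    case (Face f z)
    have "good q" if q: "pathin W q" "q ` {0..1} \<subseteq> open_face f" for q
    proof -
      define r where "r s = (case q s of FacePt _ z \<Rightarrow> z | _ \<Rightarrow> 0)" for s
      have r: "q s = FacePt f (r s) \<and> norm (r s) < 1" if "s \<in> {0..1}" for s
        using q(2) that by (force simp: r_def open_face_def)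
      have c: "continuous_on {0..1} r"
        by (rule face_coordinate_continuous[OF q(1) Face(2)]) (use r in blast)
      have r': "r ` {0..1} \<subseteq> cball 0 1" using r by force
      have "face_map e f (r s) = q s" if "s \<in> {0..1}" for s using r[OF that] by (simp add: face_map_def)
      then show ?thesis
        using good_face_path[OF Face(2) c r'] path_from_to_comp[OF face_map_continuous[OF Face(2)] c r'] 
        by (blast intro: good_cong)
    qed
    moreover have "p t \<in> open_face f" using Face by (auto simp: open_face_def)
    ultimately show ?thesis using open_face_open[OF Face(2)] by blast
  qed
qed

lemma homs_agree:
  assumes r: "r \<in> carrier (fundamental_group W (Vertex c))" shows "\<phi> r = \<psi> r"
proof -
  obtain p where p: "path_from_to W (Vertex c) (Vertex c) p" "r = loop_class W (Vertex c) p"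
    using fundamental_group_carrierE[OF r] by blast
  then have "good p" using good_path by (simp add: path_from_to_def)
  then show ?thesis using lam_loop[OF p(1)] p(2) by (simp add: good_def)
qed

end

section \<open>Gradings of Schurian categories\<close>

locale plain_module = module R M for R :: "'k ring" (structure) and M :: "('k, 'm) module"
begin

lemma has_dimension_one_multiples:
  assumes d: "has_dimension R M 0 \<or> has_dimension R M 1" and f: "f \<in> carrier M" "f \<noteq> \<zero>\<^bsub>M\<^esub>"
  shows "\<exists>b\<in>carrier M. \<forall>v\<in>carrier M. \<exists>a\<in>carrier R. v = a \<odot>\<^bsub>M\<^esub> b"
proof -
  obtain n where n: "n = 0 \<or> n = 1" "has_dimension R M n" using d by blast
  from n(2) obtain B where B: "finite B \<and> card B = n \<and> B \<subseteq> carrier M \<and>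
      (\<forall>v \<in> carrier M. \<exists>!a. a \<in> B \<rightarrow>\<^sub>E carrier R \<and> v = (\<Oplus>\<^bsub>M\<^esub>b\<in>B. a b \<odot>\<^bsub>M\<^esub> b))"
    unfolding has_dimension_def by (rule exE)
  have ex: "\<exists>a. a \<in> B \<rightarrow>\<^sub>E carrier R \<and> v = (\<Oplus>\<^bsub>M\<^esub>b\<in>B. a b \<odot>\<^bsub>M\<^esub> b)" if "v \<in> carrier M" for v
    using B that by (blast dest: ex1_implies_ex)
  \<comment> \<open>A nonzero vector excludes the empty basis, that is, dimension 0.\<close>
  have "B \<noteq> {}" using ex[OF f(1)] f(2) by auto
  then obtain b where b: "B = {b}" using B n(1) by (auto simp: card_1_singleton_iff)
  then have bM: "b \<in> carrier M" using B by simp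
  have "\<exists>a\<in>carrier R. v = a \<odot>\<^bsub>M\<^esub> b" if v: "v \<in> carrier M" for v
  proof -
    obtain a where a: "a \<in> {b} \<rightarrow>\<^sub>E carrier R" "v = (\<Oplus>\<^bsub>M\<^esub>b\<in>{b}. a b \<odot>\<^bsub>M\<^esub> b)" using ex[OF v] unfolding b by blast
    have ab: "a b \<in> carrier R" using a(1) by (rule PiE_mem) simp
    have "v = a b \<odot>\<^bsub>M\<^esub> b" using a(2) ab bM by simp
    then show ?thesis using ab by blast
  qed
  then show ?thesis using bM by blast
qed

lemma submodule_carrier: "submodule H R M \<Longrightarrow> x \<in> H \<Longrightarrow> x \<in> carrier M"
  using submoduleE(1) by blast

lemma submodule_zero: "submodule H R M \<Longrightarrow> \<zero>\<^bsub>M\<^esub> \<in> H"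
  using submoduleE(2,4) submodule_carrier smult_l_null by (metis R.zero_closed ex_in_conv)

text \<open>A nonzero \<open>v\<close> is a multiple of a spanning vector \<open>b\<close> by an
  invertible scalar, so \<open>b\<close> lies in \<open>H\<close> as well.\<close>

lemma submodule_dimension_one:
  assumes "field R" and d: "has_dimension R M 0 \<or> has_dimension R M 1"
    and H: "submodule H R M" and v: "v \<in> H" "v \<noteq> \<zero>\<^bsub>M\<^esub>"
  shows "H = carrier M"
proof
  interpret field R by fact
  show "H \<subseteq> carrier M" using submoduleE(1)[OF H] .
  have vM: "v \<in> carrier M" using submodule_carrier[OF H v(1)] .
  obtain b where b: "b \<in> carrier M" "\<forall>v\<in>carrier M. \<exists>a\<in>carrier R. v = a \<odot>\<^bsub>M\<^esub> b"
    using has_dimension_one_multiples[OF d vM v(2)] by blast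
  obtain a where a: "a \<in> carrier R" "v = a \<odot>\<^bsub>M\<^esub> b" using b(2) vM by blast
  then have "a \<noteq> \<zero>" using v(2) b(1) by auto
  then have i: "inv a \<in> carrier R" "inv a \<otimes> a = \<one>" using a(1) by (auto simp: field_Units)
  have "inv a \<odot>\<^bsub>M\<^esub> v = (inv a \<otimes> a) \<odot>\<^bsub>M\<^esub> b" unfolding a(2) by (rule smult_assoc1[symmetric, OF i(1) a(1) b(1)])
  also have "\<dots> = b" unfolding i(2) using b(1) by simp
  finally have bH: "b \<in> H" using submoduleE(4)[OF H i(1) v(1)] by simp
  show "carrier M \<subseteq> H"
  proof
    fix w assume "w \<in> carrier M"
    then obtain k where "k \<in> carrier R" "w = k \<odot>\<^bsub>M\<^esub> b" using b(2) by blast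
    then show "w \<in> H" using submoduleE(4)[OF H _ bH] by simp
  qed
qed

lemma direct_sum_component_exists:
  assumes "field R" and d: "has_dimension R M 0 \<or> has_dimension R M 1"
    and D: "is_direct_sum R M I A (carrier M)" and v: "v \<in> carrier M" "v \<noteq> \<zero>\<^bsub>M\<^esub>"
  shows "\<exists>!s. s \<in> I \<and> A s = carrier M" "\<And>s w. s \<in> I \<Longrightarrow> w \<in> A s \<Longrightarrow> w \<noteq> \<zero>\<^bsub>M\<^esub> \<Longrightarrow> A s = carrier M"
proof -
  have sub: "submodule (A s) R M" if "s \<in> I" for s using D that by (simp add: is_direct_sum_def)
  show whole: "A s = carrier M" if "s \<in> I" "w \<in> A s" "w \<noteq> \<zero>\<^bsub>M\<^esub>" for s w
    using submodule_dimension_one[OF assms(1) d sub] that by blast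
  have "v \<in> {(\<Oplus>\<^bsub>M\<^esub>i\<in>F. a i) | F a. finite F \<and> F \<subseteq> I \<and> (\<forall>i \<in> F. a i \<in> A i)}"
    using D v(1) unfolding is_direct_sum_def by simp
  then obtain F a where F: "finite F" "F \<subseteq> I" "\<And>i. i \<in> F \<Longrightarrow> a i \<in> A i" "v = (\<Oplus>\<^bsub>M\<^esub>i\<in>F. a i)" by blast
  have "\<exists>i\<in>F. a i \<noteq> \<zero>\<^bsub>M\<^esub>"
  proof (rule ccontr)
    assume "\<not> (\<exists>i\<in>F. a i \<noteq> \<zero>\<^bsub>M\<^esub>)"
    then have "(\<Oplus>\<^bsub>M\<^esub>i\<in>F. a i) = (\<Oplus>\<^bsub>M\<^esub>i\<in>F. \<zero>\<^bsub>M\<^esub>)" by (intro M.finsum_cong) auto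
    then show False using F(4) v(2) by simp
  qed
  then obtain s where s: "s \<in> I" "A s = carrier M" using whole F by blast
  have "t = s" if t: "t \<in> I" "A t = carrier M" for t
  proof (rule ccontr)
    assume ne: "t \<noteq> s"
    \<comment> \<open>If two components were the whole space, \<open>v\<close> in one and its
      negative in the other would form a nontrivial relation.\<close>
    let ?a = "\<lambda>i. if i = s then v else \<ominus>\<^bsub>M\<^esub> v"
    have sum0: "(\<Oplus>\<^bsub>M\<^esub>i\<in>{s, t}. ?a i) = \<zero>\<^bsub>M\<^esub>"
      using ne v(1) by (simp add: M.finsum_insert M.r_neg)
    have ind: "\<forall>F a. finite F \<and> F \<subseteq> I \<and> (\<forall>i \<in> F. a i \<in> A i) \<and> (\<Oplus>\<^bsub>M\<^esub>i\<in>F. a i) = \<zero>\<^bsub>M\<^esub> \<longrightarrow>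
        (\<forall>i \<in> F. a i = \<zero>\<^bsub>M\<^esub>)"
      using D unfolding is_direct_sum_def by (elim conjE)
    have "finite {s, t}" "{s, t} \<subseteq> I" "\<forall>i\<in>{s, t}. ?a i \<in> A i" using s t v(1) by simp_all
    with sum0 have "\<forall>i\<in>{s, t}. ?a i = \<zero>\<^bsub>M\<^esub>"
      by (intro spec[OF spec[OF ind, of "{s, t}"], of ?a, THEN mp] conjI)
    then show False using v(2) by simp
  qed
  then show "\<exists>!s. s \<in> I \<and> A s = carrier M" using s by blast
qed

text \<open>The index set is arbitrary, so that the fibre of a homomorphism over any
  \<open>s\<close> is covered, whether or not it contains the degree \<open>r0\<close> in which
  everything is concentrated.\<close>

lemma direct_sum_concentrated:
  "is_direct_sum R M I (\<lambda>r. if r = r0 then carrier M else {\<zero>\<^bsub>M\<^esub>}) (if r0 \<in> I then carrier M else {\<zero>\<^bsub>M\<^esub>})"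
proof -
  let ?A = "\<lambda>r. if r = r0 then carrier M else {\<zero>\<^bsub>M\<^esub>}"
  have sum: "(\<Oplus>\<^bsub>M\<^esub>i\<in>F. a i) = (if r0 \<in> F then a r0 else \<zero>\<^bsub>M\<^esub>)"
    if F: "finite F" "\<forall>i\<in>F. a i \<in> ?A i" for F a
  proof -
    have z: "a i = \<zero>\<^bsub>M\<^esub>" if "i \<in> F" "i \<noteq> r0" for i using bspec[OF F(2) that(1)] that(2) by simp
    show ?thesis
    proof (cases "r0 \<in> F")
      case True
      have "(\<Oplus>\<^bsub>M\<^esub>i\<in>insert r0 (F - {r0}). a i) = a r0 \<oplus>\<^bsub>M\<^esub> (\<Oplus>\<^bsub>M\<^esub>i\<in>F - {r0}. a i)"
        using F z True by (intro M.finsum_insert) (auto split: if_splits)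
      also have "(\<Oplus>\<^bsub>M\<^esub>i\<in>F - {r0}. a i) = (\<Oplus>\<^bsub>M\<^esub>i\<in>F - {r0}. \<zero>\<^bsub>M\<^esub>)"
        using z by (intro M.finsum_cong) auto
      finally show ?thesis using True F(2) by (auto simp: insert_absorb split: if_splits)
    next
      case False
      then have "a i = \<zero>\<^bsub>M\<^esub>" if "i \<in> F" for i using z[OF that] that by blast
      then have "(\<Oplus>\<^bsub>M\<^esub>i\<in>F. a i) = (\<Oplus>\<^bsub>M\<^esub>i\<in>F. \<zero>\<^bsub>M\<^esub>)"
        by (intro M.finsum_cong) auto
      then show ?thesis using False by simp
    qed
  qed
  have "submodule {\<zero>\<^bsub>M\<^esub>} R M" by (rule submoduleI) auto
  then have "\<forall>i\<in>I. submodule (?A i) R M" using carrier_is_submodule by simp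
  moreover have "(if r0 \<in> I then carrier M else {\<zero>\<^bsub>M\<^esub>}) =
    {(\<Oplus>\<^bsub>M\<^esub>i\<in>F. a i) | F a. finite F \<and> F \<subseteq> I \<and> (\<forall>i \<in> F. a i \<in> ?A i)}" (is "?L = ?S")
  proof (intro equalityI subsetI)
    fix w assume w: "w \<in> ?L"
    show "w \<in> ?S"
    proof (cases "r0 \<in> I")
      case True
      then have "w = (\<Oplus>\<^bsub>M\<^esub>i\<in>{r0}. w)" "w \<in> ?A r0" using w by auto
      then show ?thesis using True by (intro CollectI exI[of _ "{r0}"] exI[of _ "\<lambda>_. w"]) auto
    next
      case False
      then have "w = (\<Oplus>\<^bsub>M\<^esub>i\<in>{}. w)" using w by simp
      then show ?thesis by (intro CollectI exI[of _ "{}"] exI[of _ "\<lambda>_. w"]) auto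
    qed
  next
    fix w assume "w \<in> ?S"
    then obtain F a where F: "finite F" "F \<subseteq> I" "\<forall>i\<in>F. a i \<in> ?A i" "w = (\<Oplus>\<^bsub>M\<^esub>i\<in>F. a i)" by blast
    then have "w = (if r0 \<in> F then a r0 else \<zero>\<^bsub>M\<^esub>)" using sum by simp
    moreover have "r0 \<in> F \<Longrightarrow> a r0 \<in> carrier M" using F(3) by auto
    ultimately show "w \<in> ?L" using F(2) by auto
  qed
  moreover have "\<forall>F a. finite F \<and> F \<subseteq> I \<and> (\<forall>i \<in> F. a i \<in> ?A i) \<and> (\<Oplus>\<^bsub>M\<^esub>i\<in>F. a i) = \<zero>\<^bsub>M\<^esub> \<longrightarrow> (\<forall>i \<in> F. a i = \<zero>\<^bsub>M\<^esub>)"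
  proof (intro allI impI ballI)
    fix F a i assume *: "finite F \<and> F \<subseteq> I \<and> (\<forall>i \<in> F. a i \<in> ?A i) \<and> (\<Oplus>\<^bsub>M\<^esub>i\<in>F. a i) = \<zero>\<^bsub>M\<^esub>" and i: "i \<in> F"
    then show "a i = \<zero>\<^bsub>M\<^esub>" using sum[of F a] by (cases "i = r0") (auto split: if_splits)
  qed
  ultimately show ?thesis unfolding is_direct_sum_def by blast
qed

end

section \<open>Degrees of walks and of loop classes for a grading\<close>

locale schurian_grading = k_category K C + based_category C e + G: group \<Gamma>
  for K :: "'k ring" and C :: "('o, 'k, 'm) kcat" and e :: "'o \<Rightarrow> 'o \<Rightarrow> 'm" and \<Gamma> :: "('g, 'h) monoid_scheme" +
  fixes X :: "'g \<Rightarrow> 'o \<Rightarrow> 'o \<Rightarrow> 'm set"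
  assumes schurian: "schurian K C" and grading: "is_grading K C \<Gamma> X"
begin

lemma component_unique:
  assumes f: "nonzero_mor C x y f"
  shows "\<exists>!s. s \<in> carrier \<Gamma> \<and> X s x y = carrier (Mor C x y)"
    "s \<in> carrier \<Gamma> \<Longrightarrow> f \<in> X s x y \<Longrightarrow> X s x y = carrier (Mor C x y)"
proof -
  have o: "x \<in> Obj C" "y \<in> Obj C" "f \<in> carrier (Mor C x y)" "f \<noteq> \<zero>\<^bsub>Mor C x y\<^esub>"
    using f by (auto simp: nonzero_mor_def)
  interpret M: plain_module K "Mor C x y" using mor_space o by (intro plain_module.intro) blast
  have d: "has_dimension K (Mor C x y) 0 \<or> has_dimension K (Mor C x y) 1"
    using schurian o by (auto simp: schurian_def)
  have D: "is_direct_sum K (Mor C x y) (carrier \<Gamma>) (\<lambda>s. X s x y) (carrier (Mor C x y))"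
    using grading o by (auto simp: is_grading_def)
  show "\<exists>!s. s \<in> carrier \<Gamma> \<and> X s x y = carrier (Mor C x y)"
    by (rule M.direct_sum_component_exists(1)[OF field_axioms d D o(3,4)])
  show "X s x y = carrier (Mor C x y)" if "s \<in> carrier \<Gamma>" "f \<in> X s x y"
    using M.direct_sum_component_exists(2)[OF field_axioms d D o(3,4)] that o by blast
qed

lemma degree_of_eq:
  assumes f: "nonzero_mor C x y f" and s: "s \<in> carrier \<Gamma>" "f \<in> X s x y"
  shows "degree_of \<Gamma> X x y f = s"
  unfolding degree_of_def
  using component_unique(1)[OF f] component_unique(2)[OF f] s by (intro the_equality) blast+

lemma component_degree:
  assumes f: "nonzero_mor C x y f"
  shows "degree_of \<Gamma> X x y f \<in> carrier \<Gamma>" "X (degree_of \<Gamma> X x y f) x y = carrier (Mor C x y)"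
proof -
  obtain s where s: "s \<in> carrier \<Gamma>" "X s x y = carrier (Mor C x y)" using component_unique(1)[OF f] by blast
  then have "degree_of \<Gamma> X x y f = s" using degree_of_eq[OF f] f by (simp add: nonzero_mor_def)
  then show "degree_of \<Gamma> X x y f \<in> carrier \<Gamma>" "X (degree_of \<Gamma> X x y f) x y = carrier (Mor C x y)" using s by auto
qed

text \<open>A single component is the whole morphism space, so the degree depends on the pair of
  objects only.\<close>

lemma degree_of_same:
  assumes f: "nonzero_mor C x y f" and g: "nonzero_mor C x y g"
  shows "degree_of \<Gamma> X x y f = degree_of \<Gamma> X x y g"
  using component_degree[OF g] g by (intro degree_of_eq[OF f]) (use f in \<open>auto simp: nonzero_mor_def\<close>)

lemma degree_of_comp:
  assumes f: "nonzero_mor C x y f" and g: "nonzero_mor C y z g" and gf: "Cmp C x y z g f \<noteq> \<zero>\<^bsub>Mor C x z\<^esub>"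
  shows "nonzero_mor C x z (Cmp C x y z g f)"
    "degree_of \<Gamma> X x z (Cmp C x y z g f) = degree_of \<Gamma> X y z g \<otimes>\<^bsub>\<Gamma>\<^esub> degree_of \<Gamma> X x y f"
proof -
  have o: "x \<in> Obj C" "y \<in> Obj C" "z \<in> Obj C" "f \<in> carrier (Mor C x y)" "g \<in> carrier (Mor C y z)"
    using f g by (auto simp: nonzero_mor_def)
  show n: "nonzero_mor C x z (Cmp C x y z g f)"
    using o gf comp_closed by (auto simp: nonzero_mor_def)
  have "Cmp C x y z g f \<in> X (degree_of \<Gamma> X y z g \<otimes>\<^bsub>\<Gamma>\<^esub> degree_of \<Gamma> X x y f) x z"
    using grading o component_degree[OF f] component_degree[OF g] by (auto simp: is_grading_def)
  then show "degree_of \<Gamma> X x z (Cmp C x y z g f) = degree_of \<Gamma> X y z g \<otimes>\<^bsub>\<Gamma>\<^esub> degree_of \<Gamma> X x y f"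
    using component_degree[OF f] component_degree[OF g] by (intro degree_of_eq[OF n]) auto
qed

lemma comp_zero:
  assumes "x \<in> Obj C" "y \<in> Obj C" "z \<in> Obj C" "g \<in> carrier (Mor C y z)"
  shows "Cmp C x y z g \<zero>\<^bsub>Mor C x y\<^esub> = \<zero>\<^bsub>Mor C x z\<^esub>"
proof -
  interpret M: plain_module K "Mor C x y" using mor_space assms by (intro plain_module.intro) blast
  interpret N: plain_module K "Mor C x z" using mor_space assms by (intro plain_module.intro) blast
  have "Cmp C x y z g (\<zero>\<^bsub>K\<^esub> \<odot>\<^bsub>Mor C x y\<^esub> \<zero>\<^bsub>Mor C x y\<^esub>) = \<zero>\<^bsub>K\<^esub> \<odot>\<^bsub>Mor C x z\<^esub> Cmp C x y z g \<zero>\<^bsub>Mor C x y\<^esub>"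
    using assms by (intro comp_smult_right) auto
  then show ?thesis using comp_closed[OF assms(1-3) M.M.zero_closed assms(4)] by simp
qed

text \<open>The identity is nonzero, since \<open>f\<close> composed with it is \<open>f\<close>,
  and it is idempotent, so its degree is an idempotent of the group. The other nonzero endomorphisms
  share that degree.\<close>

lemma degree_of_endo:
  assumes f: "nonzero_mor C x x f" shows "degree_of \<Gamma> X x x f = \<one>\<^bsub>\<Gamma>\<^esub>"
proof -
  have o: "x \<in> Obj C" "f \<in> carrier (Mor C x x)" "f \<noteq> \<zero>\<^bsub>Mor C x x\<^esub>" using f by (auto simp: nonzero_mor_def)
  have "Idn C x \<noteq> \<zero>\<^bsub>Mor C x x\<^esub>"
    using comp_id_right[OF o(1) o(1) o(2)] comp_zero[OF o(1) o(1) o(1) o(2)] o(3) by auto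
  then have i: "nonzero_mor C x x (Idn C x)" using o id_closed by (auto simp: nonzero_mor_def)
  have ii: "Cmp C x x x (Idn C x) (Idn C x) = Idn C x" using comp_id_right[OF o(1) o(1) id_closed[OF o(1)]] .
  have "degree_of \<Gamma> X x x (Idn C x) = degree_of \<Gamma> X x x (Idn C x) \<otimes>\<^bsub>\<Gamma>\<^esub> degree_of \<Gamma> X x x (Idn C x)"
    using degree_of_comp(2)[OF i i] ii i by (simp add: nonzero_mor_def)
  then have "degree_of \<Gamma> X x x (Idn C x) = \<one>\<^bsub>\<Gamma>\<^esub>"
    using component_degree(1)[OF i] G.r_cancel_one' by blast
  then show ?thesis using degree_of_same[OF f i] by simp
qed

text \<open>Putting the unit on the diagonal makes \<open>d_self\<close> hold at every
  \<open>x\<close>, also where the endomorphism space is zero and \<open>e x x\<close> is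
  unconstrained.\<close>

definition edge_degree :: "'o \<Rightarrow> 'o \<Rightarrow> 'g" where
  "edge_degree x y = (if x = y then \<one>\<^bsub>\<Gamma>\<^esub> else degree_of \<Gamma> X x y (e x y))"

lemma degree_of_edge:
  assumes f: "nonzero_mor C x y f" shows "degree_of \<Gamma> X x y f = edge_degree x y"
proof (cases "x = y")
  case True then show ?thesis using degree_of_endo f by (simp add: edge_degree_def)
next
  case False
  have "nonzero_mor C x y (e x y)" using f by (intro e_nonzero) (auto simp: nonzero_mor_def nonzero_space_def)
  then show ?thesis using degree_of_same[OF f] False by (simp add: edge_degree_def)
qed

sublocale graded_complex C e \<Gamma> edge_degree
proof
  show "edge_degree x y \<in> carrier \<Gamma>" if "x \<in> Obj C" "y \<in> Obj C" "nonzero_space C x y" for x y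
    using component_degree(1) degree_of_edge e_nonzero[OF that] by metis
  show "edge_degree x x = \<one>\<^bsub>\<Gamma>\<^esub>" for x by (simp add: edge_degree_def)
  show "edge_degree y z \<otimes>\<^bsub>\<Gamma>\<^esub> edge_degree x y = edge_degree x z"
    if "x \<in> Obj C" "y \<in> Obj C" "z \<in> Obj C" "nonzero_space C x y" "nonzero_space C y z"
      "Cmp C x y z (e y z) (e x y) \<noteq> \<zero>\<^bsub>Mor C x z\<^esub>" for x y z
    using degree_of_comp[OF e_nonzero e_nonzero] degree_of_edge e_nonzero that by metis
qed

lemma virt_degree_eq: "is_virtual C v \<Longrightarrow> virt_degree v = vdegree \<Gamma> X v"
  by (cases v) (auto simp: degree_of_edge)

text \<open>The bridge between algebra and topology: through it the degree of a closed walk in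
  \<open>X\<close> is seen to depend on its homotopy class only.\<close>

lemma path_degree_walk_degree:
  assumes w: "is_walk C x y w" shows "path_degree (walk_path w) = walk_degree \<Gamma> X w"
proof -
  have "\<forall>v\<in>set w. is_virtual C v" using is_walkD(2)[OF w] by blast
  then have "total_degree w = foldr (\<lambda>v g. vdegree \<Gamma> X v \<otimes>\<^bsub>\<Gamma>\<^esub> g) w \<one>\<^bsub>\<Gamma>\<^esub>"
    by (intro foldr_cong) (auto simp: virt_degree_eq)
  then show ?thesis using path_degree_walk[OF w] by (simp add: walk_degree_def)
qed

lemma path_degree_append:
  assumes w: "is_walk C x y w" and w': "is_walk C y z w'"
  shows "path_degree (walk_path (w' @ w)) = path_degree (walk_path w') \<otimes>\<^bsub>\<Gamma>\<^esub> path_degree (walk_path w)"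
  unfolding path_degree_homotopic[OF path_homotopic_graph_CW[OF walk_path_append[OF w w']]]
  by (rule path_degree_then[OF pathin_graph_CW[OF walk_path_continuous[OF w]] pathin_graph_CW[OF walk_path_continuous[OF w']]])

lemma path_degree_walk_inverse:
  assumes w: "is_walk C x y w"
  shows "path_degree (walk_path (walk_inverse w)) = inv\<^bsub>\<Gamma>\<^esub> (path_degree (walk_path w))"
proof -
  have p: "path_from_to (CW C e) (Vertex x) (Vertex y) (walk_path w)"
    by (rule pathin_graph_CW[OF walk_path_continuous[OF w]])
  have "path_degree (walk_path (walk_inverse w)) = path_degree (rev_path (walk_path w))"
    by (rule path_degree_cong[OF pathin_graph_CW[OF walk_path_continuous[OF is_walk_inverse[OF w]]] walk_path_inverse[OF w]])
  then show ?thesis using path_degree_rev p by (simp add: path_from_to_def)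
qed

text \<open>Independent of the representative, as \<open>path_degree\<close> is homotopy invariant.
  Restriction to the carrier makes the map extensional, so that uniqueness is equality of
  functions.\<close>

definition class_degree :: "'o \<Rightarrow> (real \<Rightarrow> 'o cw_point) set \<Rightarrow> 'g" where
  "class_degree c = (\<lambda>r\<in>carrier (pi1_CW C e c). path_degree (SOME p. p \<in> r))"

lemma class_degree_loop:
  assumes p: "path_from_to (CW C e) (Vertex c) (Vertex c) p"
  shows "class_degree c (loop_class (CW C e) (Vertex c) p) = path_degree p"
proof -
  let ?r = "loop_class (CW C e) (Vertex c) p"
  have "p \<in> ?r" using p by (simp add: loop_class_iff path_homotopic_refl)
  then have "(SOME q. q \<in> ?r) \<in> ?r" by (rule someI[of "\<lambda>q. q \<in> ?r"])
  then have "path_degree p = path_degree (SOME q. q \<in> ?r)"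
    unfolding loop_class_iff by (rule path_degree_homotopic)
  then show ?thesis using loop_class_in_carrier[OF p] by (simp add: class_degree_def pi1_CW_def)
qed

lemma class_degree_hom: "class_degree c \<in> hom (pi1_CW C e c) \<Gamma>"
proof (rule homI)
  fix r assume "r \<in> carrier (pi1_CW C e c)"
  then obtain p where p: "path_from_to (CW C e) (Vertex c) (Vertex c) p" "r = loop_class (CW C e) (Vertex c) p"
    unfolding pi1_CW_def by (rule fundamental_group_carrierE)
  then show "class_degree c r \<in> carrier \<Gamma>"
    using class_degree_loop path_degree_closed by (simp add: path_from_to_def)
next
  fix r s assume "r \<in> carrier (pi1_CW C e c)" "s \<in> carrier (pi1_CW C e c)"
  then obtain p q where p: "path_from_to (CW C e) (Vertex c) (Vertex c) p" "r = loop_class (CW C e) (Vertex c) p"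
    and q: "path_from_to (CW C e) (Vertex c) (Vertex c) q" "s = loop_class (CW C e) (Vertex c) q"
    unfolding pi1_CW_def by (metis fundamental_group_carrierE)
  have "r \<otimes>\<^bsub>pi1_CW C e c\<^esub> s = loop_class (CW C e) (Vertex c) (path_then q p)"
    unfolding p(2) q(2) pi1_CW_def by (rule fundamental_group_mult[OF p(1) q(1)])
  then show "class_degree c (r \<otimes>\<^bsub>pi1_CW C e c\<^esub> s) = class_degree c r \<otimes>\<^bsub>\<Gamma>\<^esub> class_degree c s"
    using class_degree_loop[OF path_from_to_then[OF q(1) p(1)]] class_degree_loop[OF p(1)] class_degree_loop[OF q(1)]
      path_degree_then[OF q(1) p(1)] p(2) q(2) by simp
qed

lemma class_degree_walk:
  assumes w: "is_walk C c c w"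
  shows "walk_class C e c w \<in> carrier (pi1_CW C e c)" "class_degree c (walk_class C e c w) = walk_degree \<Gamma> X w"
  using loop_class_in_carrier[OF pathin_graph_CW[OF walk_path_continuous[OF w]]]
    class_degree_loop[OF pathin_graph_CW[OF walk_path_continuous[OF w]]] path_degree_walk_degree[OF w]
  by (simp_all add: walk_class_def pi1_CW_def)

section \<open>The quotient map for fixed connector walks\<close>

context
  fixes c :: 'o and u :: "'o \<Rightarrow> ('o, 'm) virt list"
  assumes c: "c \<in> Obj C" and u: "connector_walks C \<Gamma> X c u"
begin

lemma connector_is_walk: "x \<in> Obj C \<Longrightarrow> is_walk C c x (u x)"
  and connector_degree: "x \<in> Obj C \<Longrightarrow> path_degree (walk_path (u x)) = \<one>\<^bsub>\<Gamma>\<^esub>"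
  using u path_degree_walk_degree by (auto simp: connector_walks_def is_homogeneous_walk_def)

abbreviation "generator x y \<equiv> walk_class C e c (walk_inverse (u y) @ [Pos x y (e x y)] @ u x)"

text \<open>Connector walks have degree one, so only the basis morphism contributes to the degree of
  the closed walk.\<close>

lemma generator_degree:
  assumes "x \<in> Obj C" "y \<in> Obj C" "nonzero_space C x y"
  shows "generator x y \<in> carrier (pi1_CW C e c)" "class_degree c (generator x y) = edge_degree x y"
proof -
  have n: "nonzero_mor C x y (e x y)" by (rule e_nonzero[OF assms])
  then have E: "is_walk C x y [Pos x y (e x y)]" by (simp add: is_walk_def)
  note wx = connector_is_walk[OF assms(1)] and wy = connector_is_walk[OF assms(2)]
  note wE = is_walk_append[OF wx E]
  note w = is_walk_append[OF wE is_walk_inverse[OF wy]]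
  show "generator x y \<in> carrier (pi1_CW C e c)" by (rule class_degree_walk(1)[OF w])
  have d: "edge_degree x y \<in> carrier \<Gamma>" using d_closed assms by simp
  have "class_degree c (generator x y) = path_degree (walk_path (walk_inverse (u y) @ [Pos x y (e x y)] @ u x))"
    using class_degree_walk(2)[OF w] path_degree_walk_degree[OF w] by simp
  also have "\<dots> = inv\<^bsub>\<Gamma>\<^esub> \<one>\<^bsub>\<Gamma>\<^esub> \<otimes>\<^bsub>\<Gamma>\<^esub> (path_degree (walk_path [Pos x y (e x y)]) \<otimes>\<^bsub>\<Gamma>\<^esub> \<one>\<^bsub>\<Gamma>\<^esub>)"
    unfolding path_degree_append[OF wE is_walk_inverse[OF wy]] path_degree_append[OF wx E]
      path_degree_walk_inverse[OF wy] connector_degree[OF assms(1)] connector_degree[OF assms(2)] ..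
  also have "path_degree (walk_path [Pos x y (e x y)]) = edge_degree x y"
    using path_degree_walk[OF E] d by simp
  finally show "class_degree c (generator x y) = edge_degree x y" using d by simp
qed

text \<open>Both gradings concentrate a nonzero space in one degree, and \<open>class_degree\<close>
  maps one degree to the other: the fibre over \<open>s\<close> contains
  \<open>generator x y\<close> exactly if \<open>s\<close> is the degree of \<open>e x y\<close>,
  and exactly then \<open>X s x y\<close> is the whole space.\<close>

lemma Z_grading_quotient:
  assumes xy: "x \<in> Obj C" "y \<in> Obj C" and s: "s \<in> carrier \<Gamma>"
  shows "is_direct_sum K (Mor C x y) {r \<in> carrier (pi1_CW C e c). class_degree c r = s}
     (\<lambda>r. Z_grading C e c u r x y) (X s x y)"
proof -
  interpret M: plain_module K "Mor C x y" using mor_space xy by (intro plain_module.intro) blast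
  let ?I = "{r \<in> carrier (pi1_CW C e c). class_degree c r = s}"
  have sub: "submodule (X s x y) K (Mor C x y)"
    using grading xy s by (auto simp: is_grading_def is_direct_sum_def)
  have "X s x y = (if generator x y \<in> ?I then carrier (Mor C x y) else {\<zero>\<^bsub>Mor C x y\<^esub>})"
  proof (cases "nonzero_space C x y")
    case True
    note g = generator_degree[OF xy True] and n = e_nonzero[OF xy True]
    show ?thesis
    proof (cases "s = edge_degree x y")
      case True
      then show ?thesis using g component_degree[OF n] degree_of_edge[OF n] by simp
    next
      case False
      have "w = \<zero>\<^bsub>Mor C x y\<^esub>" if w: "w \<in> X s x y" for w
      proof (rule ccontr)
        assume "w \<noteq> \<zero>\<^bsub>Mor C x y\<^esub>"
        then have nw: "nonzero_mor C x y w" using xy w M.submodule_carrier[OF sub] by (simp add: nonzero_mor_def)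
        then show False using degree_of_eq[OF nw s w] degree_of_edge[OF nw] False by simp
      qed
      then have "X s x y = {\<zero>\<^bsub>Mor C x y\<^esub>}" using M.submodule_zero[OF sub] by blast
      then show ?thesis using False g(2) by auto
    qed
  next
    \<comment> \<open>Here \<open>e x y\<close> is unconstrained and \<open>generator x y\<close>
      may fail to be a loop class, but in a zero space both alternatives coincide.\<close>
    case False
    then have "carrier (Mor C x y) = {\<zero>\<^bsub>Mor C x y\<^esub>}" using xy by (auto simp: nonzero_space_def nonzero_mor_def)
    moreover from this have "X s x y = {\<zero>\<^bsub>Mor C x y\<^esub>}"
      using M.submodule_carrier[OF sub] M.submodule_zero[OF sub] by blast
    ultimately show ?thesis by simp
  qed
  moreover have "(\<lambda>r. Z_grading C e c u r x y) =
     (\<lambda>r. if r = generator x y then carrier (Mor C x y) else {\<zero>\<^bsub>Mor C x y\<^esub>})"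
    by (simp add: Z_grading_def fun_eq_iff)
  ultimately show ?thesis using M.direct_sum_concentrated[of ?I "generator x y"] by simp
qed

text \<open>The decomposition forces the value: \<open>e x y\<close> lies in the component of degree
  \<open>generator x y\<close> of the finer grading, hence in the component of \<open>X\<close> of
  degree \<open>\<phi> (generator x y)\<close>, and degrees in \<open>X\<close> are unique.\<close>

lemma quotient_generator:
  assumes h: "\<phi> \<in> hom (pi1_CW C e c) \<Gamma>"
    and sum: "\<forall>x \<in> Obj C. \<forall>y \<in> Obj C. \<forall>s \<in> carrier \<Gamma>.
        is_direct_sum K (Mor C x y) {r \<in> carrier (pi1_CW C e c). \<phi> r = s} (\<lambda>r. Z_grading C e c u r x y) (X s x y)"
    and xy: "(x, y) \<in> cw_edges C"
  shows "\<phi> (generator x y) = edge_degree x y"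
proof -
  have o: "x \<in> Obj C" "y \<in> Obj C" "nonzero_space C x y" using xy by (auto simp: cw_edges_def)
  interpret M: plain_module K "Mor C x y" using mor_space o by (intro plain_module.intro) blast
  note n = e_nonzero[OF o]
  note g = generator_degree(1)[OF o]
  define s where "s = \<phi> (generator x y)"
  have s: "s \<in> carrier \<Gamma>" unfolding s_def by (rule hom_in_carrier[OF h g])
  have eM: "e x y \<in> carrier (Mor C x y)" using n by (simp add: nonzero_mor_def)
  have "X s x y = {(\<Oplus>\<^bsub>Mor C x y\<^esub>i\<in>F. a i) | F a. finite F \<and> F \<subseteq> {r \<in> carrier (pi1_CW C e c). \<phi> r = s}
      \<and> (\<forall>i \<in> F. a i \<in> Z_grading C e c u i x y)}"
    using sum o s unfolding is_direct_sum_def by blast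
  moreover have "e x y = (\<Oplus>\<^bsub>Mor C x y\<^esub>i\<in>{generator x y}. e x y)" using eM by simp
  moreover have "e x y \<in> Z_grading C e c u (generator x y) x y" using eM by (simp add: Z_grading_def)
  ultimately have "e x y \<in> X s x y" using g s_def
    by (auto intro!: exI[of _ "{generator x y}"] exI[of _ "\<lambda>_. e x y"])
  then show ?thesis using degree_of_eq[OF n s] degree_of_edge[OF n] by (simp add: s_def)
qed

text \<open>Both maps send \<open>generator x y\<close> to \<open>edge_degree x y\<close> for every
  edge, which is the situation of \<open>agreeing_homs\<close>.\<close>

lemma quotient_unique:
  assumes h: "\<phi> \<in> hom (pi1_CW C e c) \<Gamma>"
    and sum: "\<forall>x \<in> Obj C. \<forall>y \<in> Obj C. \<forall>s \<in> carrier \<Gamma>.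
        is_direct_sum K (Mor C x y) {r \<in> carrier (pi1_CW C e c). \<phi> r = s} (\<lambda>r. Z_grading C e c u r x y) (X s x y)"
    and ext: "\<phi> \<in> extensional (carrier (pi1_CW C e c))"
  shows "\<phi> = class_degree c"
proof -
  interpret agreeing_homs C e c u "Idn C c" \<Gamma> \<phi> "class_degree c"
  proof
    show "u c = [Pos c c (Idn C c)]" using u by (simp add: connector_walks_def)
    show "\<phi> \<in> hom (fundamental_group (CW C e) (Vertex c)) \<Gamma>" using h by (simp add: pi1_CW_def)
    show "class_degree c \<in> hom (fundamental_group (CW C e) (Vertex c)) \<Gamma>"
      using class_degree_hom by (simp add: pi1_CW_def)
    show "\<phi> (generator x y) = class_degree c (generator x y)" if "(x, y) \<in> cw_edges C" for x y
      using quotient_generator[OF h sum that] generator_degree(2)[of x y] that by (auto simp: cw_edges_def)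
  qed (use c connector_is_walk in auto)
  show ?thesis
  proof (rule extensionalityI[OF ext])
    show "class_degree c \<in> extensional (carrier (pi1_CW C e c))" by (simp add: class_degree_def)
    show "\<phi> r = class_degree c r" if "r \<in> carrier (pi1_CW C e c)" for r
      using homs_agree that by (simp add: pi1_CW_def)
  qed
qed

end

end

theorem theorem3p8:
  fixes K :: "'k ring"
    and C :: "('o, 'k, 'm) kcat"
    and e :: "'o \<Rightarrow> 'o \<Rightarrow> 'm"
    and c\<^sub>0 :: 'o
    and \<Gamma> :: "('g, 'h) monoid_scheme"
    and X :: "'g \<Rightarrow> 'o \<Rightarrow> 'o \<Rightarrow> 'm set"
    and u :: "'o \<Rightarrow> ('o, 'm) virt list"
  assumes "k_category K C"
    and "connected_category C"
    and "schurian K C"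
    and "basis_choice C e"
    and "c\<^sub>0 \<in> Obj C"
    and "group \<Gamma>"
    and "is_grading K C \<Gamma> X"
    and "connected_grading C \<Gamma> X"
    and "connector_walks C \<Gamma> X c\<^sub>0 u"
  shows "\<exists>!\<phi>. \<phi> \<in> extensional (carrier (pi1_CW C e c\<^sub>0)) \<and>
           \<phi> \<in> epi (pi1_CW C e c\<^sub>0) \<Gamma> \<and>
           (\<forall>x \<in> Obj C. \<forall>y \<in> Obj C. \<forall>s \<in> carrier \<Gamma>.
              is_direct_sum K (Mor C x y) {r \<in> carrier (pi1_CW C e c\<^sub>0). \<phi> r = s}
                (\<lambda>r. Z_grading C e c\<^sub>0 u r x y) (X s x y))"
proof -
  interpret schurian_grading K C e \<Gamma> X
    using assms by (intro schurian_grading.intro schurian_grading_axioms.intro based_category.intro)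
  \<comment> \<open>Connectedness of the grading provides a closed walk at the base object of any
    given degree \<open>s\<close>; its class is a preimage of \<open>s\<close>.\<close>
  have surj: "carrier \<Gamma> \<subseteq> class_degree c\<^sub>0 ` carrier (pi1_CW C e c\<^sub>0)"
  proof
    fix s assume "s \<in> carrier \<Gamma>"
    then obtain w where w: "is_walk C c\<^sub>0 c\<^sub>0 w" "walk_degree \<Gamma> X w = s"
      using assms(5,8) unfolding connected_grading_def is_homogeneous_walk_def by blast
    then show "s \<in> class_degree c\<^sub>0 ` carrier (pi1_CW C e c\<^sub>0)"
      using class_degree_walk[OF w(1)] by force
  qed
  show ?thesis
  proof (rule ex1I[of _ "class_degree c\<^sub>0"], intro conjI ballI)
    show "class_degree c\<^sub>0 \<in> extensional (carrier (pi1_CW C e c\<^sub>0))" by (simp add: class_degree_def)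
    show "class_degree c\<^sub>0 \<in> epi (pi1_CW C e c\<^sub>0) \<Gamma>"
      using class_degree_hom surj by (auto simp: epi_def dest: hom_in_carrier)
    show "is_direct_sum K (Mor C x y) {r \<in> carrier (pi1_CW C e c\<^sub>0). class_degree c\<^sub>0 r = s}
        (\<lambda>r. Z_grading C e c\<^sub>0 u r x y) (X s x y)" if "x \<in> Obj C" "y \<in> Obj C" "s \<in> carrier \<Gamma>" for x y s
      by (rule Z_grading_quotient[OF assms(5,9) that])
    show "\<phi> = class_degree c\<^sub>0" if "\<phi> \<in> extensional (carrier (pi1_CW C e c\<^sub>0)) \<and> \<phi> \<in> epi (pi1_CW C e c\<^sub>0) \<Gamma> \<and>
      (\<forall>x \<in> Obj C. \<forall>y \<in> Obj C. \<forall>s \<in> carrier \<Gamma>. is_direct_sum K (Mor C x y) {r \<in> carrier (pi1_CW C e c\<^sub>0). \<phi> r = s}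
        (\<lambda>r. Z_grading C e c\<^sub>0 u r x y) (X s x y))" for \<phi>
      using that by (intro quotient_unique[OF assms(5,9)]) (auto simp: epi_def)
  qed
qed

end
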